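(* Let $n>k\ge1$ be coprime integers, $\eta$ in the upper half-plane, $\Lambda=\mathbb{Z}+\mathbb{Z}\eta$. If $\tau\in\mathbb{C}\setminus\frac1{2n}\Lambda$, then: (1) $R_\tau(z)$ is an isomorphism if and only if $z\notin\pm\tau+\frac1n\Lambda$; (2) for all $\zeta\in\frac1n\Lambda$, $\operatorname{im}R_\tau(\tau+\zeta)=\ker R_\tau(-\tau-\zeta)$ and $\operatorname{im}R_\tau(-\tau-\zeta)=\ker R_\tau(\tau+\zeta)$; (3) for every $p\in\mathbb{C}$, the multiplicity of $p$ as a zero of the holomorphic function $z\mapsto\det R_\tau(z)$ equals the nullity of $R_\tau(p)$, and this number is $\binom{n+1}{2}$ if $p\in\tau+\frac1n\Lambda$, $\binom n2$ if $p\in-\tau+\frac1n\Lambda$, and $0$ otherwise. If instead $\tau\in\frac1{2n}\Lambda\setminus\frac1n\Lambda$, then $\dim\ker R_\tau(\tau)=\dim\ker R_\tau(-\tau)\ge\binom{n+1}{2}$.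
   Context: Write $e(z)=e^{2\pi i z}$ and $\theta(z)=\sum_{m\in\mathbb{Z}}(-1)^m e\big(mz+\tfrac12 m(m-1)\eta\big)$. For $\alpha\in\mathbb{Z}$ put $\theta_\alpha(z)=e\big(\alpha z+\tfrac{\alpha}{2n}+\tfrac{\alpha(\alpha-n)}{2n}\eta\big)\prod_{m=0}^{n-1}\theta\big(z+\tfrac mn+\tfrac{\alpha}{n}\eta\big)$, regarded as indexed by $\alpha\in\mathbb{Z}_n$. Let $V$ be an $n$-dimensional complex vector space with basis $x_i$, $i\in\mathbb{Z}_n$. For $\tau\in\mathbb{C}\setminus\frac1n\Lambda$ and $z\in\mathbb{C}$, define $R_\tau(z)\in\mathrm{End}(V\otimes V)$ by $$R_\tau(z)(x_i\otimes x_j)=\frac{\theta_0(-z)\cdots\theta_{n-1}(-z)}{\theta_1(0)\cdots\theta_{n-1}(0)}\sum_{r\in\mathbb{Z}_n}\frac{\theta_{j-i+r(k-1)}(-z+\tau)}{\theta_{j-i-r}(-z)\,\theta_{kr}(\tau)}\,x_{j-r}\otimes x_{i+r}.$$ *)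

theory Defs
  imports "HOL-Complex_Analysis.Complex_Analysis" "Jordan_Normal_Form.Matrix_Kernel" "Jordan_Normal_Form.Determinant"
begin

definition ee :: "complex \<Rightarrow> complex" where
  "ee z = exp (2 * of_real pi * \<i> * z)"

definition theta :: "complex \<Rightarrow> complex \<Rightarrow> complex" where
  "theta \<eta> z = (\<Sum>\<^sub>\<infinity>m\<in>(UNIV::int set).
      (-1) powi m * ee (of_int m * z + of_int (m * (m - 1)) / 2 * \<eta>))"

definition theta_int :: "nat \<Rightarrow> complex \<Rightarrow> int \<Rightarrow> complex \<Rightarrow> complex" where
  "theta_int n \<eta> \<alpha> z =
     ee (of_int \<alpha> * z + of_int \<alpha> / (2 * of_nat n)
         + of_int (\<alpha> * (\<alpha> - int n)) / (2 * of_nat n) * \<eta>)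
     * (\<Prod>m<n. theta \<eta> (z + of_nat m / of_nat n + of_int \<alpha> / of_nat n * \<eta>))"

definition theta_idx :: "nat \<Rightarrow> complex \<Rightarrow> int \<Rightarrow> complex \<Rightarrow> complex" where
  "theta_idx n \<eta> \<alpha> z = theta_int n \<eta> (\<alpha> mod int n) z"

definition lattice_n :: "nat \<Rightarrow> complex \<Rightarrow> complex set" where
  "lattice_n n \<eta> = {(of_int a + of_int b * \<eta>) / of_nat n | a b. True}"

text \<open>Coefficient of x_{j-r} (x) x_{i+r} in R_tau(z)(x_i (x) x_j).  The prefactor
  theta_0(-z)...theta_{n-1}(-z) divided by theta_{j-i-r}(-z) is written as the product over
  the remaining n-1 indices (cancellation of the common factor, giving the holomorphic
  function the paper means).\<close>
definition R_coef :: "nat \<Rightarrow> nat \<Rightarrow> complex \<Rightarrow> complex \<Rightarrow> complex \<Rightarrow> int \<Rightarrow> int \<Rightarrow> int \<Rightarrow> complex" where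
  "R_coef n k \<eta> \<tau> z i j r =
     (\<Prod>\<alpha>\<in>{0..<int n} - {(j - i - r) mod int n}. theta_idx n \<eta> \<alpha> (-z))
     / (\<Prod>\<alpha>\<in>{1..<int n}. theta_idx n \<eta> \<alpha> 0)
     * theta_idx n \<eta> (j - i + r * (int k - 1)) (-z + \<tau>)
     / theta_idx n \<eta> (int k * r) \<tau>"

text \<open>Matrix of R_tau(z) on V (x) V w.r.t. the basis x_i (x) x_j (i, j in Z_n),
  where x_i (x) x_j is the (i*n+j)-th basis vector.\<close>
definition R_mat :: "nat \<Rightarrow> nat \<Rightarrow> complex \<Rightarrow> complex \<Rightarrow> complex \<Rightarrow> complex mat" where
  "R_mat n k \<eta> \<tau> z = mat (n * n) (n * n) (\<lambda>(p, q).
     (let a = int (p div n); b = int (p mod n); i = int (q div n); j = int (q mod n) in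
      if (a + b) mod int n = (i + j) mod int n
      then R_coef n k \<eta> \<tau> z i j ((j - a) mod int n) else 0))"

definition mat_image :: "'a :: comm_ring_1 mat \<Rightarrow> 'a vec set" where
  "mat_image A = {A *\<^sub>v v | v. v \<in> carrier_vec (dim_col A)}"

end

theory Submission
  imports Defs
begin

text \<open>
  Put \<open>X = - n z\<close> and \<open>Y = n \<tau>\<close>. Off the lattice, \<open>R\<close> is a nonzero scalar times a matrix \<open>M(X, Y)\<close> of
  quotients of theta functions, and translating \<open>X\<close> by the lattice multiplies \<open>M\<close> on both sides by
  monomial matrices. A Liouville argument gives the unitarity relation \<open>M(X, Y) M(-X, Y) = 0\<close> whenever
  \<open>X\<close> is congruent to \<open>Y\<close> or \<open>-Y\<close>, so the nullities of \<open>M(Y, Y)\<close> and \<open>M(-Y, Y)\<close> add up to at least \<open>n^2\<close>.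
  On the other hand \<open>det R\<close> is a theta function with exactly \<open>n^2\<close> zeros modulo the lattice, and its order
  at a point is at least the nullity there. Hence the two nullities add up to exactly \<open>n^2\<close>, the orders
  equal the nullities, there are no other zeros, and images equal kernels. The individual nullities are
  semicontinuous with constant sum, hence independent of \<open>Y\<close>; as \<open>Y\<close> tends to 0 the matrices degenerate
  to the flip plus or minus the identity, which have nullities \<open>n choose 2\<close> and \<open>n + 1 choose 2\<close>.
\<close>

text \<open>Two mechanisms lie behind the unitarity relation. Off the diagonal, pole cancellation
  and a nontrivial root of unity kill the sum. On the diagonal each summand is a difference of
  Weierstrass type, which separates into a term in \<open>X\<close> and a term in \<open>Y\<close>;
  summed over the residues both become values of one even function periodic under the whole lattice,
  so they agree when \<open>X\<close> is congruent to \<open>Y\<close> or \<open>-Y\<close>.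

  The degree n^2 comes from the scalar alone: the translations of \<open>M\<close> contribute only
  constants to the determinant, while the scalar has degree one and enters with power n^2. The
  determinant is not identically zero because R is the identity at z = 0.

  The count of zeros needs \<open>Y\<close> and \<open>-Y\<close> to be distinct modulo the lattice,
  which is where \<open>\<tau>\<close> outside the half-lattice enters. On the half-lattice only
  semicontinuity survives, together with the fact that \<open>Y\<close> and \<open>-Y\<close> then
  differ by a lattice translation.

  No kernel is ever described at a generic point. The limit at \<open>Y = 0\<close> supplies two
  upper bounds for the nullities, and these suffice because they add up to n^2.\<close>

unbundle no vec_syntax
unbundle no inner_syntax

subsection \<open>Nullity of square matrices\<close>

text \<open>Vectors are bare functions on indices: equations for chosen coordinates and equations
  coming from rows can then be mixed in one system without carrier conditions.\<close>

definition kernel_fun :: "nat \<Rightarrow> 'a::field mat \<Rightarrow> (nat \<Rightarrow> 'a) \<Rightarrow> bool" where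
  "kernel_fun m A v \<longleftrightarrow> (\<forall>i<m. (\<Sum>j<m. A $$ (i,j) * v j) = 0)"

lemma kernel_fun_index: "kernel_fun m A v \<Longrightarrow> i < m \<Longrightarrow> (\<Sum>j<m. A $$ (i,j) * v j) = 0"
  unfolding kernel_fun_def by blast

lemma mult_mat_vec_sum:
  assumes "A \<in> carrier_mat m m" "v \<in> carrier_vec m" "i < m"
  shows "(A *\<^sub>v v) $ i = (\<Sum>j<m. A $$ (i,j) * v $ j)"
  using assms by (auto simp: scalar_prod_def atLeast0LessThan intro!: sum.cong)

lemma kernel_fun_vec:
  assumes "A \<in> carrier_mat m m" "v \<in> carrier_vec m"
  shows "A *\<^sub>v v = 0\<^sub>v m \<longleftrightarrow> kernel_fun m A (\<lambda>j. v $ j)"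
proof
  assume "A *\<^sub>v v = 0\<^sub>v m"
  thus "kernel_fun m A (\<lambda>j. v $ j)"
    unfolding kernel_fun_def using mult_mat_vec_sum[OF assms] by (metis index_zero_vec(1))
next
  assume k: "kernel_fun m A (\<lambda>j. v $ j)"
  show "A *\<^sub>v v = 0\<^sub>v m"
    using k mult_mat_vec_sum[OF assms] assms unfolding kernel_fun_def
    by (intro eq_vecI) auto
qed

lemma det_zero_iff_kernel_fun:
  fixes A :: "'a::field mat"
  assumes "A \<in> carrier_mat m m"
  shows "det A = 0 \<longleftrightarrow> (\<exists>v. (\<exists>j<m. v j \<noteq> 0) \<and> kernel_fun m A v)"
proof
  assume "det A = 0"
  then obtain v where v: "v \<in> carrier_vec m" "v \<noteq> 0\<^sub>v m" "A *\<^sub>v v = 0\<^sub>v m"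
    using det_0_iff_vec_prod_zero_field[OF assms] by blast
  have "\<exists>j<m. v $ j \<noteq> 0"
  proof (rule ccontr)
    assume "\<not> ?thesis"
    hence "v = 0\<^sub>v m" using v(1) by (intro eq_vecI) auto
    thus False using v by simp
  qed
  thus "\<exists>v. (\<exists>j<m. v j \<noteq> 0) \<and> kernel_fun m A v"
    using v kernel_fun_vec[OF assms v(1)] by (intro exI[of _ "\<lambda>j. v $ j"]) auto
next
  assume "\<exists>v. (\<exists>j<m. v j \<noteq> 0) \<and> kernel_fun m A v"
  then obtain v where v: "\<exists>j<m. v j \<noteq> 0" "kernel_fun m A v" by blast
  have k: "kernel_fun m A (\<lambda>j. vec m v $ j)"
    using v(2) unfolding kernel_fun_def by simp
  have "A *\<^sub>v vec m v = 0\<^sub>v m"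
    using kernel_fun_vec[OF assms, of "vec m v"] k by simp
  moreover have "vec m v \<noteq> 0\<^sub>v m" using v(1) by (metis index_vec index_zero_vec(1))
  ultimately show "det A = 0"
    unfolding det_0_iff_vec_prod_zero_field[OF assms] by (intro exI[of _ "vec m v"]) auto
qed

text \<open>Padding the equations by zero rows gives a square matrix. At least one such row exists,
  and every product in the Leibniz formula contains an entry of it, so the determinant
  vanishes.\<close>

lemma underdetermined:
  fixes f :: "'i \<Rightarrow> nat \<Rightarrow> 'a::field"
  assumes "finite I" "card I < m"
  shows "\<exists>v. (\<exists>j<m. v j \<noteq> 0) \<and> (\<forall>i\<in>I. (\<Sum>j<m. f i j * v j) = 0)"
proof -
  obtain xs where xs: "set xs = I" "distinct xs" using finite_distinct_list[OF assms(1)] by blast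
  hence len: "length xs < m" using assms(2) distinct_card by fastforce
  let ?N = "mat m m (\<lambda>(i,j). if i < length xs then f (xs ! i) j else 0)"
  have "det ?N = 0"
  proof -
    have "(\<Prod>i = 0..<m. ?N $$ (i, p i)) = 0" if "p permutes {0..<m}" for p
    proof (rule prod_zero)
      have "p (length xs) < m" using that len permutes_in_image[OF that, of "length xs"] by simp
      hence "?N $$ (length xs, p (length xs)) = 0" using len by simp
      thus "\<exists>i\<in>{0..<m}. ?N $$ (i, p i) = 0" using len by (intro bexI[of _ "length xs"]) simp_all
    qed simp
    hence "(\<Sum>p\<in>{p. p permutes {0..<m}}. signof p * (\<Prod>i = 0..<m. ?N $$ (i, p i))) = 0"
      by (intro sum.neutral) auto
    thus ?thesis by (subst det_def'[of _ m]) auto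
  qed
  then obtain v where v: "\<exists>j<m. v j \<noteq> 0" "kernel_fun m ?N v"
    using det_zero_iff_kernel_fun[of ?N m] by auto
  have "(\<Sum>j<m. f i j * v j) = 0" if "i \<in> I" for i
  proof -
    have "i \<in> set xs" using that xs by simp
    then obtain l where l: "l < length xs" "xs ! l = i" unfolding in_set_conv_nth by blast
    have "(\<Sum>j<m. ?N $$ (l,j) * v j) = 0"
      by (rule kernel_fun_index[OF v(2)]) (use l len in simp)
    thus ?thesis using l len by simp
  qed
  thus ?thesis using v(1) by blast
qed

text \<open>In the applications one family prescribes coordinates to be zero, written as unit rows,
  and the other expresses a condition on a matrix.\<close>

lemma underdetermined2:
  fixes f :: "'i \<Rightarrow> nat \<Rightarrow> 'a::field"
  assumes "finite I" "finite J" "card I + card J < m"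
  shows "\<exists>v. (\<exists>j<m. v j \<noteq> 0) \<and> (\<forall>i\<in>I. (\<Sum>j<m. f i j * v j) = 0) \<and> (\<forall>i\<in>J. (\<Sum>j<m. g i j * v j) = 0)"
proof -
  obtain v where v: "\<exists>j<m. v j \<noteq> 0" "\<forall>i\<in>I <+> J. (\<Sum>j<m. (case_sum f g) i j * v j) = 0"
    using underdetermined[of "I <+> J" m "case_sum f g"] assms by (auto simp: card_Plus)
  have "(\<Sum>j<m. f i j * v j) = 0" if "i \<in> I" for i using v(2)[rule_format, of "Inl i"] that by auto
  moreover have "(\<Sum>j<m. g i j * v j) = 0" if "i \<in> J" for i
    using v(2)[rule_format, of "Inr i"] that by auto
  ultimately show ?thesis using v(1) by blast
qed

lemma sum_unit: "(\<Sum>j<m. (if j = (s::nat) then 1 else 0) * v j) = (if s < m then v s else (0::'a::field))"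
  by (simp add: if_distrib[of "\<lambda>x. x * _"] sum.delta cong: if_cong)

text \<open>\<open>P\<close> is the row transformation of Gauss-Jordan elimination, \<open>Z\<close>
  the set of zero rows of the reduced matrix and \<open>S\<close> the set of its non-pivot columns.
  Both sets have the size of the nullity, and a solution is determined by its free coordinates,
  those in \<open>S\<close>.\<close>

lemma echelon:
  fixes A :: "'a::field mat"
  assumes A: "A \<in> carrier_mat m m"
  obtains P Z S where "P \<in> carrier_mat m m" "det P \<noteq> 0" "Z \<subseteq> {..<m}" "card Z = kernel_dim A"
    "\<And>i j. i \<in> Z \<Longrightarrow> j < m \<Longrightarrow> (P * A) $$ (i,j) = 0"
    "S \<subseteq> {..<m}" "card S = kernel_dim A"
    "\<And>v j. (\<And>i. i < m \<Longrightarrow> i \<notin> Z \<Longrightarrow> (\<Sum>j<m. (P * A) $$ (i,j) * v j) = 0) \<Longrightarrow>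
       (\<And>s. s \<in> S \<Longrightarrow> v s = 0) \<Longrightarrow> j < m \<Longrightarrow> v j = 0"
proof -
  let ?B = "gauss_jordan_single A"
  from gauss_jordan_single[OF A refl]
  obtain P Q where AB: "?B = P * A" and QP: "Q * P = 1\<^sub>m m" and
    P: "P \<in> carrier_mat m m" and Q: "Q \<in> carrier_mat m m" and B: "?B \<in> carrier_mat m m"
    and row: "row_echelon_form ?B" by auto
  have kd: "kernel_dim A = m - card {i. i < m \<and> row ?B i \<noteq> 0\<^sub>v m}"
    using mat_kernel_mult_eq[OF A P Q QP, folded AB] find_base_vectors(6)[OF row B] A
    unfolding kernel_dim_def by auto
  have detP: "det P \<noteq> 0" using det_mult[OF Q P] QP by auto
  let ?N = "{i. i < m \<and> row ?B i \<noteq> 0\<^sub>v m}"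
  define Z where "Z = {..<m} - ?N"
  have cZ: "card Z = kernel_dim A" unfolding Z_def kd by (subst card_Diff_subset) auto
  have zero: "?B $$ (i,j) = 0" if "i \<in> Z" "j < m" for i j
  proof -
    have "i < m" "row ?B i = 0\<^sub>v m" using that unfolding Z_def by auto
    thus ?thesis using B that by (metis carrier_matD(1) carrier_matD(2) index_row(1) index_zero_vec(1))
  qed
  obtain p where pf: "pivot_fun ?B p m" using row B unfolding row_echelon_form_def by auto
  note pv = pivot_funD[OF _ pf, of m, OF carrier_matD(1)[OF B]]
  have pN: "p i < m" if "i \<in> ?N" for i
  proof (rule ccontr)
    assume "\<not> p i < m"
    hence "row ?B i = 0\<^sub>v m" using pv(2)[of i] that B by (intro eq_vecI) auto
    thus False using that by auto
  qed
  have inj: "inj_on p ?N"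
  proof (rule inj_onI)
    fix i i' assume i: "i \<in> ?N" "i' \<in> ?N" "p i = p i'"
    show "i = i'"
    proof (rule ccontr)
      assume "i \<noteq> i'"
      hence "?B $$ (i', p i) = 0" using pv(5)[of i i'] pN[OF i(1)] i by auto
      moreover have "?B $$ (i', p i') = 1" using pv(4)[of i'] pN[OF i(2)] i by auto
      ultimately show False using i by simp
    qed
  qed
  define S where "S = {..<m} - p ` ?N"
  have cS: "card S = kernel_dim A" unfolding S_def kd
    using pN by (subst card_Diff_subset) (auto simp: card_image[OF inj])
  have ker: "v j = 0" if v: "\<And>i. i < m \<Longrightarrow> i \<notin> Z \<Longrightarrow> (\<Sum>j<m. ?B $$ (i,j) * v j) = 0"
     and vS: "\<And>s. s \<in> S \<Longrightarrow> v s = 0" and j: "j < m" for v j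
  proof (cases "j \<in> S")
    case False
    then obtain i where i: "i \<in> ?N" "j = p i" using j unfolding S_def by auto
    \<comment> \<open>In the row of the pivot \<open>j\<close> all other pivot columns are zero, and
      \<open>v\<close> vanishes on the free columns, so the equation of that row reads
      \<open>v j = 0\<close>.\<close>
    have "(\<Sum>l<m. ?B $$ (i,l) * v l) = (\<Sum>l<m. if l = j then v j else 0)"
    proof (rule sum.cong[OF refl])
      fix l assume l: "l \<in> {..<m}"
      show "?B $$ (i,l) * v l = (if l = j then v j else 0)"
      proof (cases "l \<in> S")
        case True
        thus ?thesis using vS False by auto
      next
        case nS: False
        then obtain i' where i': "i' \<in> ?N" "l = p i'" using l unfolding S_def by auto
        show ?thesis
        proof (cases "i' = i")
          case True
          thus ?thesis using i i' pv(4)[of i] pN[OF i(1)] by auto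
        next
          case False
          hence "?B $$ (i, l) = 0" using pv(5)[of i' i] pN[OF i'(1)] i i' by auto
          moreover have "l \<noteq> j" using False inj i i' by (auto dest: inj_onD)
          ultimately show ?thesis by simp
        qed
      qed
    qed
    also have "\<dots> = v j" using j by simp
    finally show ?thesis using v[of i] i unfolding Z_def by auto
  qed (use vS in auto)
  show thesis
  proof (rule that[OF P detP, of Z S])
    show "Z \<subseteq> {..<m}" "S \<subseteq> {..<m}" unfolding Z_def S_def by auto
    show "(P * A) $$ (i,j) = 0" if "i \<in> Z" "j < m" for i j using zero[OF that] AB by simp
    show "v j = 0" if "\<And>i. i < m \<Longrightarrow> i \<notin> Z \<Longrightarrow> (\<Sum>j<m. (P * A) $$ (i,j) * v j) = 0"
      "\<And>s. s \<in> S \<Longrightarrow> v s = 0" "j < m" for v j using ker[of v j] that AB by simp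
  qed (use cZ cS in auto)
qed

lemma kernel_fun_mult:
  fixes A P :: "'a::field mat"
  assumes "A \<in> carrier_mat m m" "P \<in> carrier_mat m m" "kernel_fun m A v"
  shows "kernel_fun m (P * A) v"
  unfolding kernel_fun_def
proof (intro allI impI)
  fix i assume i: "i < m"
  have "(\<Sum>j<m. (P * A) $$ (i,j) * v j) = (\<Sum>j<m. (\<Sum>l<m. P $$ (i,l) * A $$ (l,j)) * v j)"
    using assms i by (intro sum.cong refl) (auto simp: scalar_prod_def atLeast0LessThan)
  also have "\<dots> = (\<Sum>l<m. P $$ (i,l) * (\<Sum>j<m. A $$ (l,j) * v j))"
    by (subst sum_distrib_left) (subst sum.swap, simp add: sum_distrib_right mult.assoc)
  also have "\<dots> = 0" using assms(3) unfolding kernel_fun_def by simp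
  finally show "(\<Sum>j<m. (P * A) $$ (i,j) * v j) = 0" .
qed

text \<open>Together with \<open>kernel_dim_le\<close> this describes the nullity as the least size
  of a set of coordinates that detects kernel elements, in the sense that a kernel element vanishing
  on it is zero. Most nullity estimates below only handle such sets.\<close>

lemma kernel_dim_witness:
  fixes A :: "'a::field mat"
  assumes A: "A \<in> carrier_mat m m"
  obtains S where "S \<subseteq> {..<m}" "card S = kernel_dim A"
    "\<And>v j. kernel_fun m A v \<Longrightarrow> (\<And>s. s \<in> S \<Longrightarrow> v s = 0) \<Longrightarrow> j < m \<Longrightarrow> v j = 0"
proof -
  obtain P Z S where e: "P \<in> carrier_mat m m" "det P \<noteq> 0" "Z \<subseteq> {..<m}" "card Z = kernel_dim A"
    "\<And>i j. i \<in> Z \<Longrightarrow> j < m \<Longrightarrow> (P * A) $$ (i,j) = 0"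
    "S \<subseteq> {..<m}" "card S = kernel_dim A"
    and ker: "\<And>v j. (\<And>i. i < m \<Longrightarrow> i \<notin> Z \<Longrightarrow> (\<Sum>j<m. (P * A) $$ (i,j) * v j) = 0) \<Longrightarrow>
       (\<And>s. s \<in> S \<Longrightarrow> v s = 0) \<Longrightarrow> j < m \<Longrightarrow> v j = 0"
    using echelon[OF A] by blast
  show thesis
  proof (rule that[OF e(6) e(7)])
    fix v :: "nat \<Rightarrow> 'a" and j
    assume v: "kernel_fun m A v" "\<And>s. s \<in> S \<Longrightarrow> v s = 0" "j < m"
    show "v j = 0"
      by (rule ker[of v, OF _ v(2) v(3)]) (rule kernel_fun_index[OF kernel_fun_mult[OF A e(1) v(1)]])
  qed
qed

text \<open>If \<open>S\<close> had fewer elements than the nullity, the nonzero rows of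
  \<open>P * A\<close> and the coordinates in \<open>S\<close> would give fewer than
  \<open>m\<close> equations, and a nonzero solution would be a kernel element that \<open>S\<close>
  fails to detect.\<close>

lemma kernel_dim_le:
  fixes A :: "'a::field mat"
  assumes A: "A \<in> carrier_mat m m" and fin: "finite S"
    and inj: "\<And>v. kernel_fun m A v \<Longrightarrow> (\<And>s. s \<in> S \<Longrightarrow> v s = 0) \<Longrightarrow> (\<forall>j<m. v j = 0)"
    and S: "S \<subseteq> {..<m}"
  shows "kernel_dim A \<le> card S"
proof (rule ccontr)
  assume "\<not> ?thesis"
  hence less: "card S < kernel_dim A" by simp
  obtain P Z S' where e: "P \<in> carrier_mat m m" "det P \<noteq> 0" "Z \<subseteq> {..<m}" "card Z = kernel_dim A"
    "\<And>i j. i \<in> Z \<Longrightarrow> j < m \<Longrightarrow> (P * A) $$ (i,j) = 0" by (rule echelon[OF A]) blast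
  have PA: "P * A \<in> carrier_mat m m" using A e(1) by auto
  have cZ: "card Z \<le> m" using e(3) card_mono[of "{..<m}" Z] by simp
  have "card ({..<m} - Z) + card S < m"
    using less e cZ by (subst card_Diff_subset) (auto intro: finite_subset)
  then obtain v where v: "\<exists>j<m. v j \<noteq> 0"
     "\<forall>i\<in>{..<m} - Z. (\<Sum>j<m. (P * A) $$ (i,j) * v j) = 0"
     "\<forall>s\<in>S. (\<Sum>j<m. (if j = s then 1 else 0) * v j) = 0"
    using underdetermined2[of "{..<m} - Z" S m "\<lambda>i j. (P * A) $$ (i,j)" "\<lambda>s j. if j = s then 1 else 0"] fin
    by blast
  have vS: "v s = 0" if "s \<in> S" for s using v(3) that S unfolding sum_unit by force
  have "(\<Sum>j<m. (P * A) $$ (i,j) * v j) = 0" if "i < m" for i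
    using v(2) e(5) that by (cases "i \<in> Z") auto
  hence k1: "kernel_fun m (P * A) v" unfolding kernel_fun_def by auto
  obtain Q where Q: "Q \<in> carrier_mat m m" "Q * P = 1\<^sub>m m"
    using det_non_zero_imp_unit[OF e(1,2)] unfolding Units_def ring_mat_def by auto
  have "Q * (P * A) = A" using assoc_mult_mat[OF Q(1) e(1) A] Q(2) A by simp
  hence "kernel_fun m A v" using kernel_fun_mult[OF PA Q(1) k1] by simp
  thus False using inj vS v(1) by blast
qed

text \<open>Replacing the zero rows of the reduced \<open>P * A0\<close> by the unit rows of its
  free coordinates produces an invertible matrix. The same recipe with the same \<open>P\<close>,
  \<open>Z\<close> and \<open>S\<close> stays invertible for \<open>A t\<close> by continuity of the
  determinant, so \<open>S\<close> detects the kernel of \<open>A t\<close> as well.\<close>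

lemma eventually_kernel_dim_le:
  fixes A0 :: "complex mat" and A :: "'b \<Rightarrow> complex mat"
  assumes A0: "A0 \<in> carrier_mat m m" and A: "\<And>t. A t \<in> carrier_mat m m"
    and lim: "\<And>i j. i < m \<Longrightarrow> j < m \<Longrightarrow> ((\<lambda>t. A t $$ (i,j)) \<longlongrightarrow> A0 $$ (i,j)) F"
  shows "eventually (\<lambda>t. kernel_dim (A t) \<le> kernel_dim A0) F"
proof -
  obtain P Z S where e: "P \<in> carrier_mat m m" "det P \<noteq> 0" "Z \<subseteq> {..<m}" "card Z = kernel_dim A0"
    "\<And>i j. i \<in> Z \<Longrightarrow> j < m \<Longrightarrow> (P * A0) $$ (i,j) = 0"
    "S \<subseteq> {..<m}" "card S = kernel_dim A0"
    and ker: "\<And>v j. (\<And>i. i < m \<Longrightarrow> i \<notin> Z \<Longrightarrow> (\<Sum>j<m. (P * A0) $$ (i,j) * v j) = 0) \<Longrightarrow>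
       (\<And>s. s \<in> S \<Longrightarrow> v s = 0) \<Longrightarrow> j < m \<Longrightarrow> v j = 0"
    using echelon[OF A0] by blast
  have finZ: "finite Z" "finite S" using e(3,6) by (auto intro: finite_subset)
  obtain b where b: "bij_betw b Z S"
    using e(4,7) finZ by (metis finite_same_card_bij)
  define N where "N A = mat m m (\<lambda>(i,j). if i \<in> Z then (if j = b i then 1 else 0) else (P * A) $$ (i,j))"
    for A :: "complex mat"
  have Nc: "N A \<in> carrier_mat m m" for A unfolding N_def by simp
  have Nker: "(\<forall>i<m. i \<notin> Z \<longrightarrow> (\<Sum>j<m. (P * A) $$ (i,j) * v j) = 0) \<and> (\<forall>s\<in>S. v s = 0)
      \<longleftrightarrow> kernel_fun m (N A) v" for A v
  proof -
    have bS: "b i \<in> S" if "i \<in> Z" for i using b that by (auto simp: bij_betw_def)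
    hence bm: "b i < m" if "i \<in> Z" for i using that e(6) by blast
    have r1: "(\<Sum>j<m. N A $$ (i,j) * v j) = v (b i)" if "i \<in> Z" for i
    proof -
      have "(\<Sum>j<m. N A $$ (i,j) * v j) = (\<Sum>j<m. (if j = b i then 1 else 0) * v j)"
        using that e(3) unfolding N_def by (intro sum.cong) auto
      thus ?thesis using bm[OF that] by (simp only: sum_unit if_True)
    qed
    have r2: "(\<Sum>j<m. N A $$ (i,j) * v j) = (\<Sum>j<m. (P * A) $$ (i,j) * v j)" if "i \<notin> Z" "i < m" for i
      using that unfolding N_def by (intro sum.cong) auto
    have "(\<forall>s\<in>S. v s = 0) \<longleftrightarrow> (\<forall>i\<in>Z. v (b i) = 0)" using b unfolding bij_betw_def by auto
    also have "\<dots> \<longleftrightarrow> (\<forall>i<m. i \<in> Z \<longrightarrow> v (b i) = 0)" using e(3) by blast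
    finally have vS: "(\<forall>s\<in>S. v s = 0) \<longleftrightarrow> (\<forall>i<m. i \<in> Z \<longrightarrow> v (b i) = 0)" .
    have "kernel_fun m (N A) v \<longleftrightarrow>
        (\<forall>i<m. if i \<in> Z then v (b i) = 0 else (\<Sum>j<m. (P * A) $$ (i,j) * v j) = 0)"
      unfolding kernel_fun_def
    proof (intro all_cong)
      fix i assume "i < m"
      thus "((\<Sum>j<m. N A $$ (i,j) * v j) = 0) =
        (if i \<in> Z then v (b i) = 0 else (\<Sum>j<m. (P * A) $$ (i,j) * v j) = 0)"
        using r1[of i] r2[of i] by (cases "i \<in> Z") simp_all
    qed
    thus ?thesis unfolding vS by (simp split: if_splits) blast
  qed
  have "det (N A0) \<noteq> 0"
  proof
    assume "det (N A0) = 0"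
    then obtain v where v: "\<exists>j<m. v j \<noteq> 0" "kernel_fun m (N A0) v"
      using det_zero_iff_kernel_fun[OF Nc] by blast
    then obtain j where j: "j < m" "v j \<noteq> 0" by blast
    have "v j = 0" by (rule ker[of v, OF _ _ j(1)]) (use v(2) Nker[of A0 v] in blast)+
    thus False using j by simp
  qed
  moreover have lim2: "((\<lambda>t. det (N (A t))) \<longlongrightarrow> det (N A0)) F"
  proof -
    have ent: "((\<lambda>t. N (A t) $$ (i,j)) \<longlongrightarrow> N A0 $$ (i,j)) F" if "i < m" "j < m" for i j
    proof (cases "i \<in> Z")
      case True
      thus ?thesis using that unfolding N_def by simp
    next
      case False
      have eq: "N X $$ (i,j) = (\<Sum>l<m. P $$ (i,l) * X $$ (l,j))" if "X \<in> carrier_mat m m" for X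
        using False that \<open>i < m\<close> \<open>j < m\<close> e(1) unfolding N_def
        by (auto simp: scalar_prod_def atLeast0LessThan)
      show ?thesis unfolding eq[OF A] eq[OF A0] using that
        by (intro tendsto_sum tendsto_mult tendsto_const lim) auto
    qed
    have "p i < m" if "p permutes {0..<m}" "i < m" for p i
      using permutes_in_image[OF that(1), of i] that(2) by simp
    thus ?thesis unfolding det_def'[OF Nc]
      by (intro tendsto_sum tendsto_mult tendsto_const tendsto_prod ent) auto
  qed
  ultimately have "eventually (\<lambda>t. det (N (A t)) \<noteq> 0) F"
    by (metis tendsto_imp_eventually_ne)
  thus ?thesis
  proof eventually_elim
    case (elim t)
    have "kernel_dim (A t) \<le> card S"
    proof (rule kernel_dim_le[OF A finZ(2) _ e(6)])
      fix v assume v: "kernel_fun m (A t) v" "\<And>s. s \<in> S \<Longrightarrow> v s = 0"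
      have "kernel_fun m (P * A t) v" by (rule kernel_fun_mult[OF A e(1) v(1)])
      hence "kernel_fun m (N (A t)) v" using Nker[of "A t" v] v(2) unfolding kernel_fun_def by blast
      thus "\<forall>j<m. v j = 0" using elim det_zero_iff_kernel_fun[OF Nc[of "A t"]] by blast
    qed
    thus ?case using e by simp
  qed
qed

lemma zero_product_kernel_fun:
  fixes A B :: "'a::field mat"
  assumes A: "A \<in> carrier_mat m m" and B: "B \<in> carrier_mat m m" and AB: "A * B = 0\<^sub>m m m"
  shows "kernel_fun m A (\<lambda>l. \<Sum>j<m. B $$ (l,j) * v j)"
  unfolding kernel_fun_def
proof (intro allI impI)
  fix i assume i: "i < m"
  have "(\<Sum>l<m. A $$ (i,l) * (\<Sum>j<m. B $$ (l,j) * v j)) = (\<Sum>j<m. (\<Sum>l<m. A $$ (i,l) * B $$ (l,j)) * v j)"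
    by (subst sum_distrib_left) (subst sum.swap, simp add: sum_distrib_right mult.assoc)
  also have "\<dots> = (\<Sum>j<m. (A * B) $$ (i,j) * v j)"
    using A B i by (intro sum.cong refl) (auto simp: scalar_prod_def atLeast0LessThan)
  also have "\<dots> = 0" using i unfolding AB by simp
  finally show "(\<Sum>l<m. A $$ (i,l) * (\<Sum>j<m. B $$ (l,j) * v j)) = 0" .
qed

text \<open>Let \<open>SA\<close> and \<open>SB\<close> be detecting sets. The conditions that
  \<open>B v\<close> vanish on \<open>SA\<close> and \<open>v\<close> on \<open>SB\<close> force
  \<open>v = 0\<close>, since \<open>B v\<close> lies in the kernel of \<open>A\<close>; hence there
  are at least \<open>m\<close> of them.\<close>

lemma kernel_dim_zero_product:
  fixes A B :: "'a::field mat"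
  assumes A: "A \<in> carrier_mat m m" and B: "B \<in> carrier_mat m m" and AB: "A * B = 0\<^sub>m m m"
  shows "kernel_dim A + kernel_dim B \<ge> m"
proof (rule ccontr)
  assume "\<not> ?thesis"
  hence less: "kernel_dim A + kernel_dim B < m" by simp
  obtain SA where SA: "SA \<subseteq> {..<m}" "card SA = kernel_dim A"
    "\<And>v j. kernel_fun m A v \<Longrightarrow> (\<And>s. s \<in> SA \<Longrightarrow> v s = 0) \<Longrightarrow> j < m \<Longrightarrow> v j = 0"
    using kernel_dim_witness[OF A] by blast
  obtain SB where SB: "SB \<subseteq> {..<m}" "card SB = kernel_dim B"
    "\<And>v j. kernel_fun m B v \<Longrightarrow> (\<And>s. s \<in> SB \<Longrightarrow> v s = 0) \<Longrightarrow> j < m \<Longrightarrow> v j = 0"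
    using kernel_dim_witness[OF B] by blast
  have fin: "finite SA" "finite SB" using SA SB by (auto intro: finite_subset)
  obtain v where v: "\<exists>j<m. v j \<noteq> 0" "\<forall>i\<in>SA. (\<Sum>j<m. B $$ (i,j) * v j) = 0"
    "\<forall>s\<in>SB. (\<Sum>j<m. (if j = s then 1 else 0) * v j) = 0"
    using underdetermined2[OF fin, of m "\<lambda>i j. B $$ (i,j)" "\<lambda>s j. if j = s then 1 else 0"] less SA SB
    by auto
  have k: "kernel_fun m B v"
    unfolding kernel_fun_def using SA(3)[OF zero_product_kernel_fun[OF A B AB, of v]] v(2) by blast
  have vS: "v s = 0" if "s \<in> SB" for s using v(3) that SB(1) unfolding sum_unit by force
  from v(1) SB(3)[OF k vS] show False by blast
qed

text \<open>An element \<open>w\<close> of the kernel of \<open>A\<close> is reached by solving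
  \<open>B v = t w\<close>. Because \<open>B v - t w\<close> lies in that kernel, the equations need
  only be imposed on \<open>SA\<close>, and the dimension hypothesis leaves room for the extra
  unknown \<open>t\<close>.\<close>

lemma image_eq_kernel_of_zero_product:
  fixes A B :: "'a::field mat"
  assumes A: "A \<in> carrier_mat m m" and B: "B \<in> carrier_mat m m" and AB: "A * B = 0\<^sub>m m m"
    and dims: "kernel_dim A + kernel_dim B = m"
  shows "mat_image B = mat_kernel A"
proof
  show "mat_image B \<subseteq> mat_kernel A"
  proof
    fix w assume "w \<in> mat_image B"
    then obtain v where v: "v \<in> carrier_vec m" "w = B *\<^sub>v v" using B unfolding mat_image_def by auto
    have "A *\<^sub>v w = (A * B) *\<^sub>v v" unfolding v(2) using assoc_mult_mat_vec[OF A B v(1)] by simp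
    also have "\<dots> = 0\<^sub>v m" unfolding AB using v(1) by (intro eq_vecI) auto
    finally show "w \<in> mat_kernel A" using A B v by (intro mat_kernelI[OF A]) auto
  qed
next
  obtain SA where SA: "SA \<subseteq> {..<m}" "card SA = kernel_dim A"
    "\<And>v j. kernel_fun m A v \<Longrightarrow> (\<And>s. s \<in> SA \<Longrightarrow> v s = 0) \<Longrightarrow> j < m \<Longrightarrow> v j = 0"
    using kernel_dim_witness[OF A] by blast
  obtain SB where SB: "SB \<subseteq> {..<m}" "card SB = kernel_dim B"
    "\<And>v j. kernel_fun m B v \<Longrightarrow> (\<And>s. s \<in> SB \<Longrightarrow> v s = 0) \<Longrightarrow> j < m \<Longrightarrow> v j = 0"
    using kernel_dim_witness[OF B] by blast
  have fin: "finite SA" "finite SB" using SA SB by (auto intro: finite_subset)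
  show "mat_kernel A \<subseteq> mat_image B"
  proof
    fix w assume "w \<in> mat_kernel A"
    hence w: "w \<in> carrier_vec m" "kernel_fun m A (\<lambda>j. w $ j)"
      using mat_kernelD[OF A] kernel_fun_vec[OF A] by auto
    \<comment> \<open>Homogeneous unknowns $(v,t)$, with $t$ in slot $m$: the equations
      $Bv = tw$ on SA and $v = 0$ on SB are $m$ in number, for $m+1$ unknowns.\<close>
    obtain x where x: "\<exists>j<Suc m. x j \<noteq> 0"
      "\<forall>i\<in>SA. (\<Sum>j<Suc m. (if j = m then - w $ i else B $$ (i,j)) * x j) = 0"
      "\<forall>s\<in>SB. (\<Sum>j<Suc m. (if j = s then 1 else 0) * x j) = 0"
      using underdetermined2[OF fin, of "Suc m" "\<lambda>i j. if j = m then - w $ i else B $$ (i,j)"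
          "\<lambda>s j. if j = s then 1 else 0"] dims SA SB by auto
    define t where "t = x m"
    have x2: "(\<Sum>j<m. B $$ (i,j) * x j) = t * w $ i" if "i \<in> SA" for i
      using x(2)[rule_format, OF that] unfolding t_def by (simp add: algebra_simps)
    have x3: "x s = 0" if "s \<in> SB" for s using x(3) that SB(1) unfolding sum_unit by force
    have k: "kernel_fun m A (\<lambda>l. (\<Sum>j<m. B $$ (l,j) * x j) - t * w $ l)"
      unfolding kernel_fun_def
    proof (intro allI impI)
      fix i assume i: "i < m"
      have "(\<Sum>l<m. A $$ (i,l) * ((\<Sum>j<m. B $$ (l,j) * x j) - t * w $ l))
         = (\<Sum>l<m. A $$ (i,l) * (\<Sum>j<m. B $$ (l,j) * x j)) - t * (\<Sum>l<m. A $$ (i,l) * w $ l)"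
        by (simp add: right_diff_distrib sum_subtractf sum_distrib_left mult_ac)
      thus "(\<Sum>l<m. A $$ (i,l) * ((\<Sum>j<m. B $$ (l,j) * x j) - t * w $ l)) = 0"
        using kernel_fun_index[OF zero_product_kernel_fun[OF A B AB, of x] i] kernel_fun_index[OF w(2) i] by simp
    qed
    have Bx: "(\<Sum>j<m. B $$ (l,j) * x j) = t * w $ l" if "l < m" for l
      using SA(3)[OF k _ that] x2 by simp
    \<comment> \<open>With \<open>t = 0\<close> the vector \<open>x\<close> would be a kernel
      element of \<open>B\<close> vanishing on \<open>SB\<close>, hence zero, contrary to its
      choice.\<close>
    have t: "t \<noteq> 0"
    proof
      assume t0: "t = 0"
      hence "kernel_fun m B x" unfolding kernel_fun_def using Bx by simp
      hence "\<forall>j<m. x j = 0" using SB(3)[of x] x3 by blast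
      thus False using x(1) t0 unfolding t_def by (auto simp: less_Suc_eq)
    qed
    have "B *\<^sub>v vec m (\<lambda>j. x j / t) = w"
    proof (rule eq_vecI)
      fix i assume "i < dim_vec w"
      hence i: "i < m" using w by simp
      have "(B *\<^sub>v vec m (\<lambda>j. x j / t)) $ i = (\<Sum>j<m. B $$ (i,j) * x j) / t"
        using mult_mat_vec_sum[OF B _ i, of "vec m (\<lambda>j. x j / t)"]
        by (simp add: sum_divide_distrib)
      thus "(B *\<^sub>v vec m (\<lambda>j. x j / t)) $ i = w $ i" using Bx[OF i] t by simp
    qed (use B w in auto)
    thus "w \<in> mat_image B" unfolding mat_image_def using B
      by (intro CollectI exI[of _ "vec m (\<lambda>j. x j / t)"]) auto
  qed
qed

text \<open>Kernel elements of \<open>B\<close> become kernel elements of \<open>A\<close> after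
  rescaling by \<open>w\<close> and reindexing by \<open>q\<close>, the inverse of
  \<open>\<pi>\<close>; row factors and the row permutation only rearrange the equations. So
  \<open>q\<close> carries a detecting set of \<open>A\<close> to one of \<open>B\<close>.\<close>

lemma kernel_dim_monomial_le:
  fixes A B :: "'a::field mat"
  assumes A: "A \<in> carrier_mat m m" and B: "B \<in> carrier_mat m m"
    and \<sigma>: "bij_betw \<sigma> {..<m} {..<m}" and \<pi>: "bij_betw \<pi> {..<m} {..<m}"
    and u: "\<And>i. i < m \<Longrightarrow> u i \<noteq> 0" and w: "\<And>j. j < m \<Longrightarrow> w j \<noteq> 0"
    and eq: "\<And>i j. i < m \<Longrightarrow> j < m \<Longrightarrow> B $$ (i,j) = u i * A $$ (\<sigma> i, \<pi> j) * w j"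
  shows "kernel_dim B \<le> kernel_dim A"
proof -
  obtain S where S: "S \<subseteq> {..<m}" "card S = kernel_dim A"
    "\<And>v j. kernel_fun m A v \<Longrightarrow> (\<And>s. s \<in> S \<Longrightarrow> v s = 0) \<Longrightarrow> j < m \<Longrightarrow> v j = 0"
    using kernel_dim_witness[OF A] by blast
  define q where "q = inv_into {..<m} \<pi>"
  have q: "bij_betw q {..<m} {..<m}" unfolding q_def by (rule bij_betw_inv_into[OF \<pi>])
  have \<pi>q: "\<pi> (q l) = l" "q l < m" if "l < m" for l
    using \<pi> that bij_betw_inv_into_right[OF \<pi>, of l] q unfolding q_def
    by (auto simp: bij_betw_def)
  have q\<pi>: "q (\<pi> j) = j" "\<pi> j < m" if "j < m" for j
    using \<pi> that bij_betw_inv_into_left[OF \<pi>, of j] unfolding q_def by (auto simp: bij_betw_def)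
  have "kernel_dim B \<le> card (q ` S)"
  proof (rule kernel_dim_le[OF B])
    show "finite (q ` S)" using S(1) by (auto intro: finite_subset)
    show "q ` S \<subseteq> {..<m}" using S(1) \<pi>q by auto
    fix v assume v: "kernel_fun m B v" "\<And>s. s \<in> q ` S \<Longrightarrow> v s = 0"
    define v' where "v' l = w (q l) * v (q l)" for l
    have "kernel_fun m A v'"
      unfolding kernel_fun_def
    proof (intro allI impI)
      fix i assume "i < m"
      then obtain i' where i': "i' < m" "\<sigma> i' = i" using \<sigma> by (metis bij_betw_def imageE lessThan_iff)
      have "(\<Sum>j<m. A $$ (i,j) * v' j) = (\<Sum>j<m. A $$ (i, \<pi> j) * v' (\<pi> j))"
        by (rule sum.reindex_bij_betw[OF \<pi>, symmetric])
      also have "u i' * \<dots> = (\<Sum>j<m. B $$ (i',j) * v j)"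
        unfolding sum_distrib_left v'_def using q\<pi> i' eq
        by (intro sum.cong) (auto simp: mult_ac)
      also have "\<dots> = 0" by (rule kernel_fun_index[OF v(1) i'(1)])
      finally show "(\<Sum>j<m. A $$ (i,j) * v' j) = 0" using u[OF i'(1)] by simp
    qed
    moreover have "v' s = 0" if "s \<in> S" for s unfolding v'_def using v(2) that by simp
    ultimately have 0: "v' l = 0" if "l < m" for l using S(3)[of v'] that by blast
    show "\<forall>j<m. v j = 0"
    proof (intro allI impI)
      fix j assume j: "j < m"
      show "v j = 0" using 0[of "\<pi> j"] q\<pi>[OF j] w[OF j] unfolding v'_def by simp
    qed
  qed
  also have "\<dots> \<le> card S" using S(1) by (intro card_image_le) (auto intro: finite_subset)
  finally show ?thesis using S(2) by simp
qed

lemma kernel_dim_monomial: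
  fixes A B :: "'a::field mat"
  assumes A: "A \<in> carrier_mat m m" and B: "B \<in> carrier_mat m m"
    and \<sigma>: "bij_betw \<sigma> {..<m} {..<m}" and \<pi>: "bij_betw \<pi> {..<m} {..<m}"
    and u: "\<And>i. i < m \<Longrightarrow> u i \<noteq> 0" and w: "\<And>j. j < m \<Longrightarrow> w j \<noteq> 0"
    and eq: "\<And>i j. i < m \<Longrightarrow> j < m \<Longrightarrow> B $$ (i,j) = u i * A $$ (\<sigma> i, \<pi> j) * w j"
  shows "kernel_dim B = kernel_dim A"
proof (rule antisym)
  show "kernel_dim B \<le> kernel_dim A" by (rule kernel_dim_monomial_le[OF A B \<sigma> \<pi> u w eq])
  let ?\<sigma> = "inv_into {..<m} \<sigma>" and ?\<pi> = "inv_into {..<m} \<pi>"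
  have b: "bij_betw ?\<sigma> {..<m} {..<m}" "bij_betw ?\<pi> {..<m} {..<m}"
    using \<sigma> \<pi> by (auto intro: bij_betw_inv_into)
  have s: "\<sigma> (?\<sigma> i) = i" "?\<sigma> i < m" if "i < m" for i
    using \<sigma> that bij_betw_inv_into_right[OF \<sigma>, of i] b by (auto simp: bij_betw_def)
  have p: "\<pi> (?\<pi> i) = i" "?\<pi> i < m" if "i < m" for i
    using \<pi> that bij_betw_inv_into_right[OF \<pi>, of i] b by (auto simp: bij_betw_def)
  show "kernel_dim A \<le> kernel_dim B"
  proof (rule kernel_dim_monomial_le[OF B A b, of "\<lambda>i. inverse (u (?\<sigma> i))" "\<lambda>j. inverse (w (?\<pi> j))"])
    fix i j assume ij: "i < m" "j < m"
    show "A $$ (i,j) = inverse (u (?\<sigma> i)) * B $$ (?\<sigma> i, ?\<pi> j) * inverse (w (?\<pi> j))"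
      using eq[OF s(2)[OF ij(1)] p(2)[OF ij(2)]] s[OF ij(1)] p[OF ij(2)] u[OF s(2)[OF ij(1)]] w[OF p(2)[OF ij(2)]]
      by simp
  qed (use s p u w in auto)
qed

text \<open>Columns are treated as rows of the transpose. The factor in front of
  \<open>det A\<close> consists of the row and column factors and two signs, so for lattice
  translations of the matrix it is independent of \<open>X\<close>.\<close>

lemma det_monomial:
  fixes A B :: "'a::field mat"
  assumes A: "A \<in> carrier_mat m m" and B: "B \<in> carrier_mat m m"
    and \<sigma>: "\<sigma> permutes {0..<m}" and \<pi>: "\<pi> permutes {0..<m}"
    and eq: "\<And>i j. i < m \<Longrightarrow> j < m \<Longrightarrow> B $$ (i,j) = u i * A $$ (\<sigma> i, \<pi> j) * w j"
  shows "det B = (\<Prod>i<m. u i) * (\<Prod>j<m. w j) * (signof \<sigma> * signof \<pi>) * det A"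
proof -
  have scale: "det C = (\<Prod>i<m. u i) * det D"
    if "C \<in> carrier_mat m m" "D \<in> carrier_mat m m" "\<And>i j. i < m \<Longrightarrow> j < m \<Longrightarrow> C $$ (i,j) = u i * D $$ (i,j)"
    for C D :: "'a mat" and u
  proof -
    have "(\<Prod>i = 0..<m. C $$ (i, p i)) = (\<Prod>i<m. u i) * (\<Prod>i = 0..<m. D $$ (i, p i))"
      if "p permutes {0..<m}" for p
    proof -
      have "(\<Prod>i = 0..<m. C $$ (i, p i)) = (\<Prod>i = 0..<m. u i * D $$ (i, p i))"
        using permutes_in_image[OF that] \<open>\<And>i j. i < m \<Longrightarrow> j < m \<Longrightarrow> C $$ (i,j) = u i * D $$ (i,j)\<close>
        by (intro prod.cong) auto
      thus ?thesis by (simp add: prod.distrib atLeast0LessThan)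
    qed
    thus ?thesis unfolding det_def'[OF that(1)] det_def'[OF that(2)] sum_distrib_left
      by (intro sum.cong) auto
  qed
  let ?D = "mat m m (\<lambda>(i,j). A $$ (\<sigma> i, \<pi> j) * w j)"
  let ?E = "mat m m (\<lambda>(i,j). A $$ (\<sigma> i, j))"
  let ?F = "mat m m (\<lambda>(i,j). A $$ (\<sigma> i, \<pi> j))"
  have "det B = (\<Prod>i<m. u i) * det ?D" by (rule scale) (use B eq in \<open>auto simp: mult_ac\<close>)
  also have "det ?D = det (transpose_mat ?D)" by (subst det_transpose[of _ m]) auto
  also have "\<dots> = (\<Prod>i<m. w i) * det (transpose_mat ?F)"
    by (rule scale) (auto simp: mult_ac)
  also have "det (transpose_mat ?F) = det (mat m m (\<lambda>(i,j). transpose_mat ?E $$ (\<pi> i, j)))"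
    using permutes_in_image[OF \<pi>] by (intro arg_cong[of _ _ det] eq_matI) auto
  also have "\<dots> = signof \<pi> * det (transpose_mat ?E)"
    by (rule det_permute_rows[OF _ \<pi>]) auto
  also have "det (transpose_mat ?E) = det ?E" by (subst det_transpose[of _ m]) auto
  also have "det ?E = signof \<sigma> * det A" by (rule det_permute_rows[OF A \<sigma>])
  finally show ?thesis by (simp add: mult_ac)
qed

lemma invertible_mat_iff_det:
  fixes A :: "'a::field mat"
  assumes A: "A \<in> carrier_mat m m"
  shows "invertible_mat A \<longleftrightarrow> det A \<noteq> 0"
proof
  assume "invertible_mat A"
  then obtain B where B: "A * B = 1\<^sub>m m" "B * A = 1\<^sub>m (dim_row B)"
    using A unfolding invertible_mat_def inverts_mat_def by auto
  have "dim_col B = m" using arg_cong[OF B(1), of dim_col] by simp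
  moreover have "dim_row B = m" using arg_cong[OF B(2), of dim_col] A by simp
  ultimately have "B \<in> carrier_mat m m" by auto
  from det_mult[OF A this] B(1) show "det A \<noteq> 0" by auto
next
  assume "det A \<noteq> 0"
  from det_non_zero_imp_unit[OF A this] obtain B where "B \<in> carrier_mat m m" "A * B = 1\<^sub>m m" "B * A = 1\<^sub>m m"
    unfolding Units_def ring_mat_def by auto
  thus "invertible_mat A" using A unfolding invertible_mat_def inverts_mat_def square_mat.simps
    by (intro conjI exI[of _ B]) auto
qed

section \<open>Entire functions and determinants with holomorphic entries\<close>

lemma entire_divide_root:
  assumes "f holomorphic_on UNIV" "f p = 0"
  obtains g where "g holomorphic_on UNIV" "\<And>z. f z = (z - p) * g z"
proof -
  define g where "g z = (if z = p then deriv f p else (f z - f p) / (z - p))" for z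
  have "g holomorphic_on UNIV" unfolding g_def
    using pole_lemma[OF assms(1), of p] by simp
  moreover have "f z = (z - p) * g z" for z using assms by (auto simp: g_def)
  ultimately show thesis using that by blast
qed

lemma det_holomorphic:
  assumes "\<And>z. A z \<in> carrier_mat m m"
    "\<And>i j. i < m \<Longrightarrow> j < m \<Longrightarrow> (\<lambda>z. A z $$ (i,j)) holomorphic_on S"
  shows "(\<lambda>z. det (A z)) holomorphic_on S"
proof -
  have "p i < m" if "p permutes {0..<m}" "i < m" for p i
    using permutes_in_image[OF that(1), of i] that(2) by simp
  thus ?thesis unfolding det_def'[OF assms(1)]
    by (intro holomorphic_on_sum holomorphic_on_mult holomorphic_on_const holomorphic_on_prod assms(2)) auto
qed

text \<open>Row operations make \<open>kernel_dim (A p)\<close> rows of the matrix vanish at \<open>p\<close>.\<close>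
lemma det_divisible_kernel_dim:
  fixes A :: "complex \<Rightarrow> complex mat"
  assumes A: "\<And>z. A z \<in> carrier_mat m m"
    and hol: "\<And>i j. i < m \<Longrightarrow> j < m \<Longrightarrow> (\<lambda>z. A z $$ (i,j)) holomorphic_on UNIV"
  obtains g where "g holomorphic_on UNIV" "\<And>z. det (A z) = (z - p) ^ kernel_dim (A p) * g z"
proof -
  obtain P Z S where e: "P \<in> carrier_mat m m" "det P \<noteq> 0" "Z \<subseteq> {..<m}" "card Z = kernel_dim (A p)"
    "\<And>i j. i \<in> Z \<Longrightarrow> j < m \<Longrightarrow> (P * A p) $$ (i,j) = 0" by (rule echelon[OF A[of p]]) blast
  have PA: "P * A z \<in> carrier_mat m m" for z using A e(1) by auto
  have holPA: "(\<lambda>z. (P * A z) $$ (i,j)) holomorphic_on UNIV" if "i < m" "j < m" for i j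
  proof -
    have "(P * A z) $$ (i,j) = (\<Sum>l<m. P $$ (i,l) * A z $$ (l,j))" for z
      using that e(1) A[of z] by (auto simp: scalar_prod_def atLeast0LessThan)
    thus ?thesis using that by (auto intro!: holomorphic_intros hol)
  qed
  have "\<exists>h. h holomorphic_on UNIV \<and> (\<forall>z. (P * A z) $$ (i,j) = (if i \<in> Z then z - p else 1) * h z)"
    if ij: "i < m" "j < m" for i j
  proof (cases "i \<in> Z")
    case True
    obtain g where "g holomorphic_on UNIV" "\<And>z. (P * A z) $$ (i,j) = (z - p) * g z"
      using entire_divide_root[OF holPA[OF ij] e(5)[OF True ij(2)]] by blast
    thus ?thesis using True by auto
  next
    case False
    thus ?thesis using holPA[OF ij] by (intro exI[of _ "\<lambda>z. (P * A z) $$ (i,j)"]) auto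
  qed
  then obtain h where h: "\<And>i j. i < m \<Longrightarrow> j < m \<Longrightarrow> h i j holomorphic_on UNIV"
    "\<And>i j z. i < m \<Longrightarrow> j < m \<Longrightarrow> (P * A z) $$ (i,j) = (if i \<in> Z then z - p else 1) * h i j z"
    by metis
  define B where "B z = mat m m (\<lambda>(i,j). h i j z)" for z
  have B: "B z \<in> carrier_mat m m" for z unfolding B_def by simp
  \<comment> \<open>The factor \<open>z - p\<close> is pulled out of each row in \<open>Z\<close>,
    as a monomial scaling with identity permutations.\<close>
  have "det (P * A z) = (z - p) ^ kernel_dim (A p) * det (B z)" for z
  proof -
    have "det (P * A z) = (\<Prod>i<m. if i \<in> Z then z - p else 1) * (\<Prod>j<m. 1) * (signof id * signof id) * det (B z)"
      by (rule det_monomial[OF B PA permutes_id permutes_id]) (auto simp: h(2) B_def)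
    also have "(\<Prod>i<m. if i \<in> Z then z - p else 1) = (z - p) ^ card Z"
    proof -
      have "{..<m} \<inter> Z = Z" using e(3) by blast
      thus ?thesis by (simp add: prod.If_cases)
    qed
    finally show ?thesis using e(4) by (simp add: sign_id)
  qed
  hence "det (A z) = (z - p) ^ kernel_dim (A p) * (det (B z) / det P)" for z
    using det_mult[OF e(1) A[of z]] e(2) by (simp add: field_simps)
  moreover have "(\<lambda>z. det (B z) / det P) holomorphic_on UNIV"
    by (intro holomorphic_intros det_holomorphic[OF B]) (auto simp: B_def h e(2))
  ultimately show thesis using that by blast
qed

subsection \<open>Liouville theorems for quasi-periodic functions\<close>

lemma ee_0 [simp]: "ee 0 = 1" by (simp add: ee_def)
lemma ee_add: "ee (a + b) = ee a * ee b" by (simp add: ee_def distrib_left exp_add)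
lemma ee_minus: "ee (- a) = inverse (ee a)" by (simp add: ee_def exp_minus)
lemma ee_diff: "ee (a - b) = ee a / ee b" by (simp add: ee_def right_diff_distrib exp_diff)
lemma ee_nonzero [simp]: "ee a \<noteq> 0" by (simp add: ee_def)
lemma ee_of_nat_mult: "ee (of_nat n * a) = ee a ^ n"
  by (simp add: ee_def exp_of_nat_mult[symmetric] mult_ac)
lemma ee_eq_1_iff: "ee z = 1 \<longleftrightarrow> z \<in> \<int>"
proof
  assume "ee z = 1"
  then obtain k :: int where "Re (2 * of_real pi * \<i> * z) = 0" "Im (2 * of_real pi * \<i> * z) = of_int (2 * k) * pi"
    unfolding ee_def exp_eq_1 by blast
  hence "z = of_int k" by (auto simp: complex_eq_iff)
  thus "z \<in> \<int>" by simp
next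
  assume "z \<in> \<int>"
  then obtain k where "z = of_int k" by (auto elim: Ints_cases)
  thus "ee z = 1" using exp_integer_2pi[of "of_int k"] by (simp add: ee_def mult_ac)
qed
lemma ee_of_int [simp]: "ee (of_int k) = 1" by (simp add: ee_eq_1_iff)
lemma ee_1 [simp]: "ee 1 = 1" using ee_of_int[of 1] by simp
lemma ee_half [simp]: "ee (1/2) = -1" by (simp add: ee_def)
lemma norm_ee: "norm (ee z) = exp (- 2 * pi * Im z)" by (simp add: ee_def)

lemma holomorphic_on_ee [holomorphic_intros]: "f holomorphic_on S \<Longrightarrow> (\<lambda>z. ee (f z)) holomorphic_on S"
  unfolding ee_def by (intro holomorphic_intros)

lemma tendsto_ee [tendsto_intros]: "(f \<longlongrightarrow> a) F \<Longrightarrow> ((\<lambda>z. ee (f z)) \<longlongrightarrow> ee a) F"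
  unfolding ee_def by (intro tendsto_intros)

text \<open>The condition on \<open>(z - p) * f z\<close> is Riemann's criterion, met in particular
  by a sum of simple poles whose residues cancel. The local extensions agree with \<open>f\<close>
  off \<open>S\<close>, and each ball meets \<open>S\<close> in its centre only, so they
  glue.\<close>

lemma entire_extension:
  assumes hol: "f holomorphic_on - S" and cl: "closed S"
    and disc: "\<And>p. p \<in> S \<Longrightarrow> \<exists>r>0. ball p r \<inter> S \<subseteq> {p}"
    and lim: "\<And>p. p \<in> S \<Longrightarrow> ((\<lambda>z. (z - p) * f z) \<longlongrightarrow> 0) (at p)"
  obtains g where "g holomorphic_on UNIV" "\<And>z. z \<notin> S \<Longrightarrow> g z = f z"
proof -
  obtain r where r: "\<And>p. p \<in> S \<Longrightarrow> r p > 0" "\<And>p. p \<in> S \<Longrightarrow> ball p (r p) \<inter> S \<subseteq> {p}"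
    using disc by metis
  have "\<exists>h. h holomorphic_on ball p (r p) \<and> (\<forall>z\<in>ball p (r p) - {p}. h z = f z)" if p: "p \<in> S" for p
  proof -
    have "ball p (r p) - {p} \<subseteq> - S" using r(2)[OF p] by blast
    hence "f holomorphic_on ball p (r p) - {p}" using hol holomorphic_on_subset by blast
    thus ?thesis
      using holomorphic_on_extend_lim[of f "ball p (r p)" p] lim[OF p] r(1)[OF p] by simp
  qed
  then obtain h where h: "\<And>p. p \<in> S \<Longrightarrow> h p holomorphic_on ball p (r p)"
    "\<And>p z. p \<in> S \<Longrightarrow> z \<in> ball p (r p) \<Longrightarrow> z \<noteq> p \<Longrightarrow> h p z = f z" by (metis Diff_iff singletonD)
  define g where "g z = (if z \<in> S then h z z else f z)" for z
  have 1: "g holomorphic_on - S"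
    by (rule holomorphic_transform[OF hol]) (simp add: g_def)
  have 2: "g holomorphic_on ball p (r p)" if p: "p \<in> S" for p
  proof (rule holomorphic_transform[OF h(1)[OF p]])
    fix z assume z: "z \<in> ball p (r p)"
    show "h p z = g z"
    proof (cases "z = p")
      case False
      hence "z \<notin> S" using z r(2)[OF p] by blast
      thus ?thesis using h(2)[OF p z False] by (simp add: g_def)
    qed (use p in \<open>simp add: g_def\<close>)
  qed
  have "g holomorphic_on (\<Union>B\<in>insert (- S) ((\<lambda>p. ball p (r p)) ` S). B)"
    using 1 2 cl by (intro holomorphic_on_UN_open) auto
  moreover have "(\<Union>B\<in>insert (- S) ((\<lambda>p. ball p (r p)) ` S). B) = UNIV"
    using r(1) by force
  ultimately show thesis using that[of g] by (simp add: g_def)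
qed

lemma entire_shift:
  assumes "f holomorphic_on UNIV"
  shows "(\<lambda>z. f (z + c)) holomorphic_on UNIV" "(\<lambda>z. f (z - c)) holomorphic_on UNIV"
  using holomorphic_on_compose_gen[OF _ assms, of "\<lambda>z. z + c" UNIV]
    holomorphic_on_compose_gen[OF _ assms, of "\<lambda>z. z - c" UNIV]
  by (auto simp: o_def holomorphic_on_add holomorphic_on_diff)

lemma Im_basis_decomp:
  assumes "Im \<eta> > 0"
  obtains x y :: real where "z = of_real x + of_real y * \<eta>"
proof (rule that[of "Re z - Im z / Im \<eta> * Re \<eta>" "Im z / Im \<eta>"])
  show "z = of_real (Re z - Im z / Im \<eta> * Re \<eta>) + of_real (Im z / Im \<eta>) * \<eta>"
    using assms by (simp add: complex_eq_iff)
qed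

text \<open>The codomain is arbitrary because the lemma is applied to norms, to the predicate of
  being a zero, and to nullities.\<close>

lemma shift_int_induct:
  fixes g :: "complex \<Rightarrow> 'a"
  assumes "\<And>z. g (z + w) = g z"
  shows "g (z + of_int k * w) = g z"
proof (induction k arbitrary: z rule: int_induct[of _ 0])
  case (step1 i)
  have "g (z + of_int (i + 1) * w) = g ((z + of_int i * w) + w)" by (simp add: algebra_simps)
  thus ?case using assms step1 by simp
next
  case (step2 i)
  have "g (z + of_int (i - 1) * w) = g ((z + of_int (i - 1) * w) + w)" using assms by simp
  also have "\<dots> = g (z + of_int i * w)" by (simp add: algebra_simps)
  finally show ?case using step2 by simp
qed simp

lemma doubly_periodic_norm_constant:
  assumes eta: "Im \<eta> > 0" and hol: "f holomorphic_on UNIV"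
    and p1: "\<And>z. norm (f (z + 1)) = norm (f z)" and p2: "\<And>z. norm (f (z + \<eta>)) = norm (f z)"
  obtains c where "\<And>z. f z = c"
proof -
  let ?P = "(\<lambda>(x, y). of_real x + of_real y * \<eta>) ` ({0..1} \<times> {0..1::real}) :: complex set"
  have "compact ?P"
    unfolding case_prod_unfold
    by (intro compact_continuous_image compact_Times compact_Icc continuous_intros)
  hence "compact (f ` ?P)"
    by (intro compact_continuous_image[OF continuous_on_subset[OF holomorphic_on_imp_continuous_on[OF hol]]]) simp_all
  hence "bounded (f ` ?P)" by (rule compact_imp_bounded)
  then obtain B where "\<forall>x\<in>f ` ?P. norm x \<le> B" by (auto simp only: bounded_iff)
  hence B: "norm (f z) \<le> B" if "z \<in> ?P" for z
    using imageI[OF that, of f] by (rule bspec)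
  have "norm (f z) \<le> B" for z
  proof -
    obtain x y where z: "z = of_real x + of_real y * \<eta>" using Im_basis_decomp[OF eta] by blast
    have e: "z = (of_real (frac x) + of_real (frac y) * \<eta> + of_int \<lfloor>x\<rfloor> * 1) + of_int \<lfloor>y\<rfloor> * \<eta>"
    proof -
      have "x = frac x + of_int \<lfloor>x\<rfloor>" "y = frac y + of_int \<lfloor>y\<rfloor>" by (auto simp: frac_def)
      hence "(of_real x :: complex) = of_real (frac x) + of_int \<lfloor>x\<rfloor>"
        "(of_real y :: complex) = of_real (frac y) + of_int \<lfloor>y\<rfloor>"
        by (metis of_real_add of_real_of_int_eq)+
      thus ?thesis unfolding z by (simp add: algebra_simps)
    qed
    have "norm (f z) = norm (f (of_real (frac x) + of_real (frac y) * \<eta>))"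
      unfolding e using shift_int_induct[of "\<lambda>z. norm (f z)" \<eta>, OF p2] shift_int_induct[of "\<lambda>z. norm (f z)" 1, OF p1]
      by simp
    also have "\<dots> \<le> B"
      by (rule B) (auto intro!: image_eqI[of _ _ "(frac x, frac y)"] simp: frac_lt_1 less_imp_le)
    finally show ?thesis .
  qed
  hence "bounded (range f)" unfolding bounded_iff by auto
  hence "f constant_on UNIV" by (rule Liouville_theorem[OF hol])
  thus thesis using that unfolding constant_on_def by blast
qed

lemma entire_multiplicative:
  assumes eta: "Im \<eta> > 0" and hol: "f holomorphic_on UNIV"
    and p1: "\<And>z. f (z + 1) = u * f z" and p2: "\<And>z. f (z + \<eta>) = v * f z" and uv: "u \<noteq> 0" "v \<noteq> 0"
  obtains K l where "\<And>z. f z = K * exp (l * z)"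
proof -
  \<comment> \<open>Two real linear conditions fix \<open>l\<close>: the real parts of
    \<open>l\<close> and of \<open>l * \<eta>\<close> are the logarithms of the norms of
    \<open>u\<close> and \<open>v\<close>. Dividing by \<open>exp (l * z)\<close> then leaves
    multipliers of modulus one.\<close>
  define l where "l = Complex (ln (norm u)) ((ln (norm u) * Re \<eta> - ln (norm v)) / Im \<eta>)"
  have "norm (exp (- l)) = exp (- Re l)" by (simp only: norm_exp_eq_Re uminus_complex.simps)
  hence l1: "norm (exp (- l)) = inverse (norm u)" using uv by (simp add: l_def exp_minus)
  have "Re (l * \<eta>) = ln (norm v)" using eta by (simp add: l_def)
  moreover have "norm (exp (- l * \<eta>)) = exp (- Re (l * \<eta>))"
    by (simp only: norm_exp_eq_Re uminus_complex.simps mult_minus_left)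
  ultimately have l2: "norm (exp (- l * \<eta>)) = inverse (norm v)" using uv by (simp add: exp_minus)
  obtain c where c: "\<And>z. f z * exp (- l * z) = c"
  proof (rule doubly_periodic_norm_constant[OF eta, of "\<lambda>z. f z * exp (- l * z)"])
    show "(\<lambda>z. f z * exp (- l * z)) holomorphic_on UNIV" by (intro holomorphic_intros hol)
    have a: "exp (- l * (z + w)) = exp (- l * z) * exp (- l * w)" for z w
      by (simp add: exp_add[symmetric] algebra_simps)
    show "norm (f (z + 1) * exp (- l * (z + 1))) = norm (f z * exp (- l * z))" for z
      unfolding p1 a norm_mult using l1 uv by simp
    show "norm (f (z + \<eta>) * exp (- l * (z + \<eta>))) = norm (f z * exp (- l * z))" for z
      unfolding p2 a norm_mult l2 using uv by simp
  next
    fix c assume "\<And>z. f z * exp (- l * z) = c"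
    thus thesis by (rule that)
  qed
  have "f z = c * exp (l * z)" for z
    using c[of z] by (simp add: exp_minus field_simps)
  thus thesis using that by blast
qed

subsection \<open>Two power series\<close>

text \<open>The ratio of consecutive terms is at most \<open>M * r ^ k * norm x\<close>, which tends
  to zero for every \<open>x\<close>; the radius of convergence is infinite.\<close>

lemma super_ratio_summable:
  fixes c :: "nat \<Rightarrow> complex"
  assumes r: "0 \<le> r" "r < 1" and c: "\<And>k. norm (c (Suc k)) \<le> M * r ^ k * norm (c k)"
  shows "summable (\<lambda>k. norm (c k * x ^ k))"
proof -
  have "(\<lambda>k. M * r ^ k * norm x) \<longlonglongrightarrow> M * 0 * norm x"
    by (intro tendsto_intros LIMSEQ_power_zero) (use r in auto)
  hence "eventually (\<lambda>k. M * r ^ k * norm x < 1/2) sequentially" by (rule order_tendstoD) simp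
  then obtain N where N: "\<And>k. k \<ge> N \<Longrightarrow> M * r ^ k * norm x < 1/2" by (auto simp: eventually_sequentially)
  show ?thesis
  proof (rule summable_ratio_test[of "1/2" N])
    fix k assume "N \<le> k"
    have "norm (c (Suc k) * x ^ Suc k) \<le> (M * r ^ k * norm (c k)) * (norm x * norm x ^ k)"
      unfolding norm_mult norm_power power_Suc by (intro mult_right_mono c mult_nonneg_nonneg) auto
    also have "\<dots> = (M * r ^ k * norm x) * norm (c k * x ^ k)" by (simp add: norm_mult norm_power mult_ac)
    also have "\<dots> \<le> 1/2 * norm (c k * x ^ k)"
      using N[OF \<open>N \<le> k\<close>] by (intro mult_right_mono) auto
    finally show "norm (norm (c (Suc k) * x ^ Suc k)) \<le> 1/2 * norm (norm (c k * x ^ k))" by simp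
  qed simp
qed

lemma powser_entire:
  fixes c :: "nat \<Rightarrow> complex"
  assumes "\<And>x. summable (\<lambda>k. c k * x ^ k)"
  shows "(\<lambda>x. \<Sum>k. c k * x ^ k) holomorphic_on UNIV"
  unfolding holomorphic_on_def field_differentiable_def
  using termdiffs_strong_converges_everywhere[OF assms] has_field_derivative_at_within by blast

text \<open>The recursion comes from comparing coefficients in
  \<open>f x = (1 - x) * f (q * x)\<close>, the functional equation of the infinite product.\<close>

primrec euler_coeff :: "complex \<Rightarrow> nat \<Rightarrow> complex" where
  "euler_coeff q 0 = 1"
| "euler_coeff q (Suc k) = - (q ^ k) / (1 - q ^ Suc k) * euler_coeff q k"

text \<open>Euler's series for the infinite product of the factors \<open>1 - q ^ j * x\<close>.\<close>
definition euler_series :: "complex \<Rightarrow> complex \<Rightarrow> complex" where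
  "euler_series q x = (\<Sum>k. euler_coeff q k * x ^ k)"

text \<open>In closed form (-1)^k q^(k(k+1)/2): a one-sided theta series, two of which make up the
  sum over all integers.\<close>

primrec tri_coeff :: "complex \<Rightarrow> nat \<Rightarrow> complex" where
  "tri_coeff q 0 = 1"
| "tri_coeff q (Suc k) = - (q ^ Suc k) * tri_coeff q k"

definition tri_series :: "complex \<Rightarrow> complex \<Rightarrow> complex" where
  "tri_series q x = (\<Sum>k. tri_coeff q k * x ^ k)"

context
  fixes q :: complex
  assumes q: "norm q < 1"
begin

lemma one_minus_power_nz: "1 - q ^ Suc k \<noteq> 0"
proof -
  have "norm (q ^ Suc k) \<le> norm q" unfolding norm_power using q
    by (metis less_imp_le mult_left_le norm_ge_zero power_Suc power_le_one)
  hence "norm (q ^ Suc k) < 1" using q by simp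
  thus ?thesis by auto
qed

lemma euler_summable: "summable (\<lambda>k. norm (euler_coeff q k * x ^ k))"
proof (rule super_ratio_summable[of "norm q" _ "1 / (1 - norm q)"])
  fix k
  have "norm (q ^ Suc k) \<le> norm q" unfolding norm_power using q
    by (metis less_imp_le mult_left_le norm_ge_zero power_Suc power_le_one)
  hence "1 - norm q \<le> norm (1 - q ^ Suc k)" using norm_triangle_ineq2[of 1 "q ^ Suc k"] by simp
  hence "norm q ^ k / norm (1 - q ^ Suc k) \<le> norm q ^ k / (1 - norm q)"
    using q one_minus_power_nz[of k]
    by (intro divide_left_mono mult_pos_pos) auto
  hence "norm q ^ k / norm (1 - q ^ Suc k) * norm (euler_coeff q k)
      \<le> norm q ^ k / (1 - norm q) * norm (euler_coeff q k)" by (intro mult_right_mono) auto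
  thus "norm (euler_coeff q (Suc k)) \<le> 1 / (1 - norm q) * norm q ^ k * norm (euler_coeff q k)"
    by (simp add: norm_mult norm_divide norm_power)
qed (use q in auto)

lemma tri_summable: "summable (\<lambda>k. norm (tri_coeff q k * x ^ k))"
  by (rule super_ratio_summable[of "norm q" _ "norm q"]) (use q in \<open>auto simp: norm_mult norm_power\<close>)

lemma euler_entire: "euler_series q holomorphic_on UNIV"
  unfolding euler_series_def by (intro powser_entire summable_norm_cancel[OF euler_summable])

lemma tri_entire: "tri_series q holomorphic_on UNIV"
  unfolding tri_series_def by (intro powser_entire summable_norm_cancel[OF tri_summable])

lemma euler_0: "euler_series q 0 = 1"
  unfolding euler_series_def by (subst powser_zero) simp

lemma tri_0: "tri_series q 0 = 1"
  unfolding tri_series_def by (subst powser_zero) simp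

lemma tri_eq: "tri_series q x = 1 - q * x * tri_series q (q * x)"
proof -
  have "tri_series q x = (\<Sum>k. tri_coeff q (Suc k) * x ^ Suc k) + tri_coeff q 0 * x ^ 0"
    unfolding tri_series_def by (subst suminf_split_head[OF summable_norm_cancel[OF tri_summable]]) simp
  also have "(\<Sum>k. tri_coeff q (Suc k) * x ^ Suc k) = (\<Sum>k. (- q * x) * (tri_coeff q k * (q * x) ^ k))"
    by (intro arg_cong[of _ _ suminf] ext) (simp add: power_mult_distrib mult_ac)
  also have "\<dots> = - q * x * tri_series q (q * x)"
    unfolding tri_series_def by (rule suminf_mult[OF summable_norm_cancel[OF tri_summable]])
  finally show ?thesis by simp
qed

lemma euler_eq: "euler_series q x = (1 - x) * euler_series q (q * x)"
proof -
  note S = summable_norm_cancel[OF euler_summable]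
  have "euler_series q x - euler_series q (q * x) = (\<Sum>k. euler_coeff q k * x ^ k - euler_coeff q k * (q * x) ^ k)"
    unfolding euler_series_def by (rule suminf_diff[OF S S])
  also have "\<dots> = (\<Sum>k. euler_coeff q (Suc k) * x ^ Suc k - euler_coeff q (Suc k) * (q * x) ^ Suc k)"
    by (subst suminf_split_head[OF summable_diff[OF S S]]) simp
  also have "\<dots> = (\<Sum>k. (- x) * (euler_coeff q k * (q * x) ^ k))"
  proof (intro arg_cong[of _ _ suminf] ext)
    fix k
    have "euler_coeff q (Suc k) * x ^ Suc k - euler_coeff q (Suc k) * (q * x) ^ Suc k
        = (euler_coeff q (Suc k) * (1 - q ^ Suc k)) * x ^ Suc k"
      by (simp add: power_mult_distrib algebra_simps del: euler_coeff.simps)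
    also have "euler_coeff q (Suc k) * (1 - q ^ Suc k) = - (q ^ k) * euler_coeff q k"
      using one_minus_power_nz[of k] by simp
    finally show "euler_coeff q (Suc k) * x ^ Suc k - euler_coeff q (Suc k) * (q * x) ^ Suc k
       = (- x) * (euler_coeff q k * (q * x) ^ k)" by (simp add: power_mult_distrib mult_ac)
  qed
  also have "\<dots> = - x * euler_series q (q * x)"
    unfolding euler_series_def by (rule suminf_mult[OF S])
  finally show ?thesis by (simp add: algebra_simps)
qed

text \<open>A zero at \<open>x\<close> propagates to \<open>q * x\<close> unless
  \<open>x = 1\<close>. If no factor \<open>1 - x * q ^ j\<close> vanished, all points
  \<open>x * q ^ N\<close> would be zeros; they tend to 0, where the series has the value 1.\<close>

lemma euler_zero:
  assumes "euler_series q x = 0"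
  shows "\<exists>j. x * q ^ j = 1"
proof (rule ccontr)
  assume no: "\<not> ?thesis"
  have 0: "euler_series q (x * q ^ N) = 0" for N
  proof (induction N)
    case (Suc N)
    have "x * q ^ N \<noteq> 1" using no by blast
    thus ?case using euler_eq[of "x * q ^ N"] Suc by (simp add: mult_ac)
  qed (use assms in simp)
  have "(\<lambda>N. x * q ^ N) \<longlonglongrightarrow> x * 0" by (intro tendsto_intros LIMSEQ_power_zero q)
  moreover have "isCont (euler_series q) 0"
    using holomorphic_on_imp_continuous_on[OF euler_entire] by (simp add: continuous_on_eq_continuous_at)
  ultimately have "(\<lambda>N. euler_series q (x * q ^ N)) \<longlonglongrightarrow> euler_series q 0"
    by (intro isCont_tendsto_compose[where g = "euler_series q"]) simp_all
  thus False using 0 euler_0 LIMSEQ_unique[OF _ tendsto_const] by fastforce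
qed

end

subsection \<open>The theta function of a lattice\<close>

text \<open>The second period is a parameter because two lattices occur: that of
  \<open>\<eta>\<close> governs the poles of the matrix and the zeros of the determinant, that of
  \<open>n * \<eta>\<close> the zeros of the theta functions of order n.\<close>

definition period_lattice :: "complex \<Rightarrow> complex set" where
  "period_lattice \<eta> = {of_int a + of_int b * \<eta> | a b. True}"

lemma lattice_0 [simp]: "0 \<in> period_lattice \<eta>" unfolding period_lattice_def by (auto intro!: exI[of _ 0])
lemma lattice_add: "x \<in> period_lattice \<eta> \<Longrightarrow> y \<in> period_lattice \<eta> \<Longrightarrow> x + y \<in> period_lattice \<eta>"
  unfolding period_lattice_def
proof safe
  fix a b c d
  show "\<exists>a' b'. of_int a + of_int b * \<eta> + (of_int c + of_int d * \<eta>) = of_int a' + of_int b' * \<eta> \<and> True"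
    by (intro exI[of _ "a + c"] exI[of _ "b + d"]) (simp add: algebra_simps)
qed
lemma lattice_uminus: "x \<in> period_lattice \<eta> \<Longrightarrow> - x \<in> period_lattice \<eta>"
  unfolding period_lattice_def
proof safe
  fix a b
  show "\<exists>a' b'. - (of_int a + of_int b * \<eta>) = of_int a' + of_int b' * \<eta> \<and> True"
    by (intro exI[of _ "- a"] exI[of _ "- b"]) (simp add: algebra_simps)
qed
lemma lattice_uminus_iff [simp]: "- x \<in> period_lattice \<eta> \<longleftrightarrow> x \<in> period_lattice \<eta>"
  using lattice_uminus[of x] lattice_uminus[of "- x"] by auto
lemma lattice_diff: "x \<in> period_lattice \<eta> \<Longrightarrow> y \<in> period_lattice \<eta> \<Longrightarrow> x - y \<in> period_lattice \<eta>"
  using lattice_add[of x \<eta> "- y"] by simp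
lemma lattice_add_iff: "y \<in> period_lattice \<eta> \<Longrightarrow> x + y \<in> period_lattice \<eta> \<longleftrightarrow> x \<in> period_lattice \<eta>"
  using lattice_add[of x \<eta> y] lattice_diff[of "x + y" \<eta> y] by auto
lemma lattice_1 [simp]: "1 \<in> period_lattice \<eta>" unfolding period_lattice_def
  by (intro CollectI exI[of _ 1] exI[of _ 0]) simp
lemma lattice_eta [simp]: "\<eta> \<in> period_lattice \<eta>" unfolding period_lattice_def
  by (intro CollectI exI[of _ 0] exI[of _ 1]) simp
lemma lattice_intro [simp]: "of_int a + of_int b * \<eta> \<in> period_lattice \<eta>" unfolding period_lattice_def by blast

text \<open>By the Jacobi triple product this is \<open>theta\<close> up to a constant; unlike the series, it shows the zeros.\<close>
definition tht :: "complex \<Rightarrow> complex \<Rightarrow> complex" where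
  "tht \<eta> z = euler_series (ee \<eta>) (ee z) * euler_series (ee \<eta>) (ee \<eta> * ee (- z))"

text \<open>A bound rather than an exact order: it records a zero of multiplicity at least
  \<open>a\<close>, makes sense for the zero function, and passes to quotients.\<close>

definition vanishes_to_order :: "(complex \<Rightarrow> complex) \<Rightarrow> complex \<Rightarrow> nat \<Rightarrow> bool" where
  "vanishes_to_order f p a \<longleftrightarrow> (\<exists>C. eventually (\<lambda>z. norm (f z) \<le> C * norm (z - p) ^ a) (at p))"

context
  fixes \<eta> :: complex
  assumes eta: "Im \<eta> > 0"
begin

lemma norm_nome: "norm (ee \<eta>) < 1" using eta by (simp add: norm_ee)

lemma holomorphic_on_euler [holomorphic_intros]:
  "f holomorphic_on S \<Longrightarrow> (\<lambda>z. euler_series (ee \<eta>) (f z)) holomorphic_on S"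
  using holomorphic_on_compose[OF _ holomorphic_on_subset[OF euler_entire[OF norm_nome]], of f S]
  by (simp add: o_def)

lemma holomorphic_on_tht [holomorphic_intros]: "f holomorphic_on S \<Longrightarrow> (\<lambda>z. tht \<eta> (f z)) holomorphic_on S"
  unfolding tht_def by (intro holomorphic_intros)

lemma tht_entire: "tht \<eta> holomorphic_on UNIV"
  using holomorphic_on_tht[OF holomorphic_on_ident] by simp

lemma isCont_tht: "isCont (tht \<eta>) z"
  using holomorphic_on_imp_continuous_on[OF tht_entire] by (simp add: continuous_on_eq_continuous_at)

lemma tht_add_1: "tht \<eta> (z + 1) = tht \<eta> z"
  unfolding tht_def by (simp add: ee_add ee_diff ee_minus)

lemma tht_alt: "tht \<eta> z = (1 - ee z) * euler_series (ee \<eta>) (ee \<eta> * ee z) * euler_series (ee \<eta>) (ee \<eta> * ee (- z))"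
  unfolding tht_def using euler_eq[OF norm_nome, of "ee z"] by simp

text \<open>The translation multiplies the argument of one Euler factor by the nome and divides that
  of the other. Correcting by \<open>euler_eq\<close> exchanges \<open>1 - ee z\<close> for
  \<open>1 - ee (- z)\<close>, and the quotient of these is the multiplier.\<close>

lemma tht_add_eta: "tht \<eta> (z + \<eta>) = - ee (- z) * tht \<eta> z"
proof -
  have "ee \<eta> * ee (- (z + \<eta>)) = ee (- z)" by (simp add: ee_add ee_minus ee_diff field_simps)
  hence "tht \<eta> (z + \<eta>) = euler_series (ee \<eta>) (ee \<eta> * ee z) * euler_series (ee \<eta>) (ee (- z))"
    unfolding tht_def by (simp add: ee_add mult_ac)
  also have "\<dots> = (1 - ee (- z)) * euler_series (ee \<eta>) (ee \<eta> * ee z) * euler_series (ee \<eta>) (ee \<eta> * ee (- z))"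
    using euler_eq[OF norm_nome, of "ee (- z)"] by simp
  also have "1 - ee (- z) = - ee (- z) * (1 - ee z)" by (simp add: ee_minus field_simps)
  finally show ?thesis unfolding tht_alt[of z] by simp
qed

lemma tht_uminus: "tht \<eta> (- z) = - ee (- z) * tht \<eta> z"
proof -
  have "1 - ee (- z) = - ee (- z) * (1 - ee z)" by (simp add: ee_minus field_simps)
  thus ?thesis unfolding tht_alt[of z] tht_alt[of "- z"] by simp
qed

text \<open>A nowhere vanishing entire multiplier carries the behaviour at 0, including the order of
  the zero, to every lattice point.\<close>

lemma tht_unit:
  obtains c where "\<And>z. c z \<noteq> 0" "\<And>z. tht \<eta> (z + (of_int a + of_int b * \<eta>)) = c z * tht \<eta> z"
    "c holomorphic_on UNIV"
proof -
  have "\<exists>c. (\<forall>z. c z \<noteq> 0) \<and> (\<forall>z. tht \<eta> (z + of_int b * \<eta>) = c z * tht \<eta> z) \<and> c holomorphic_on UNIV"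
  proof (induction b rule: int_induct[of _ 0])
    case base
    show ?case by (intro exI[of _ "\<lambda>_. 1"]) auto
  next
    case (step1 i)
    then obtain c where c: "\<And>z. c z \<noteq> 0" "\<And>z. tht \<eta> (z + of_int i * \<eta>) = c z * tht \<eta> z" "c holomorphic_on UNIV" by blast
    have "tht \<eta> (z + of_int (i + 1) * \<eta>) = (- ee (- (z + of_int i * \<eta>)) * c z) * tht \<eta> z" for z
      using tht_add_eta[of "z + of_int i * \<eta>"] c(2)[of z] by (simp add: algebra_simps)
    thus ?case using c
      by (intro exI[of _ "\<lambda>z. - ee (- (z + of_int i * \<eta>)) * c z"]) (auto intro!: holomorphic_intros)
  next
    case (step2 i)
    then obtain c where c: "\<And>z. c z \<noteq> 0" "\<And>z. tht \<eta> (z + of_int i * \<eta>) = c z * tht \<eta> z" "c holomorphic_on UNIV" by blast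
    have "tht \<eta> (z + of_int (i - 1) * \<eta>) = (- ee (z + of_int (i - 1) * \<eta>) * c z) * tht \<eta> z" for z
    proof -
      define w where "w = z + of_int (i - 1) * \<eta>"
      have "w + \<eta> = z + of_int i * \<eta>" unfolding w_def by (simp add: algebra_simps)
      hence "- ee (- w) * tht \<eta> w = c z * tht \<eta> z" using tht_add_eta[of w] c(2)[of z] by simp
      moreover have "tht \<eta> w = - ee w * (- ee (- w) * tht \<eta> w)" by (simp add: ee_minus)
      ultimately show ?thesis unfolding w_def[symmetric] by simp
    qed
    thus ?case using c
      by (intro exI[of _ "\<lambda>z. - ee (z + of_int (i - 1) * \<eta>) * c z"]) (auto intro!: holomorphic_intros)
  qed
  then obtain c where c: "\<And>z. c z \<noteq> 0" "\<And>z. tht \<eta> (z + of_int b * \<eta>) = c z * tht \<eta> z" "c holomorphic_on UNIV" by blast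
  have "tht \<eta> (z + (of_int a + of_int b * \<eta>)) = c z * tht \<eta> z" for z
    using shift_int_induct[of "tht \<eta>" 1 "z + of_int b * \<eta>" a, OF tht_add_1] c(2)[of z] by (simp add: algebra_simps)
  thus thesis using that c by blast
qed

text \<open>The zero is simple: \<open>1 - ee z\<close> has a nonzero derivative at 0, and the
  remaining Euler factors are nonzero there by \<open>euler_zero\<close>.\<close>

lemma tht_at_0:
  obtains G where "G holomorphic_on UNIV" "G 0 \<noteq> 0" "\<And>z. tht \<eta> z = z * G z"
proof -
  have "(\<lambda>z. 1 - ee z) holomorphic_on UNIV" by (intro holomorphic_intros)
  then obtain g where g: "g holomorphic_on UNIV" "\<And>z. 1 - ee z = (z - 0) * g z"
    using entire_divide_root[of "\<lambda>z. 1 - ee z" 0] by (metis ee_0 diff_self)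
  have "((\<lambda>z. 1 - ee z) has_field_derivative - (2 * of_real pi * \<i>)) (at 0)"
    unfolding ee_def by (auto intro!: derivative_eq_intros)
  moreover have "((\<lambda>z. 1 - ee z) has_field_derivative g 0) (at 0)"
  proof -
    have "(g has_field_derivative deriv g 0) (at 0)" using holomorphic_derivI[OF g(1)] by auto
    thus ?thesis unfolding g(2) by (auto intro!: derivative_eq_intros)
  qed
  ultimately have g0: "g 0 \<noteq> 0" using DERIV_unique by fastforce
  have E: "euler_series (ee \<eta>) (ee \<eta>) \<noteq> 0"
  proof
    assume "euler_series (ee \<eta>) (ee \<eta>) = 0"
    then obtain j where "ee \<eta> * ee \<eta> ^ j = 1" using euler_zero[OF norm_nome] by blast
    thus False using one_minus_power_nz[OF norm_nome, of j] by simp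
  qed
  show thesis
    by (rule that[of "\<lambda>z. g z * euler_series (ee \<eta>) (ee \<eta> * ee z) * euler_series (ee \<eta>) (ee \<eta> * ee (- z))"])
       (use g g0 E tht_alt in \<open>auto intro!: holomorphic_intros simp: mult_ac\<close>)
qed

lemma tht_0 [simp]: "tht \<eta> 0 = 0" unfolding tht_alt by simp

lemma tht_eq_0_iff: "tht \<eta> z = 0 \<longleftrightarrow> z \<in> period_lattice \<eta>"
proof
  assume "z \<in> period_lattice \<eta>"
  then obtain a b where z: "z = of_int a + of_int b * \<eta>" unfolding period_lattice_def by blast
  obtain c where c: "\<And>w. tht \<eta> (w + (of_int a + of_int b * \<eta>)) = c w * tht \<eta> w"
    using tht_unit[of a b] by blast
  show "tht \<eta> z = 0" using c[of 0] z by simp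
next
  have eq: "w \<in> period_lattice \<eta>" if "ee (w + of_int b * \<eta>) = 1" for w b
  proof -
    obtain k where "w + of_int b * \<eta> = of_int k" using \<open>ee (w + of_int b * \<eta>) = 1\<close>
      unfolding ee_eq_1_iff by (auto elim: Ints_cases)
    hence "w = of_int k + of_int (- b) * \<eta>" by (simp add: algebra_simps)
    thus ?thesis by (metis lattice_intro)
  qed
  have pw: "ee \<eta> ^ j = ee (of_int (int j) * \<eta>)" for j using ee_of_nat_mult[of j \<eta>] by simp
  assume "tht \<eta> z = 0"
  hence "euler_series (ee \<eta>) (ee z) = 0 \<or> euler_series (ee \<eta>) (ee \<eta> * ee (- z)) = 0" unfolding tht_def by simp
  thus "z \<in> period_lattice \<eta>"
  proof
    assume "euler_series (ee \<eta>) (ee z) = 0"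
    then obtain j where "ee z * ee \<eta> ^ j = 1" using euler_zero[OF norm_nome] by blast
    thus ?thesis by (intro eq[of z "int j"]) (simp only: ee_add pw)
  next
    assume "euler_series (ee \<eta>) (ee \<eta> * ee (- z)) = 0"
    then obtain j where "ee \<eta> * ee (- z) * ee \<eta> ^ j = 1" using euler_zero[OF norm_nome] by blast
    hence "ee (- z) * ee \<eta> ^ Suc j = 1" by (simp add: mult_ac)
    hence "- z \<in> period_lattice \<eta>" by (intro eq[of "- z" "int (Suc j)"]) (simp only: ee_add pw)
    thus ?thesis by simp
  qed
qed

lemma tht_local:
  assumes "p \<in> period_lattice \<eta>"
  obtains G where "G holomorphic_on UNIV" "G p \<noteq> 0" "\<And>z. tht \<eta> z = (z - p) * G z"
proof -
  obtain a b where p: "p = of_int a + of_int b * \<eta>" using assms unfolding period_lattice_def by blast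
  obtain c where c: "\<And>z. c z \<noteq> 0" "\<And>z. tht \<eta> (z + p) = c z * tht \<eta> z" "c holomorphic_on UNIV"
    unfolding p using tht_unit[of a b] by blast
  obtain G where G: "G holomorphic_on UNIV" "G 0 \<noteq> 0" "\<And>z. tht \<eta> z = z * G z" by (rule tht_at_0, rule that)
  have cc: "(\<lambda>z. c (z - p)) holomorphic_on UNIV" "(\<lambda>z. G (z - p)) holomorphic_on UNIV"
    by (rule entire_shift[OF c(3)], rule entire_shift[OF G(1)])
  have "tht \<eta> z = (z - p) * (c (z - p) * G (z - p))" for z
    using c(2)[of "z - p"] G(3)[of "z - p"] by simp
  moreover have "(\<lambda>z. c (z - p) * G (z - p)) holomorphic_on UNIV" by (intro holomorphic_on_mult cc)
  moreover have "c (p - p) * G (p - p) \<noteq> 0" using c(1) G(2) by simp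
  ultimately show thesis using that[of "\<lambda>z. c (z - p) * G (z - p)"] by blast
qed

text \<open>The lattice is the zero set of \<open>tht \<eta>\<close>, so its discreteness is read
  off from the simple zeros instead of the geometry of the periods.\<close>

lemma lattice_isolated:
  "eventually (\<lambda>z. z \<notin> period_lattice \<eta>) (at p)"
proof (cases "p \<in> period_lattice \<eta>")
  case True
  obtain G where G: "G holomorphic_on UNIV" "G p \<noteq> 0" "\<And>z. tht \<eta> z = (z - p) * G z" by (rule tht_local[OF True], rule that)
  have "isCont G p" using holomorphic_on_imp_continuous_on[OF G(1)] by (simp add: continuous_on_eq_continuous_at)
  hence "eventually (\<lambda>z. G z \<noteq> 0) (at p)" using G(2) by (intro tendsto_imp_eventually_ne) (auto simp: isCont_def)
  moreover have "eventually (\<lambda>z. z \<noteq> p) (at p)" by (simp add: eventually_at_filter)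
  ultimately show ?thesis by eventually_elim (use G(3) in \<open>simp flip: tht_eq_0_iff\<close>)
next
  case False
  hence "eventually (\<lambda>z. tht \<eta> z \<noteq> 0) (at p)"
    using isCont_tht[of p] by (intro tendsto_imp_eventually_ne) (auto simp: isCont_def tht_eq_0_iff)
  thus ?thesis by (simp add: tht_eq_0_iff)
qed

lemma translate_isolated: "eventually (\<lambda>z. z - p \<notin> period_lattice \<eta>) (at x)"
proof -
  have "filterlim (\<lambda>z. z - p) (at (x - p)) (at x)"
    by (auto simp: filterlim_at eventually_at_filter intro!: tendsto_intros)
  from filterlim_iff[THEN iffD1, OF this] lattice_isolated[of "x - p"] show ?thesis by auto
qed

lemma closed_lattice: "closed (period_lattice \<eta>)"
proof -
  have "period_lattice \<eta> = tht \<eta> -` {0}" by (auto simp: tht_eq_0_iff)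
  thus ?thesis using continuous_closed_vimage[of "{0}" "tht \<eta>"] isCont_tht by auto
qed

lemma lattice_disc:
  assumes "p \<in> period_lattice \<eta>" shows "\<exists>r>0. ball p r \<inter> period_lattice \<eta> \<subseteq> {p}"
proof -
  obtain r where "r > 0" "\<forall>z. z \<noteq> p \<and> dist z p < r \<longrightarrow> z \<notin> period_lattice \<eta>"
    using lattice_isolated[of p] unfolding eventually_at by auto
  thus ?thesis by (intro exI[of _ r]) (auto simp: dist_commute)
qed

text \<open>Identities are verified where no denominator vanishes and then extended by continuity,
  since the excluded set is discrete.\<close>

lemma lattice_cancel:
  assumes "f holomorphic_on UNIV" "g holomorphic_on UNIV" "\<And>z. z - p \<notin> period_lattice \<eta> \<Longrightarrow> f z = g z"
  shows "f z = (g z :: complex)"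
proof -
  have c: "isCont f z" "isCont g z"
    using holomorphic_on_imp_continuous_on[OF assms(1)] holomorphic_on_imp_continuous_on[OF assms(2)]
    by (auto simp: continuous_on_eq_continuous_at)
  have "eventually (\<lambda>z. f z = g z) (at z)"
    using translate_isolated[of p z] by eventually_elim (rule assms(3))
  hence "(f \<longlongrightarrow> g z) (at z)" using c(2) unfolding isCont_def by (subst tendsto_cong) auto
  from LIM_unique[OF c(1)[unfolded isCont_def] this] show ?thesis .
qed

text \<open>Quasi-periodicity spreads the zero at \<open>p\<close> over \<open>p\<close> plus the
  lattice, so the quotient by \<open>tht \<eta> (z - p)\<close> is entire. Its multiplier loses one
  factor \<open>ee (- z)\<close>: the degree drops from \<open>N\<close> to
  \<open>N - 1\<close>.\<close>

lemma tht_quotient: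
  fixes N :: int
  assumes hol: "f holomorphic_on UNIV" and p1: "\<And>z. f (z + 1) = u * f z"
    and p2: "\<And>z. f (z + \<eta>) = v * ee (- of_int N * z) * f z" and f0: "f p = 0"
  obtains g where "g holomorphic_on UNIV" "\<And>z. f z = tht \<eta> (z - p) * g z" "\<And>z. g (z + 1) = u * g z"
    "\<And>z. g (z + \<eta>) = (- v * ee (- p)) * ee (- of_int (N - 1) * z) * g z"
proof -
  have uz: "f (p + (of_int a + of_int b * \<eta>)) = 0" for a b
  proof -
    have z1: "f (z + 1) = 0 \<longleftrightarrow> f z = 0" if "u \<noteq> 0" for z using p1 that by simp
    show ?thesis
    proof (cases "u = 0 \<or> v = 0")
      \<comment> \<open>A vanishing multiplier makes \<open>f\<close> identically zero.\<close>
      case True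
      hence "f z = 0" for z using p1[of "z - 1"] p2[of "z - \<eta>"] by auto
      thus ?thesis by blast
    next
      case False
      have "(f ((p + of_int b * \<eta>) + of_int a * 1) = 0) = (f (p + of_int b * \<eta>) = 0)"
        by (rule shift_int_induct[of "\<lambda>z. f z = 0"]) (use p1 False in auto)
      also have "\<dots> = (f p = 0)"
        by (rule shift_int_induct[of "\<lambda>z. f z = 0"]) (use p2 False in auto)
      finally show ?thesis using f0 by (simp add: algebra_simps)
    qed
  qed
  have fh: "(\<lambda>z. f (z + p)) holomorphic_on UNIV"
    by (rule entire_shift[OF hol])
  obtain g where g: "g holomorphic_on UNIV" "\<And>z. z \<notin> period_lattice \<eta> \<Longrightarrow> g z = f (z + p) / tht \<eta> z"
  proof (rule entire_extension[of "\<lambda>z. f (z + p) / tht \<eta> z" "period_lattice \<eta>", OF _ closed_lattice lattice_disc])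
    show "(\<lambda>z. f (z + p) / tht \<eta> z) holomorphic_on - period_lattice \<eta>"
      by (intro holomorphic_intros holomorphic_on_subset[OF fh]) (auto simp: tht_eq_0_iff)
    fix r assume r: "r \<in> period_lattice \<eta>"
    obtain G where G: "G holomorphic_on UNIV" "G r \<noteq> 0" "\<And>z. tht \<eta> z = (z - r) * G z" by (rule tht_local[OF r], rule that)
    have "((\<lambda>z. f (z + p) / G z) \<longlongrightarrow> f (r + p) / G r) (at r)"
      using holomorphic_on_imp_continuous_on[OF G(1)] holomorphic_on_imp_continuous_on[OF fh] G(2)
      by (intro tendsto_divide) (auto simp: continuous_on_eq_continuous_at isCont_def)
    moreover have "f (r + p) = 0" using r uz unfolding period_lattice_def by (auto simp: add.commute)
    moreover have "eventually (\<lambda>z. f (z + p) / G z = (z - r) * (f (z + p) / tht \<eta> z)) (at r)"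
      unfolding eventually_at_filter by (rule always_eventually) (auto simp: G(3))
    ultimately show "((\<lambda>z. (z - r) * (f (z + p) / tht \<eta> z)) \<longlongrightarrow> 0) (at r)"
      using tendsto_cong[of "\<lambda>z. f (z + p) / G z"] by fastforce
  next
    fix g assume "g holomorphic_on UNIV" "\<And>z. z \<notin> period_lattice \<eta> \<Longrightarrow> g z = f (z + p) / tht \<eta> z"
    thus thesis by (rule that)
  qed
  define h where "h z = g (z - p)" for z
  have hh: "h holomorphic_on UNIV"
    unfolding h_def by (rule entire_shift[OF g(1)])
  have hs: "(\<lambda>z. h (z + c)) holomorphic_on UNIV" for c
    by (rule entire_shift[OF hh])
  have h_eq: "h z = f z / tht \<eta> (z - p)" if "z - p \<notin> period_lattice \<eta>" for z unfolding h_def using g(2)[OF that] by simp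
  show thesis
  proof (rule that[OF hh])
    show "f z = tht \<eta> (z - p) * h z" for z
      by (rule lattice_cancel[OF hol, of _ p])
         (auto intro!: holomorphic_intros hh simp: h_eq tht_eq_0_iff)
    show "h (z + 1) = u * h z" for z
    proof (rule lattice_cancel[of "\<lambda>z. h (z + 1)" "\<lambda>z. u * h z" p])
      fix z assume z: "z - p \<notin> period_lattice \<eta>"
      hence z': "(z + 1) - p \<notin> period_lattice \<eta>" using lattice_add_iff[of 1 \<eta> "z - p"] by (simp add: algebra_simps)
      have t: "tht \<eta> ((z + 1) - p) = tht \<eta> (z - p)"
        using tht_add_1[of "z - p"] by (simp add: algebra_simps)
      show "h (z + 1) = u * h z" unfolding h_eq[OF z] h_eq[OF z'] p1 t by simp
    qed (intro holomorphic_intros hs hh)+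
    show "h (z + \<eta>) = (- v * ee (- p)) * ee (- of_int (N - 1) * z) * h z" for z
    proof (rule lattice_cancel[of "\<lambda>z. h (z + \<eta>)" "\<lambda>z. (- v * ee (- p)) * ee (- of_int (N - 1) * z) * h z" p])
      fix z assume z: "z - p \<notin> period_lattice \<eta>"
      hence z': "(z + \<eta>) - p \<notin> period_lattice \<eta>" using lattice_add_iff[of \<eta> \<eta> "z - p"] by (simp add: algebra_simps)
      have t: "tht \<eta> ((z + \<eta>) - p) = - ee (- (z - p)) * tht \<eta> (z - p)"
        using tht_add_eta[of "z - p"] by (simp add: algebra_simps)
      have e: "ee (- of_int N * z) = ee (- (z - p)) * ee (- p) * ee (- of_int (N - 1) * z)"
        unfolding ee_add[symmetric] by (simp add: algebra_simps)
      show "h (z + \<eta>) = (- v * ee (- p)) * ee (- of_int (N - 1) * z) * h z"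
        unfolding h_eq[OF z] h_eq[OF z'] p2 t e by simp
    qed (intro holomorphic_intros hs hh)+
  qed
qed

text \<open>In degree one, dividing out the zero at 0 leaves a function with both periods, hence a
  constant. The theta series and the products of its translates are recognised by this
  uniqueness.\<close>

lemma tht_unique:
  assumes hol: "f holomorphic_on UNIV" and p1: "\<And>z. f (z + 1) = f z"
    and p2: "\<And>z. f (z + \<eta>) = - ee (- z) * f z" and f0: "f 0 = 0"
  obtains K where "\<And>z. f z = K * tht \<eta> z"
proof -
  obtain g where g: "g holomorphic_on UNIV" "\<And>z. f z = tht \<eta> (z - 0) * g z" "\<And>z. g (z + 1) = 1 * g z"
    "\<And>z. g (z + \<eta>) = (- (-1) * ee (- 0)) * ee (- of_int (1 - 1) * z) * g z"
    by (rule tht_quotient[OF hol, of 1 "-1" 1 0]) (use p1 p2 f0 in auto)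
  obtain c where "\<And>z. g z = c"
    by (rule doubly_periodic_norm_constant[OF eta g(1)]) (use g(3,4) in auto)
  thus thesis using that[of c] g(2) by (simp add: mult.commute)
qed

section \<open>Orders of vanishing and division by several theta factors\<close>

lemma vanishes_to_order_quotient:
  assumes f: "\<And>z. f z = h z * g z" and h: "h holomorphic_on UNIV"
    and G: "G holomorphic_on UNIV" "G p \<noteq> 0" "\<And>z. h z = (z - p) ^ e * G z"
    and van: "vanishes_to_order f p (e + b)"
  shows "vanishes_to_order g p b"
proof -
  obtain C where C: "eventually (\<lambda>z. norm (f z) \<le> C * norm (z - p) ^ (e + b)) (at p)"
    using van unfolding vanishes_to_order_def by blast
  define d where "d = norm (G p) / 2"
  have d: "d > 0" using G(2) by (simp add: d_def)
  have "isCont G p" using holomorphic_on_imp_continuous_on[OF G(1)] by (simp add: continuous_on_eq_continuous_at)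
  hence "((\<lambda>z. norm (G z)) \<longlongrightarrow> norm (G p)) (at p)" by (intro tendsto_norm) (simp add: isCont_def)
  hence "eventually (\<lambda>z. norm (G z) > d) (at p)" by (rule order_tendstoD(1)) (use G(2) in \<open>simp add: d_def\<close>)
  moreover have "eventually (\<lambda>z. z \<noteq> p) (at p)" by (simp add: eventually_at_filter)
  ultimately have "eventually (\<lambda>z. norm (g z) \<le> C / d * norm (z - p) ^ b) (at p)" using C
  proof eventually_elim
    case (elim z)
    have np: "norm (z - p) ^ e > 0" using elim by simp
    have "norm (z - p) ^ e * (norm (G z) * norm (g z)) \<le> norm (z - p) ^ e * (C * norm (z - p) ^ b)"
      using elim(3) unfolding f G(3) by (simp add: norm_mult norm_power power_add mult_ac)
    hence "norm (G z) * norm (g z) \<le> C * norm (z - p) ^ b" using np by simp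
    moreover have "d * norm (g z) \<le> norm (G z) * norm (g z)" using elim(1) by (intro mult_right_mono) auto
    ultimately show ?case using d by (simp add: field_simps)
  qed
  thus ?thesis unfolding vanishes_to_order_def by blast
qed

lemma vanishes_to_order_imp_zero:
  assumes "vanishes_to_order f p (Suc a)" "f holomorphic_on UNIV"
  shows "f p = 0"
proof -
  obtain C where C: "eventually (\<lambda>z. norm (f z) \<le> C * norm (z - p) ^ Suc a) (at p)"
    using assms unfolding vanishes_to_order_def by blast
  have "((\<lambda>z. C * norm (z - p) ^ Suc a) \<longlongrightarrow> C * norm (p - p) ^ Suc a) (at p)" by (intro tendsto_intros)
  hence "(f \<longlongrightarrow> 0) (at p)" by (intro Lim_null_comparison[OF C]) simp
  moreover have "(f \<longlongrightarrow> f p) (at p)"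
    using holomorphic_on_imp_continuous_on[OF assms(2)] by (simp add: continuous_on_eq_continuous_at isCont_def)
  ultimately show ?thesis by (rule LIM_unique[symmetric])
qed

lemma tht_shift_local:
  obtains G where "G holomorphic_on UNIV" "G p \<noteq> 0" "\<And>z. tht \<eta> (z - p) = (z - p) * G z"
proof -
  obtain G where G: "G holomorphic_on UNIV" "G 0 \<noteq> 0" "\<And>z. tht \<eta> z = z * G z" by (rule tht_at_0, rule that)
  have "(\<lambda>z. G (z - p)) holomorphic_on UNIV"
    by (rule entire_shift[OF G(1)])
  thus thesis using that[of "\<lambda>z. G (z - p)"] G by auto
qed

text \<open>\<open>N\<close> is an integer because the division may run into negative degree; that
  case is excluded afterwards for functions that are not identically zero.\<close>

lemma tht_power_quotient:
  fixes N :: int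
  assumes "f holomorphic_on UNIV" "\<And>z. f (z + 1) = u * f z"
    "\<And>z. f (z + \<eta>) = v * ee (- of_int N * z) * f z" "v \<noteq> 0" "vanishes_to_order f p a"
  shows "\<exists>g v'. g holomorphic_on UNIV \<and> (\<forall>z. f z = tht \<eta> (z - p) ^ a * g z) \<and> (\<forall>z. g (z + 1) = u * g z) \<and>
    v' \<noteq> 0 \<and> (\<forall>z. g (z + \<eta>) = v' * ee (- of_int (N - int a) * z) * g z)"
  using assms
proof (induction a arbitrary: f v N)
  case 0
  thus ?case by (intro exI[of _ f] exI[of _ v]) auto
next
  case (Suc a)
  obtain g where g: "g holomorphic_on UNIV" "\<And>z. f z = tht \<eta> (z - p) * g z" "\<And>z. g (z + 1) = u * g z"
    "\<And>z. g (z + \<eta>) = (- v * ee (- p)) * ee (- of_int (N - 1) * z) * g z"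
    using tht_quotient[OF Suc.prems(1-3) vanishes_to_order_imp_zero[OF Suc.prems(5,1)]] by blast
  obtain G where G: "G holomorphic_on UNIV" "G p \<noteq> 0" "\<And>z. tht \<eta> (z - p) = (z - p) * G z" by (rule tht_shift_local, rule that)
  have "vanishes_to_order g p a"
    by (rule vanishes_to_order_quotient[OF g(2) _ G(1,2), where e = 1])
       (use G Suc.prems(5) in \<open>auto intro!: holomorphic_intros\<close>)
  from Suc.IH[OF g(1,3,4) _ this] Suc.prems(4)
  obtain g2 v' where g2: "g2 holomorphic_on UNIV" "\<And>z. g z = tht \<eta> (z - p) ^ a * g2 z" "\<And>z. g2 (z + 1) = u * g2 z"
     "v' \<noteq> 0" "\<And>z. g2 (z + \<eta>) = v' * ee (- of_int (N - 1 - int a) * z) * g2 z" by auto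
  thus ?case using g(2)
    by (intro exI[of _ g2] exI[of _ v']) (simp add: algebra_simps)
qed

lemma vanishes_to_order_nonunit:
  assumes f: "\<And>z. f z = h z * g z" and h: "h holomorphic_on UNIV" "h p \<noteq> 0" and van: "vanishes_to_order f p b"
  shows "vanishes_to_order g p b"
  by (rule vanishes_to_order_quotient[OF f h(1) h, where e = 0]) (use van in auto)

text \<open>Dividing out theta factors lowers the degree \<open>N\<close> of the factor of automorphy,
  and a function of negative degree vanishes.\<close>
lemma two_point_factorization:
  fixes N :: nat
  assumes hol: "f holomorphic_on UNIV" and u: "u \<noteq> 0" "\<And>z. f (z + 1) = u * f z"
    and v: "v \<noteq> 0" "\<And>z. f (z + \<eta>) = v * ee (- of_nat N * z) * f z" and nz: "f z0 \<noteq> 0"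
    and van: "vanishes_to_order f p a" "vanishes_to_order f p' b" and pp': "p' - p \<notin> period_lattice \<eta>"
    and ab: "a + b \<ge> N"
  shows "a + b = N \<and> (\<exists>K l. K \<noteq> 0 \<and> (\<forall>z. f z = K * exp (l * z) * tht \<eta> (z - p) ^ a * tht \<eta> (z - p') ^ b))"
proof -
  from tht_power_quotient[OF hol u(2) _ v(1) van(1), of "int N"] v(2)
  obtain g v1 where g: "g holomorphic_on UNIV" "\<And>z. f z = tht \<eta> (z - p) ^ a * g z" "\<And>z. g (z + 1) = u * g z"
    "v1 \<noteq> 0" "\<And>z. g (z + \<eta>) = v1 * ee (- of_int (int N - int a) * z) * g z" by auto
  have "vanishes_to_order g p' b"
    by (rule vanishes_to_order_nonunit[OF g(2) _ _ van(2)])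
       (use pp' in \<open>auto intro!: holomorphic_intros simp: tht_eq_0_iff\<close>)
  from tht_power_quotient[OF g(1,3,5,4) this]
  obtain h v2 where h: "h holomorphic_on UNIV" "\<And>z. g z = tht \<eta> (z - p') ^ b * h z" "\<And>z. h (z + 1) = u * h z"
    "v2 \<noteq> 0" "\<And>z. h (z + \<eta>) = v2 * ee (- of_int (int N - int a - int b) * z) * h z" by auto
  define M where "M = a + b - N"
  have M: "int N - int a - int b = - int M" using ab by (simp add: M_def)
  \<comment> \<open>Multiplying back by \<open>M\<close> theta factors with zero at 0 restores
    degree zero, so \<open>k\<close> has constant multipliers and is a multiple of an exponential.
    For positive \<open>M\<close> it vanishes at 0, which makes it identically zero.\<close>
  define k where "k z = h z * tht \<eta> z ^ M" for z
  have k1: "k (z + 1) = u * k z" for z unfolding k_def by (simp add: h(3) tht_add_1)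
  have k2: "k (z + \<eta>) = (v2 * (-1) ^ M) * k z" for z
  proof -
    have "ee (of_nat M * z) * ee (- z) ^ M = 1"
      unfolding ee_of_nat_mult[symmetric] ee_add[symmetric] by simp
    hence e: "ee (- of_int (- int M) * z) * ee (- z) ^ M = 1" by simp
    have p: "(- ee (- z) * tht \<eta> z) ^ M = (-1) ^ M * (ee (- z) ^ M * tht \<eta> z ^ M)"
      by (metis mult_minus1 mult_minus_left power_mult_distrib)
    have "k (z + \<eta>) = (v2 * (-1) ^ M) * k z * (ee (- of_int (- int M) * z) * ee (- z) ^ M)"
      unfolding k_def tht_add_eta h(5) M p by (simp only: mult_ac)
    thus ?thesis unfolding e by simp
  qed
  have kh: "k holomorphic_on UNIV" unfolding k_def by (intro holomorphic_intros h(1))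
  have "v2 * (-1) ^ M \<noteq> 0" using h(4) by simp
  then obtain K l where K: "\<And>z. k z = K * exp (l * z)"
    using entire_multiplicative[OF eta kh k1 k2 u(1)] by blast
  have M0: "M = 0"
  proof (rule ccontr)
    assume "M \<noteq> 0"
    hence "k 0 = 0" unfolding k_def by simp
    hence "K = 0" using K[of 0] by simp
    hence "h z = 0" if "z - 0 \<notin> period_lattice \<eta>" for z
      using K[of z] that tht_eq_0_iff[of z] unfolding k_def by simp
    hence "h z = 0" for z using lattice_cancel[of h "\<lambda>_. 0" 0 z] h(1) by simp
    thus False using nz g(2) h(2) by simp
  qed
  have hK: "h z = K * exp (l * z)" for z using K[of z] M0 unfolding k_def by simp
  have "K \<noteq> 0" using nz g(2) h(2) hK by auto
  moreover have "f z = K * exp (l * z) * tht \<eta> (z - p) ^ a * tht \<eta> (z - p') ^ b" for z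
    using g(2) h(2) hK by (simp add: mult_ac)
  ultimately show ?thesis using M0 ab unfolding M_def by auto
qed

end

subsection \<open>The theta functions of order \<open>n\<close>\<close>

lemma isCont_entire:
  assumes "f holomorphic_on UNIV" shows "isCont f z"
  using holomorphic_on_imp_continuous_on[OF assms] by (simp add: continuous_on_eq_continuous_at)

lemma vanishes_to_orderI:
  assumes "h holomorphic_on UNIV" "\<And>z. f z = (z - p) ^ a * h z"
  shows "vanishes_to_order f p a"
proof -
  have "((\<lambda>z. norm (h z)) \<longlongrightarrow> norm (h p)) (at p)"
    using isCont_entire[OF assms(1), of p] by (intro tendsto_norm) (simp add: isCont_def)
  hence "eventually (\<lambda>z. norm (h z) < norm (h p) + 1) (at p)" by (rule order_tendstoD(2)) simp
  hence "eventually (\<lambda>z. norm (f z) \<le> (norm (h p) + 1) * norm (z - p) ^ a) (at p)"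
  proof eventually_elim
    case (elim z)
    have "norm (h z) * norm (z - p) ^ a \<le> (norm (h p) + 1) * norm (z - p) ^ a"
      using elim by (intro mult_right_mono) auto
    thus ?case unfolding assms(2) by (simp add: norm_mult norm_power mult_ac)
  qed
  thus ?thesis unfolding vanishes_to_order_def by blast
qed

text \<open>For \<open>m = l\<close> the exponent m(m-1)/2 falls short by \<open>l\<close> of the
  exponent l(l+1)/2 in \<open>tri_coeff\<close>, which is why the series is evaluated at
  \<open>ee z / ee \<eta>\<close>. For \<open>m = - l\<close>, in the next lemma, the two exponents
  agree.\<close>

lemma theta_term_nat:
  "(-1) powi (int l) * ee (of_int (int l) * z + of_int (int l * (int l - 1)) / 2 * \<eta>)
     = tri_coeff (ee \<eta>) l * (ee z / ee \<eta>) ^ l"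
proof (induction l)
  case (Suc l)
  have e: "of_int (int (Suc l)) * z + of_int (int (Suc l) * (int (Suc l) - 1)) / 2 * \<eta>
    = (of_int (int l) * z + of_int (int l * (int l - 1)) / 2 * \<eta>) + (z + of_nat l * \<eta>)"
    by (simp add: field_simps)
  have "(-1) powi (int (Suc l)) * ee (of_int (int (Suc l)) * z + of_int (int (Suc l) * (int (Suc l) - 1)) / 2 * \<eta>)
     = - (ee z * ee \<eta> ^ l) * ((-1) powi (int l) * ee (of_int (int l) * z + of_int (int l * (int l - 1)) / 2 * \<eta>))"
    unfolding e ee_add ee_of_nat_mult by (simp add: power_int_def nat_add_distrib)
  also have "\<dots> = tri_coeff (ee \<eta>) (Suc l) * (ee z / ee \<eta>) ^ Suc l"
    unfolding Suc by (simp add: field_simps)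
  finally show ?case .
qed simp

lemma theta_term_neg:
  "(-1) powi (- int l) * ee (of_int (- int l) * z + of_int (- int l * (- int l - 1)) / 2 * \<eta>)
     = tri_coeff (ee \<eta>) l * (ee (- z)) ^ l"
proof (induction l)
  case (Suc l)
  have e: "of_int (- int (Suc l)) * z + of_int (- int (Suc l) * (- int (Suc l) - 1)) / 2 * \<eta>
    = (of_int (- int l) * z + of_int (- int l * (- int l - 1)) / 2 * \<eta>) + (- z + of_nat (Suc l) * \<eta>)"
    by (simp add: field_simps)
  have m: "(-1) powi (- int j) = ((-1) ^ j :: complex)" for j
    by (simp add: power_int_minus flip: power_inverse)
  have "(-1) powi (- int (Suc l)) * ee (of_int (- int (Suc l)) * z + of_int (- int (Suc l) * (- int (Suc l) - 1)) / 2 * \<eta>)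
     = - (ee (- z) * ee \<eta> ^ Suc l) * ((-1) powi (- int l) * ee (of_int (- int l) * z + of_int (- int l * (- int l - 1)) / 2 * \<eta>))"
    unfolding e ee_add ee_of_nat_mult m by simp
  also have "\<dots> = tri_coeff (ee \<eta>) (Suc l) * (ee (- z)) ^ Suc l"
    unfolding Suc by (simp add: mult_ac)
  finally show ?case .
qed simp

context
  fixes \<eta> :: complex
  assumes eta: "Im \<eta> > 0"
begin

text \<open>Both one-sided series contain the term \<open>m = 0\<close>, whence the subtraction of
  1.\<close>

lemma theta_tri_series:
  "theta \<eta> z = tri_series (ee \<eta>) (ee z / ee \<eta>) + tri_series (ee \<eta>) (ee (- z)) - 1"
proof -
  let ?t = "\<lambda>m::int. (-1) powi m * ee (of_int m * z + of_int (m * (m - 1)) / 2 * \<eta>)"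
  let ?A = "tri_series (ee \<eta>)"
  note S = tri_summable[OF norm_nome[OF eta]]
  have hs: "((\<lambda>l. tri_coeff (ee \<eta>) l * x ^ l) has_sum ?A x) UNIV" for x
    unfolding tri_series_def
    by (intro norm_summable_imp_has_sum[OF S] summable_sums summable_norm_cancel[OF S])
  have 1: "(?t has_sum ?A (ee z / ee \<eta>)) (range int)"
    unfolding has_sum_reindex[OF inj_on_of_nat] o_def theta_term_nat by (rule hs)
  have inj: "inj_on (\<lambda>l. - int l) UNIV" by (auto intro: inj_onI)
  have 2: "(?t has_sum ?A (ee (- z))) (range (\<lambda>l. - int l))"
    unfolding has_sum_reindex[OF inj] o_def theta_term_neg by (rule hs)
  have 3: "(?t has_sum 1) {0}" by (auto intro!: has_sum_finiteI)
  have 4: "(?t has_sum (?A (ee (- z)) - 1)) (range (\<lambda>l. - int l) - {0})"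
    by (rule has_sum_Diff[OF 2 3]) auto
  have 5: "range int \<inter> (range (\<lambda>l. - int l) - {0}) = {}" by auto
  have "(?t has_sum (?A (ee z / ee \<eta>) + (?A (ee (- z)) - 1))) (range int \<union> (range (\<lambda>l. - int l) - {0}))"
    by (rule has_sum_Un_disjoint[OF 1 4 5])
  also have "range int \<union> (range (\<lambda>l. - int l) - {0}) = UNIV"
  proof -
    have "m \<in> range int \<union> (range (\<lambda>l. - int l) - {0})" for m
    proof (cases "m \<ge> 0")
      case True
      hence "m = int (nat m)" by simp
      thus ?thesis by blast
    next
      case False
      hence "m = - int (nat (- m))" "m \<noteq> 0" by auto
      thus ?thesis by blast
    qed
    thus ?thesis by blast
  qed
  finally show ?thesis unfolding theta_def by (simp add: infsumI)
qed

text \<open>Proportionality is \<open>tht_unique\<close>; the point is \<open>K \<noteq> 0\<close>.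
  Write q for the nome. If the series were zero, \<open>?A x\<close> would equal
  \<open>1 - ?A (1 / (q * x))\<close>, which tends to \<open>1 - ?A 0 = 0\<close> at infinity.
  Liouville's theorem would make \<open>?A\<close> zero, although its value at 0 is 1.\<close>

lemma theta_eq_tht:
  obtains K where "K \<noteq> 0" "\<And>z. theta \<eta> z = K * tht \<eta> z"
proof -
  let ?A = "tri_series (ee \<eta>)"
  note q = norm_nome[OF eta]
  have holA: "(\<lambda>z. ?A (f z)) holomorphic_on UNIV" if "f holomorphic_on UNIV" for f
    using holomorphic_on_compose_gen[OF that tri_entire[OF q]] by (simp add: o_def)
  have hol: "theta \<eta> holomorphic_on UNIV"
    unfolding theta_tri_series[abs_def] by (intro holomorphic_intros holA) auto
  have p1: "theta \<eta> (z + 1) = theta \<eta> z" for z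
    unfolding theta_tri_series by (simp add: ee_add ee_diff ee_minus)
  have a1: "?A (ee z / ee \<eta>) = 1 - ee z * ?A (ee z)" for z
    using tri_eq[OF q, of "ee z / ee \<eta>"] by simp
  have p2: "theta \<eta> (z + \<eta>) = - ee (- z) * theta \<eta> z" for z
  proof -
    have "ee (- (z + \<eta>)) = ee (- z) / ee \<eta>" by (simp add: ee_diff ee_add ee_minus field_simps)
    hence "theta \<eta> (z + \<eta>) = ?A (ee z) + ?A (ee (- z) / ee \<eta>) - 1"
      unfolding theta_tri_series by (simp add: ee_add)
    also have "\<dots> = - ee (- z) * (- ee z * ?A (ee z) + ?A (ee (- z)))"
      unfolding a1 by (simp add: ee_minus field_simps)
    finally show ?thesis unfolding theta_tri_series a1 by (simp add: algebra_simps)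
  qed
  have f0: "theta \<eta> 0 = 0" unfolding theta_tri_series a1 by simp
  obtain K where K: "\<And>z. theta \<eta> z = K * tht \<eta> z" using tht_unique[OF eta hol p1 p2 f0] by blast
  have "K \<noteq> 0"
  proof
    assume "K = 0"
    hence z: "?A (ee z / ee \<eta>) = 1 - ?A (ee (- z))" for z
      using K[of z] unfolding theta_tri_series by (simp add: algebra_simps)
    have surj: "\<exists>z. x = ee z" if "x \<noteq> 0" for x
      using that by (intro exI[of _ "Ln x / (2 * of_real pi * \<i>)"]) (simp add: ee_def)
    have x: "?A x = 1 - ?A (inverse (ee \<eta> * x))" if x0: "x \<noteq> 0" for x
    proof -
      obtain z where "ee \<eta> * x = ee z" using surj[of "ee \<eta> * x"] x0 by auto
      hence xz: "x = ee z / ee \<eta>" by (simp add: field_simps)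
      show ?thesis unfolding xz using z[of z] by (simp add: ee_minus)
    qed
    have "((\<lambda>x. ?A (inverse (ee \<eta> * x))) \<longlongrightarrow> ?A 0) at_infinity"
    proof (rule isCont_tendsto_compose[OF isCont_entire[OF tri_entire[OF q]]])
      have "((\<lambda>x. inverse (ee \<eta>) * inverse x) \<longlongrightarrow> inverse (ee \<eta>) * 0) at_infinity"
        by (intro tendsto_intros tendsto_inverse_0)
      thus "((\<lambda>x. inverse (ee \<eta> * x)) \<longlongrightarrow> 0) at_infinity" by simp
    qed
    hence "((\<lambda>x. 1 - ?A (inverse (ee \<eta> * x))) \<longlongrightarrow> 1 - 1) at_infinity"
      unfolding tri_0[OF q] by (intro tendsto_intros)
    moreover have "eventually (\<lambda>x. 1 - ?A (inverse (ee \<eta> * x)) = ?A x) at_infinity"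
      unfolding eventually_at_infinity
    proof (intro exI[of _ 1] allI impI)
      fix y :: complex assume "1 \<le> norm y"
      hence "y \<noteq> 0" by auto
      thus "1 - ?A (inverse (ee \<eta> * y)) = ?A y" by (rule x[symmetric])
    qed
    ultimately have "(?A \<longlongrightarrow> 0) at_infinity" using tendsto_cong by fastforce
    hence "?A 0 = 0" by (rule Liouville_weak_0[OF tri_entire[OF q]])
    thus False using tri_0[OF q] by simp
  qed
  thus thesis using that K by blast
qed

end

text \<open>Every \<open>theta_int n \<eta> a\<close> is an exponential times \<open>sg n \<eta> (n * z + a * \<eta>)\<close>; \<open>sg\<close> is odd and
  belongs to the lattice spanned by 1 and \<open>n * \<eta>\<close>.\<close>
definition sg :: "nat \<Rightarrow> complex \<Rightarrow> complex \<Rightarrow> complex" where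
  "sg n \<eta> x = ee (- x / 2) * tht (of_nat n * \<eta>) x"

text \<open>Up to a constant, \<open>theta_(a+b) (Z+W) / (theta_a Z * theta_b W)\<close> at \<open>X = n * Z\<close>, \<open>Y = n * W\<close>:
  the coefficient of \<open>R\<close> without its scalar prefactor.\<close>
definition Phi :: "nat \<Rightarrow> complex \<Rightarrow> int \<Rightarrow> int \<Rightarrow> complex \<Rightarrow> complex \<Rightarrow> complex" where
  "Phi n \<eta> a b X Y = ee ((of_int b * X + of_int a * Y + of_int (a * b) * \<eta>) / of_nat n)
     * sg n \<eta> (X + Y + of_int (a + b) * \<eta>) / (sg n \<eta> (X + of_int a * \<eta>) * sg n \<eta> (Y + of_int b * \<eta>))"

text \<open>Proportional to the difference of the values of the Weierstrass function at \<open>v\<close> and \<open>u\<close>.\<close>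
definition Wfun :: "nat \<Rightarrow> complex \<Rightarrow> complex \<Rightarrow> complex \<Rightarrow> complex" where
  "Wfun n \<eta> u v = sg n \<eta> (u - v) * sg n \<eta> (u + v) / (sg n \<eta> u ^ 2 * sg n \<eta> v ^ 2)"

context
  fixes n :: nat and \<eta> :: complex
  assumes n: "n > 0" and eta: "Im \<eta> > 0"
begin

lemma neta: "Im (of_nat n * \<eta>) > 0" using n eta by simp

section \<open>Quasi-periodicity of \<open>sg\<close> and its relation to the theta functions of
  order n\<close>

lemma sg_add_1: "sg n \<eta> (x + 1) = - sg n \<eta> x"
proof -
  have "ee (- (x + 1) / 2) = ee (- x / 2) * inverse (ee (1/2))"
    unfolding ee_minus[symmetric] ee_add[symmetric] by (simp add: field_simps)
  thus ?thesis unfolding sg_def tht_add_1[OF neta] by (simp del: ee_half) simp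
qed

lemma sg_uminus: "sg n \<eta> (- x) = - sg n \<eta> x"
proof -
  have "ee (- (- x) / 2) * ee (- x) = ee (- x / 2)" unfolding ee_add[symmetric] by (simp add: field_simps)
  thus ?thesis unfolding sg_def tht_uminus[OF neta] by simp
qed

lemma sg_diff_swap: "sg n \<eta> (x - y) = - sg n \<eta> (y - x)"
  using sg_uminus[of "y - x"] by simp

lemma sg_add_period: "sg n \<eta> (x + of_nat n * \<eta>) = - ee (- x - of_nat n * \<eta> / 2) * sg n \<eta> x"
proof -
  have "ee (- (x + of_nat n * \<eta>) / 2) * ee (- x) = ee (- x - of_nat n * \<eta> / 2) * ee (- x / 2)"
    unfolding ee_add[symmetric] by (intro arg_cong[of _ _ ee]) (simp add: field_simps)
  thus ?thesis unfolding sg_def tht_add_eta[OF neta] by simp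
qed

lemma sg_eq_0_iff: "sg n \<eta> x = 0 \<longleftrightarrow> x \<in> period_lattice (of_nat n * \<eta>)"
  unfolding sg_def by (simp add: tht_eq_0_iff[OF neta])

lemma sg_0 [simp]: "sg n \<eta> 0 = 0" by (simp add: sg_eq_0_iff)

lemma sg_entire: "sg n \<eta> holomorphic_on UNIV"
  unfolding sg_def[abs_def] by (intro holomorphic_intros holomorphic_on_tht[OF neta]) auto

lemma holomorphic_on_sg [holomorphic_intros]:
  "f holomorphic_on S \<Longrightarrow> (\<lambda>z. sg n \<eta> (f z)) holomorphic_on S"
  using holomorphic_on_compose_gen[OF _ sg_entire, of f S] by (auto simp: o_def)

lemma tendsto_sg [tendsto_intros]: "(f \<longlongrightarrow> a) F \<Longrightarrow> ((\<lambda>t. sg n \<eta> (f t)) \<longlongrightarrow> sg n \<eta> a) F"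
  by (rule isCont_tendsto_compose[OF isCont_entire[OF sg_entire]])

lemma sg_local:
  obtains G where "G holomorphic_on UNIV" "G 0 \<noteq> 0" "\<And>x. sg n \<eta> x = x * G x"
proof -
  obtain G where G: "G holomorphic_on UNIV" "G 0 \<noteq> 0" "\<And>z. tht (of_nat n * \<eta>) z = z * G z"
    by (rule tht_at_0[OF neta], rule that)
  have "(\<lambda>z. ee (- z / 2) * G z) holomorphic_on UNIV" by (intro holomorphic_intros G(1)) auto
  thus thesis using that[of "\<lambda>z. ee (- z / 2) * G z"] G unfolding sg_def by auto
qed

text \<open>The map \<open>x + 1\<close> permutes the factors cyclically, and
  \<open>x + n * \<eta>\<close> shifts the argument of every factor by \<open>\<eta>\<close>. So the
  product is a theta function of degree one for the period \<open>n * \<eta>\<close> that vanishes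
  at 0.\<close>

lemma theta_prod:
  obtains K where "K \<noteq> 0" "\<And>x. (\<Prod>m<n. theta \<eta> (x / of_nat n + of_nat m / of_nat n)) = K * tht (of_nat n * \<eta>) x"
proof -
  obtain K where K: "K \<noteq> 0" "\<And>z. theta \<eta> z = K * tht \<eta> z" by (rule theta_eq_tht[OF eta], rule that)
  let ?f = "\<lambda>x. \<Prod>m<n. theta \<eta> (x / of_nat n + of_nat m / of_nat n)"
  have hol: "?f holomorphic_on UNIV" unfolding K(2)
    by (intro holomorphic_intros holomorphic_on_tht[OF eta]) auto
  have p1: "?f (x + 1) = ?f x" for x
  proof -
    define h where "h m = theta \<eta> (x / of_nat n + of_nat m / of_nat n)" for m
    have hn: "h n = h 0" unfolding h_def K(2) using tht_add_1[OF eta, of "x / of_nat n"] n by simp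
    have "?f (x + 1) = (\<Prod>m<n. h (Suc m))"
      unfolding h_def by (intro prod.cong refl arg_cong[of _ _ "theta \<eta>"]) (simp add: add_divide_distrib)
    also have "\<dots> = (\<Prod>m<n. h m)"
    proof -
      obtain l where l: "n = Suc l" using n by (cases n) auto
      have "(\<Prod>m<n. h (Suc m)) = (\<Prod>m<l. h (Suc m)) * h n" unfolding l by simp
      also have "\<dots> = h 0 * (\<Prod>m<l. h (Suc m))" using hn by simp
      also have "\<dots> = (\<Prod>m<n. h m)" unfolding l by (rule prod.lessThan_Suc_shift[symmetric])
      finally show ?thesis .
    qed
    finally show ?thesis unfolding h_def .
  qed
  have p2: "?f (x + of_nat n * \<eta>) = - ee (- x) * ?f x" for x
  proof -
    have pe: "(\<Prod>m<N. ee (g m)) = ee (\<Sum>m<N. g m)" for g and N :: nat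
      by (induction N) (simp_all add: ee_add mult.commute)
    have "?f (x + of_nat n * \<eta>) = (\<Prod>m<n. (-1) * ee (- (x / of_nat n + of_nat m / of_nat n)) * theta \<eta> (x / of_nat n + of_nat m / of_nat n))"
    proof (intro prod.cong refl)
      fix m
      have e: "(x + of_nat n * \<eta>) / of_nat n + of_nat m / of_nat n = (x / of_nat n + of_nat m / of_nat n) + \<eta>"
        using n by (simp add: field_simps)
      show "theta \<eta> ((x + of_nat n * \<eta>) / of_nat n + of_nat m / of_nat n) = (-1) * ee (- (x / of_nat n + of_nat m / of_nat n)) * theta \<eta> (x / of_nat n + of_nat m / of_nat n)"
        unfolding e K(2) tht_add_eta[OF eta] by simp
    qed
    also have "\<dots> = ((-1) ^ n * ee (\<Sum>m<n. - (x / of_nat n + of_nat m / of_nat n))) * ?f x"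
      unfolding prod.distrib pe by simp
    \<comment> \<open>The phases m/n sum to (n - 1)/2; the resulting sign (-1)^(n-1) combines with
      (-1)^n from the n multipliers to a single -1.\<close>
    also have "(\<Sum>m<n. - (x / of_nat n + of_nat m / of_nat n)) = - x + of_nat (n - 1) * (- (1/2))"
    proof -
      have "(\<Sum>m<n. of_nat m :: complex) = of_nat n * of_nat (n - 1) / 2"
      proof -
        have "(\<Sum>m<N. of_nat m :: complex) = of_nat N * (of_nat N - 1) / 2" for N :: nat
          by (induction N) (auto simp: field_simps)
        thus ?thesis using n by (simp add: of_nat_diff)
      qed
      hence "(\<Sum>m<n. of_nat m / of_nat n :: complex) = of_nat (n - 1) / 2"
        using n by (simp flip: sum_divide_distrib)
      thus ?thesis using n by (simp add: sum_negf sum.distrib sum_subtractf)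
    qed
    also have "ee (- x + of_nat (n - 1) * (- (1/2))) = ee (- x) * (-1) ^ (n - 1)"
      unfolding ee_add ee_of_nat_mult by (simp add: ee_minus)
    also have "(-1) ^ n * (ee (- x) * (-1) ^ (n - 1)) = - ee (- x)"
      using n by (cases n) (simp_all add: power_mult_distrib[symmetric] mult_ac)
    finally show ?thesis .
  qed
  have f0: "?f 0 = 0"
    by (rule prod_zero) (use n K tht_0[OF eta] in \<open>auto intro!: bexI[of _ 0]\<close>)
  obtain C where C: "\<And>x. ?f x = C * tht (of_nat n * \<eta>) x"
    using tht_unique[OF neta hol p1 p2 f0] by blast
  \<comment> \<open>At this point all arguments have imaginary part \<open>Im \<eta> / 2\<close>,
    half-way between two rows of the lattice.\<close>
  have "?f (of_nat n * \<eta> / 2) \<noteq> 0"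
  proof -
    have "theta \<eta> ((of_nat n * \<eta> / 2) / of_nat n + of_nat m / of_nat n) \<noteq> 0" for m
    proof
      assume "theta \<eta> ((of_nat n * \<eta> / 2) / of_nat n + of_nat m / of_nat n) = 0"
      hence "\<eta> / 2 + of_nat m / of_nat n \<in> period_lattice \<eta>" using K n by (simp add: tht_eq_0_iff[OF eta])
      then obtain a b where "\<eta> / 2 + of_nat m / of_nat n = of_int a + of_int b * \<eta>" unfolding period_lattice_def by blast
      from arg_cong[OF this, of Im] have "Im \<eta> / 2 = of_int b * Im \<eta>" using n by simp
      hence "(1::real) = of_int (2 * b)" using eta by (simp add: field_simps)
      hence "2 * b = 1" using of_int_eq_iff[of 1 "2 * b", where 'a = real] by simp
      thus False by presburger
    qed
    thus ?thesis using n by simp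
  qed
  hence "C \<noteq> 0" unfolding C by auto
  thus thesis using that C by blast
qed

text \<open>One constant serves all \<open>a\<close> and \<open>z\<close>. The term
  \<open>- a * \<eta> / 2\<close> of the original exponent is absorbed by \<open>sg\<close>, leaving
  a purely quadratic term in \<open>a\<close> times \<open>\<eta>\<close>; the cross terms of such
  exponents make up the phase of \<open>Phi\<close>.\<close>

lemma theta_int_sg:
  obtains K where "K \<noteq> 0" "\<And>a z. theta_int n \<eta> a z =
    K * ee (of_nat n * z / 2 + of_int a * z + of_int a ^ 2 * \<eta> / (2 * of_nat n) + of_int a / (2 * of_nat n))
      * sg n \<eta> (of_nat n * z + of_int a * \<eta>)"
proof -
  obtain K where K: "K \<noteq> 0" "\<And>x. (\<Prod>m<n. theta \<eta> (x / of_nat n + of_nat m / of_nat n)) = K * tht (of_nat n * \<eta>) x"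
    by (rule theta_prod, rule that)
  have "theta_int n \<eta> a z =
    K * ee (of_nat n * z / 2 + of_int a * z + of_int a ^ 2 * \<eta> / (2 * of_nat n) + of_int a / (2 * of_nat n))
      * sg n \<eta> (of_nat n * z + of_int a * \<eta>)" for a z
  proof -
    have "(\<Prod>m<n. theta \<eta> (z + of_nat m / of_nat n + of_int a / of_nat n * \<eta>))
      = (\<Prod>m<n. theta \<eta> ((of_nat n * z + of_int a * \<eta>) / of_nat n + of_nat m / of_nat n))"
      using n by (intro prod.cong refl arg_cong[of _ _ "theta \<eta>"]) (simp add: field_simps)
    also have "\<dots> = K * tht (of_nat n * \<eta>) (of_nat n * z + of_int a * \<eta>)" by (rule K(2))
    finally have 1: "(\<Prod>m<n. theta \<eta> (z + of_nat m / of_nat n + of_int a / of_nat n * \<eta>))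
       = K * tht (of_nat n * \<eta>) (of_nat n * z + of_int a * \<eta>)" .
    have "ee (of_nat n * z / 2 + of_int a * z + of_int a ^ 2 * \<eta> / (2 * of_nat n) + of_int a / (2 * of_nat n))
       * ee (- (of_nat n * z + of_int a * \<eta>) / 2) =
       ee (of_int a * z + of_int a / (2 * of_nat n) + of_int (a * (a - int n)) / (2 * of_nat n) * \<eta>)"
      unfolding ee_add[symmetric] using n by (intro arg_cong[of _ _ ee]) (simp add: field_simps power2_eq_square)
    thus ?thesis unfolding theta_int_def 1 sg_def by (simp add: mult_ac)
  qed
  thus thesis using that K(1) by blast
qed

lemma theta_int_periodic: "theta_int n \<eta> (a + int n) z = theta_int n \<eta> a z"
proof -
  obtain K where K0: "K \<noteq> 0" and K: "\<And>a z. theta_int n \<eta> a z =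
    K * ee (of_nat n * z / 2 + of_int a * z + of_int a ^ 2 * \<eta> / (2 * of_nat n) + of_int a / (2 * of_nat n))
      * sg n \<eta> (of_nat n * z + of_int a * \<eta>)" by (rule theta_int_sg, rule that)
  let ?x = "of_nat n * z + of_int a * \<eta>"
  have c: "K * A * (- F * S) = K * B * S" if "A * F = B * ee (1/2)" for A F B S
  proof -
    have "K * A * (- F * S) = - (K * S * (A * F))" by (simp add: mult_ac)
    thus ?thesis unfolding that by (simp add: mult_ac)
  qed
  have s: "of_nat n * z + of_int (a + int n) * \<eta> = ?x + of_nat n * \<eta>" by (simp add: algebra_simps)
  have e: "ee (of_nat n * z / 2 + of_int (a + int n) * z + of_int (a + int n) ^ 2 * \<eta> / (2 * of_nat n) + of_int (a + int n) / (2 * of_nat n))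
     * ee (- ?x - of_nat n * \<eta> / 2) =
     ee (of_nat n * z / 2 + of_int a * z + of_int a ^ 2 * \<eta> / (2 * of_nat n) + of_int a / (2 * of_nat n)) * ee (1/2)"
    unfolding ee_add[symmetric] using n by (intro arg_cong[of _ _ ee]) (simp add: field_simps power2_eq_square)
  show ?thesis unfolding K s sg_add_period by (rule c[OF e])
qed

lemma theta_idx_eq: "theta_idx n \<eta> a z = theta_int n \<eta> a z"
proof -
  have 1: "theta_int n \<eta> (b + int n * l) z = theta_int n \<eta> b z" for b l
  proof (induction l rule: int_induct[of _ 0])
    case (step1 i)
    thus ?case using theta_int_periodic[of "b + int n * i" z] by (simp add: algebra_simps)
  next
    case (step2 i)
    thus ?case using theta_int_periodic[of "b + int n * (i - 1)" z] by (simp add: algebra_simps)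
  qed simp
  show ?thesis unfolding theta_idx_def using 1[of "a mod int n" "a div int n"] by simp
qed

lemma theta_int_cong:
  assumes "a mod int n = b mod int n" shows "theta_int n \<eta> a z = theta_int n \<eta> b z"
  using assms theta_idx_eq[of a z] theta_idx_eq[of b z] unfolding theta_idx_def by simp

lemma Phi_theta:
  obtains K where "K \<noteq> 0" "\<And>a b Z W. theta_int n \<eta> (a + b) (Z + W) / (theta_int n \<eta> a Z * theta_int n \<eta> b W)
    = K * Phi n \<eta> a b (of_nat n * Z) (of_nat n * W)"
proof -
  obtain K where K: "K \<noteq> 0" "\<And>a z. theta_int n \<eta> a z =
    K * ee (of_nat n * z / 2 + of_int a * z + of_int a ^ 2 * \<eta> / (2 * of_nat n) + of_int a / (2 * of_nat n))
      * sg n \<eta> (of_nat n * z + of_int a * \<eta>)" by (rule theta_int_sg, rule that)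
  define E where "E a z = ee (of_nat n * z / 2 + of_int a * z + of_int a ^ 2 * \<eta> / (2 * of_nat n) + of_int a / (2 * of_nat n))" for a z
  have "theta_int n \<eta> (a + b) (Z + W) / (theta_int n \<eta> a Z * theta_int n \<eta> b W)
    = inverse K * Phi n \<eta> a b (of_nat n * Z) (of_nat n * W)" for a b Z W
  proof -
    have "E (a + b) (Z + W) = ee ((of_int b * (of_nat n * Z) + of_int a * (of_nat n * W) + of_int (a * b) * \<eta>) / of_nat n) * (E a Z * E b W)"
      unfolding E_def ee_add[symmetric] using n by (intro arg_cong[of _ _ ee]) (simp add: field_simps power2_eq_square)
    hence e: "E (a + b) (Z + W) / (E a Z * E b W) = ee ((of_int b * (of_nat n * Z) + of_int a * (of_nat n * W) + of_int (a * b) * \<eta>) / of_nat n)"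
      unfolding E_def by simp
    have s: "of_nat n * (Z + W) + of_int (a + b) * \<eta> = of_nat n * Z + of_nat n * W + of_int (a + b) * \<eta>"
      by (simp add: algebra_simps)
    show ?thesis unfolding K(2) Phi_def e[symmetric] s E_def[symmetric]
      using K(1) by (simp add: divide_inverse mult_ac)
  qed
  thus thesis using that[of "inverse K"] K(1) by auto
qed

text \<open>Inherited through \<open>Phi_theta\<close> from \<open>theta_int\<close>, which depends
  on its index modulo n only, whereas \<open>sg\<close> by itself picks up a factor under
  \<open>n * \<eta>\<close>.\<close>

lemma Phi_cong:
  assumes "a mod int n = a' mod int n" "b mod int n = b' mod int n"
  shows "Phi n \<eta> a b X Y = Phi n \<eta> a' b' X Y"
proof -
  obtain K where K: "K \<noteq> 0" "\<And>a b Z W. theta_int n \<eta> (a + b) (Z + W) / (theta_int n \<eta> a Z * theta_int n \<eta> b W)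
    = K * Phi n \<eta> a b (of_nat n * Z) (of_nat n * W)" by (rule Phi_theta, rule that)
  have "(a + b) mod int n = (a' + b') mod int n" using assms by (rule mod_add_cong)
  hence "K * Phi n \<eta> a b (of_nat n * (X / of_nat n)) (of_nat n * (Y / of_nat n)) = K * Phi n \<eta> a' b' (of_nat n * (X / of_nat n)) (of_nat n * (Y / of_nat n))"
    unfolding K(2)[symmetric] using theta_int_cong[OF assms(1)] theta_int_cong[OF assms(2)] theta_int_cong[of "a + b" "a' + b'"] by simp
  thus ?thesis using K(1) n by simp
qed

lemma Phi_add_1: "Phi n \<eta> a b (X + 1) Y = ee (of_int b / of_nat n) * Phi n \<eta> a b X Y"
proof -
  have e: "ee ((of_int b * (X + 1) + of_int a * Y + of_int (a * b) * \<eta>) / of_nat n)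
    = ee (of_int b / of_nat n) * ee ((of_int b * X + of_int a * Y + of_int (a * b) * \<eta>) / of_nat n)"
    unfolding ee_add[symmetric] by (intro arg_cong[of _ _ ee]) (simp add: add_divide_distrib algebra_simps)
  have s: "X + 1 + Y + of_int (a + b) * \<eta> = (X + Y + of_int (a + b) * \<eta>) + 1"
    "X + 1 + of_int a * \<eta> = (X + of_int a * \<eta>) + 1" by simp_all
  show ?thesis unfolding Phi_def e s sg_add_1 by simp
qed

lemma Phi_add_int: "Phi n \<eta> a b (X + of_int l) Y = ee (of_int (l * b) / of_nat n) * Phi n \<eta> a b X Y"
proof -
  \<comment> \<open>The twist by \<open>ee (- b * X / n)\<close> makes the function invariant under
    \<open>X + 1\<close>, so the induction over the integers applies.\<close>
  have "ee (- (of_int b * (X + of_int l * 1)) / of_nat n) * Phi n \<eta> a b (X + of_int l * 1) Y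
     = ee (- (of_int b * X) / of_nat n) * Phi n \<eta> a b X Y"
  proof (rule shift_int_induct)
    fix z
    have "ee (- (of_int b * (z + 1)) / of_nat n) * ee (of_int b / of_nat n) = ee (- (of_int b * z) / of_nat n)"
      unfolding ee_add[symmetric] by (intro arg_cong[of _ _ ee]) (simp add: add_divide_distrib algebra_simps diff_divide_distrib)
    thus "ee (- (of_int b * (z + 1)) / of_nat n) * Phi n \<eta> a b (z + 1) Y = ee (- (of_int b * z) / of_nat n) * Phi n \<eta> a b z Y"
      unfolding Phi_add_1 by (simp flip: mult.assoc)
  qed
  moreover have "ee (- (of_int b * X) / of_nat n) = ee (- (of_int b * (X + of_int l * 1)) / of_nat n) * ee (of_int (l * b) / of_nat n)"
    unfolding ee_add[symmetric] by (intro arg_cong[of _ _ ee]) (simp add: add_divide_distrib algebra_simps diff_divide_distrib)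
  ultimately show ?thesis by simp
qed

text \<open>A translation by \<open>l * \<eta>\<close> is absorbed into the first index. On the
  matrix it therefore acts through permutations of the basis.\<close>

lemma Phi_add_eta: "Phi n \<eta> a b (X + of_int l * \<eta>) Y = ee (- (of_int l * Y) / of_nat n) * Phi n \<eta> (a + l) b X Y"
proof -
  have e: "ee ((of_int b * (X + of_int l * \<eta>) + of_int a * Y + of_int (a * b) * \<eta>) / of_nat n)
    = ee (- (of_int l * Y) / of_nat n) * ee ((of_int b * X + of_int (a + l) * Y + of_int ((a + l) * b) * \<eta>) / of_nat n)"
    unfolding ee_add[symmetric] by (intro arg_cong[of _ _ ee]) (simp add: algebra_simps add_divide_distrib diff_divide_distrib)
  have s: "X + of_int l * \<eta> + Y + of_int (a + b) * \<eta> = X + Y + of_int (a + l + b) * \<eta>"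
    "X + of_int l * \<eta> + of_int a * \<eta> = X + of_int (a + l) * \<eta>" by (simp_all add: algebra_simps)
  show ?thesis unfolding Phi_def e s by simp
qed

text \<open>Weierstrass's three-term relation. As a function of \<open>u\<close> the left side has
  degree two for the period \<open>n * \<eta>\<close>, vanishes at \<open>v\<close>, and vanishes
  twice at 0 because it is even; three zeros exceed the degree.\<close>

lemma three_term_entire:
  assumes v: "v \<notin> period_lattice (of_nat n * \<eta>)"
  shows "sg n \<eta> (u - v) * sg n \<eta> (u + v) * sg n \<eta> w ^ 2 - sg n \<eta> (u - w) * sg n \<eta> (u + w) * sg n \<eta> v ^ 2
     + sg n \<eta> (v - w) * sg n \<eta> (v + w) * sg n \<eta> u ^ 2 = 0"
proof -
  define N where "N u = sg n \<eta> (u - v) * sg n \<eta> (u + v) * sg n \<eta> w ^ 2 - sg n \<eta> (u - w) * sg n \<eta> (u + w) * sg n \<eta> v ^ 2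
     + sg n \<eta> (v - w) * sg n \<eta> (v + w) * sg n \<eta> u ^ 2" for u
  have hol: "N holomorphic_on UNIV" unfolding N_def[abs_def] by (intro holomorphic_intros)
  have a1: "sg n \<eta> (u + 1 - x) * sg n \<eta> (u + 1 + x) = sg n \<eta> (u - x) * sg n \<eta> (u + x)" for u x
    using sg_add_1[of "u - x"] sg_add_1[of "u + x"] by (simp add: algebra_simps)
  have p1: "N (u + 1) = 1 * N u" for u unfolding N_def a1 sg_add_1 by simp
  have a2: "sg n \<eta> (u + of_nat n * \<eta> - x) * sg n \<eta> (u + of_nat n * \<eta> + x) = ee (- of_nat n * \<eta>) * ee (- of_nat 2 * u) * (sg n \<eta> (u - x) * sg n \<eta> (u + x))" for u x
  proof -
    have s: "u + of_nat n * \<eta> - x = (u - x) + of_nat n * \<eta>" "u + of_nat n * \<eta> + x = (u + x) + of_nat n * \<eta>" by simp_all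
    have e: "ee (- (u - x) - of_nat n * \<eta> / 2) * ee (- (u + x) - of_nat n * \<eta> / 2) = ee (- of_nat n * \<eta>) * ee (- of_nat 2 * u)"
      unfolding ee_add[symmetric] by (intro arg_cong[of _ _ ee]) (simp add: field_simps)
    show ?thesis unfolding s sg_add_period e[symmetric] by simp
  qed
  have a3: "sg n \<eta> (u + of_nat n * \<eta>) ^ 2 = ee (- of_nat n * \<eta>) * ee (- of_nat 2 * u) * sg n \<eta> u ^ 2" for u
    using a2[of u 0] by (simp add: power2_eq_square)
  have p2: "N (u + of_nat n * \<eta>) = ee (- of_nat n * \<eta>) * ee (- of_nat 2 * u) * N u" for u
    unfolding N_def a2 a3 by (simp only: ring_distribs mult_ac)
  have Nv: "N v = 0" unfolding N_def by simp
  have N0: "N 0 = 0" unfolding N_def by (simp add: sg_uminus power2_eq_square)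
  have even: "N (- u) = N u" for u
  proof -
    have "sg n \<eta> (- u - x) * sg n \<eta> (- u + x) = sg n \<eta> (u - x) * sg n \<eta> (u + x)" for x
      using sg_uminus[of "u + x"] sg_uminus[of "u - x"] by (simp add: algebra_simps)
    thus ?thesis unfolding N_def sg_uminus by simp
  qed
  obtain g where g: "g holomorphic_on UNIV" "\<And>z. N z = (z - 0) * g z" using entire_divide_root[OF hol N0] by blast
  \<comment> \<open>\<open>N\<close> is even and equals \<open>z * g z\<close>, so \<open>g\<close>
    is odd off 0, and continuity gives its value at 0.\<close>
  have "g 0 = 0"
  proof -
    have odd: "g (- z) = - g z" if "z \<noteq> 0" for z
    proof -
      have "- (z * g (- z)) = z * g z" using even[of z] unfolding g(2) by simp
      hence "z * (g (- z) + g z) = 0" by (metis add.right_inverse distrib_left)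
      thus ?thesis using that by (simp add: eq_neg_iff_add_eq_0)
    qed
    have "((\<lambda>z. g (- z)) \<longlongrightarrow> g (- 0)) (at 0)"
      by (rule isCont_tendsto_compose[OF isCont_entire[OF g(1)]]) (intro tendsto_intros)
    moreover have "eventually (\<lambda>z. g (- z) = - g z) (at 0)" unfolding eventually_at_filter
      by (rule always_eventually) (auto simp: odd)
    ultimately have "((\<lambda>z. - g z) \<longlongrightarrow> g 0) (at 0)" using tendsto_cong[of "\<lambda>z. g (- z)"] by fastforce
    moreover have "((\<lambda>z. - g z) \<longlongrightarrow> - g 0) (at 0)"
      using isCont_entire[OF g(1), of 0] by (intro tendsto_minus) (simp add: isCont_def)
    ultimately have "g 0 = - g 0" by (rule LIM_unique)
    thus ?thesis by simp
  qed
  then obtain h where h: "h holomorphic_on UNIV" "\<And>z. g z = (z - 0) * h z" using entire_divide_root[OF g(1)] by blast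
  obtain h' where h': "h' holomorphic_on UNIV" "\<And>z. N z = (z - v) * h' z" using entire_divide_root[OF hol Nv] by blast
  have o1: "vanishes_to_order N 0 2" by (rule vanishes_to_orderI[OF h(1)]) (simp add: g(2) h(2) power2_eq_square)
  have o2: "vanishes_to_order N v 1" by (rule vanishes_to_orderI[OF h'(1)]) (simp add: h'(2))
  have "N z = 0" for z
  proof (rule ccontr)
    assume "N z \<noteq> 0"
    from two_point_factorization[OF neta hol _ p1 _ p2 this o1 o2] v show False by simp
  qed
  thus ?thesis unfolding N_def by blast
qed

text \<open>This separates the variables: for a fixed \<open>w\<close>,
  \<open>Wfun n \<eta> u v\<close> is a function of \<open>u\<close> minus the same function of
  \<open>v\<close>.\<close>

lemma Wfun_three_term:
  assumes "u \<notin> period_lattice (of_nat n * \<eta>)" "v \<notin> period_lattice (of_nat n * \<eta>)" "w \<notin> period_lattice (of_nat n * \<eta>)"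
  shows "Wfun n \<eta> u v = Wfun n \<eta> u w - Wfun n \<eta> v w"
proof -
  have nz: "sg n \<eta> u \<noteq> 0" "sg n \<eta> v \<noteq> 0" "sg n \<eta> w \<noteq> 0" using assms by (auto simp: sg_eq_0_iff)
  have "sg n \<eta> (u - v) * sg n \<eta> (u + v) * sg n \<eta> w ^ 2 = sg n \<eta> (u - w) * sg n \<eta> (u + w) * sg n \<eta> v ^ 2
     - sg n \<eta> (v - w) * sg n \<eta> (v + w) * sg n \<eta> u ^ 2"
    using three_term_entire[OF assms(2), of u w] by (simp add: algebra_simps)
  thus ?thesis unfolding Wfun_def using nz by (simp add: field_simps)
qed

lemma Wfun_uminus: "Wfun n \<eta> (- u) v = Wfun n \<eta> u v"
  unfolding Wfun_def using sg_uminus[of "u + v"] sg_uminus[of "u - v"] by (simp add: sg_uminus algebra_simps)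

lemma Wfun_add_1: "Wfun n \<eta> (u + 1) v = Wfun n \<eta> u v"
proof -
  have s: "u + 1 - v = (u - v) + 1" "u + 1 + v = (u + v) + 1" by simp_all
  show ?thesis unfolding Wfun_def s sg_add_1 by simp
qed

lemma Wfun_add_period: "Wfun n \<eta> (u + of_nat n * \<eta>) v = Wfun n \<eta> u v"
proof -
  have s: "u + of_nat n * \<eta> - v = (u - v) + of_nat n * \<eta>" "u + of_nat n * \<eta> + v = (u + v) + of_nat n * \<eta>" by simp_all
  have e: "ee (- (u - v) - of_nat n * \<eta> / 2) * ee (- (u + v) - of_nat n * \<eta> / 2) = ee (- u - of_nat n * \<eta> / 2) ^ 2"
    unfolding power2_eq_square ee_add[symmetric] by (intro arg_cong[of _ _ ee]) (simp add: field_simps)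
  show ?thesis unfolding Wfun_def s sg_add_period
    by (simp add: power_mult_distrib e[symmetric])
qed

text \<open>Opposite signs of \<open>X\<close> and \<open>a\<close> cancel the exponential phases,
  and by oddness of \<open>sg\<close> the remaining quotient is a difference of Weierstrass
  type.\<close>

lemma Phi_diagonal_product:
  "Phi n \<eta> a b X Y * Phi n \<eta> (- a) b (- X) Y = Wfun n \<eta> (X + of_int a * \<eta>) (Y + of_int b * \<eta>)"
proof -
  define u v where "u = X + of_int a * \<eta>" and "v = Y + of_int b * \<eta>"
  have s: "X + Y + of_int (a + b) * \<eta> = u + v" "- X + Y + of_int (- a + b) * \<eta> = v - u"
    "- X + of_int (- a) * \<eta> = - u" unfolding u_def v_def by (simp_all add: algebra_simps)
  have e: "ee ((of_int b * X + of_int a * Y + of_int (a * b) * \<eta>) / of_nat n) *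
     ee ((of_int b * (- X) + of_int (- a) * Y + of_int ((- a) * b) * \<eta>) / of_nat n) = 1"
  proof -
    have "(of_int b * X + of_int a * Y + of_int (a * b) * \<eta>) / of_nat n +
      (of_int b * (- X) + of_int (- a) * Y + of_int ((- a) * b) * \<eta>) / of_nat n = 0"
      by (simp flip: add_divide_distrib)
    thus ?thesis unfolding ee_add[symmetric] by simp
  qed
  have r: "(A * P / (Q * V)) * (B * P' / (- Q * V)) = (A * B) * (P * - P') / (Q ^ 2 * V ^ 2)" for A B P P' Q V :: complex
    by (simp add: power2_eq_square mult_ac)
  show ?thesis
    unfolding Phi_def s u_def[symmetric] v_def[symmetric] sg_uminus r e Wfun_def sg_diff_swap[of v u]
    by (simp add: mult_ac)
qed

end

subsection \<open>Unitarity\<close>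

text \<open>\<open>h\<close> need only be injective on residues; finiteness makes it a permutation
  of them. The substitutions \<open>c - l\<close>, \<open>i - c\<close> and
  \<open>k * (j - c)\<close> are all of this kind.\<close>

lemma sum_residues:
  fixes g :: "int \<Rightarrow> 'a::comm_monoid_add" and n :: nat
  assumes n: "n > 0" and g: "\<And>c c'. c mod int n = c' mod int n \<Longrightarrow> g c = g c'"
    and h: "\<And>c c'. h c mod int n = h c' mod int n \<Longrightarrow> c mod int n = c' mod int n"
  shows "(\<Sum>c\<in>{0..<int n}. g (h c)) = (\<Sum>c\<in>{0..<int n}. g c)"
proof -
  have inj: "inj_on (\<lambda>c. h c mod int n) {0..<int n}"
  proof (rule inj_onI)
    fix x y assume "x \<in> {0..<int n}" "y \<in> {0..<int n}" "h x mod int n = h y mod int n"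
    thus "x = y" using h[of x y] by simp
  qed
  have sub: "(\<lambda>c. h c mod int n) ` {0..<int n} \<subseteq> {0..<int n}" using n by auto
  have "(\<lambda>c. h c mod int n) ` {0..<int n} = {0..<int n}" by (rule endo_inj_surj[OF _ sub inj]) simp
  hence b: "bij_betw (\<lambda>c. h c mod int n) {0..<int n} {0..<int n}" using inj unfolding bij_betw_def by blast
  have "(\<Sum>c\<in>{0..<int n}. g (h c)) = (\<Sum>c\<in>{0..<int n}. g (h c mod int n))"
    by (intro sum.cong refl g) simp
  also have "\<dots> = (\<Sum>c\<in>{0..<int n}. g c)" by (rule sum.reindex_bij_betw[OF b])
  finally show ?thesis .
qed

lemma period_lattice_subset:
  assumes "x \<in> period_lattice (of_nat n * \<eta>)" shows "x \<in> period_lattice \<eta>"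
proof -
  obtain a b where "x = of_int a + of_int b * (of_nat n * \<eta>)" using assms unfolding period_lattice_def by blast
  hence "x = of_int a + of_int (b * int n) * \<eta>" by simp
  thus ?thesis unfolding period_lattice_def by blast
qed

lemma period_lattice_int_eta [simp]: "of_int c * \<eta> \<in> period_lattice \<eta>"
  using lattice_intro[of 0 c \<eta>] by simp

lemma lattice_add_int_eta_iff: "x + of_int c * \<eta> \<in> period_lattice \<eta> \<longleftrightarrow> x \<in> period_lattice \<eta>"
  by (rule lattice_add_iff) simp

lemma int_eta_lattice_iff:
  assumes n: "n > 0" and eta: "Im \<eta> > 0"
  shows "of_int a * \<eta> \<in> period_lattice (of_nat n * \<eta>) \<longleftrightarrow> a mod int n = 0"
proof
  assume "of_int a * \<eta> \<in> period_lattice (of_nat n * \<eta>)"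
  then obtain c d where "of_int a * \<eta> = of_int c + of_int d * (of_nat n * \<eta>)" unfolding period_lattice_def by blast
  from arg_cong[OF this, of Im] have "real_of_int a = of_int (d * int n)" using eta by simp
  hence "a = d * int n" by (simp only: of_int_eq_iff)
  thus "a mod int n = 0" by simp
next
  assume "a mod int n = 0"
  then obtain d where "a = int n * d" by (auto simp: mod_eq_0_iff_dvd)
  hence "of_int a * \<eta> = of_int 0 + of_int d * (of_nat n * \<eta>)" by simp
  thus "of_int a * \<eta> \<in> period_lattice (of_nat n * \<eta>)" by (metis lattice_intro)
qed

context
  fixes n :: nat and \<eta> :: complex
  assumes n: "n > 0" and eta: "Im \<eta> > 0"
begin

lemma sg_nonzero: "x \<notin> period_lattice \<eta> \<Longrightarrow> sg n \<eta> (x + of_int c * \<eta>) \<noteq> 0"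
  using period_lattice_subset[of "x + of_int c * \<eta>" n \<eta>] by (auto simp: sg_eq_0_iff[OF n eta] lattice_add_int_eta_iff)

lemma sg_int_eta: "sg n \<eta> (of_int a * \<eta>) = 0 \<longleftrightarrow> a mod int n = 0"
  by (simp add: sg_eq_0_iff[OF n eta] int_eta_lattice_iff[OF n eta])

lemma Phi_holomorphic:
  assumes "f holomorphic_on S" "\<And>z. z \<in> S \<Longrightarrow> f z \<notin> period_lattice \<eta>" "Y \<notin> period_lattice \<eta>"
  shows "(\<lambda>z. Phi n \<eta> a b (f z) Y) holomorphic_on S"
  unfolding Phi_def
  by (intro holomorphic_on_divide holomorphic_on_mult holomorphic_on_ee holomorphic_on_sg[OF n eta]
      holomorphic_intros assms(1)) (use sg_nonzero assms n in auto)

lemma tendsto_Phi: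
  assumes f: "(f \<longlongrightarrow> x) F" and g: "(g \<longlongrightarrow> y) F"
    and nz: "sg n \<eta> (x + of_int a * \<eta>) \<noteq> 0" "sg n \<eta> (y + of_int b * \<eta>) \<noteq> 0"
  shows "((\<lambda>t. Phi n \<eta> a b (f t) (g t)) \<longlongrightarrow> Phi n \<eta> a b x y) F"
  unfolding Phi_def
  by (intro tendsto_divide tendsto_mult tendsto_ee tendsto_sg[OF n eta] tendsto_add tendsto_const f g)
     (use nz n in auto)

text \<open>As functions of \<open>X\<close> the two singular terms cancel at each lattice point, so the sum is entire and
  bounded; the shift \<open>X + 1\<close> multiplies it by a root of unity different from 1.\<close>
lemma unitarity_off_diagonal:
  fixes k a i j :: int
  assumes cop: "coprime k (int n)" and ai: "a mod int n \<noteq> i mod int n"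
    and X: "X \<notin> period_lattice \<eta>" and Y: "Y \<notin> period_lattice \<eta>"
  shows "(\<Sum>c\<in>{0..<int n}. Phi n \<eta> (a - c) (k * (i + j - c - a)) X Y * Phi n \<eta> (c - i) (k * (j - c)) (- X) Y) = 0"
proof -
  define T where "T j X c = Phi n \<eta> (a - c) (k * (i + j - c - a)) X Y * Phi n \<eta> (c - i) (k * (j - c)) (- X) Y" for j X c
  define H where "H j X = (\<Sum>c\<in>{0..<int n}. T j X c)" for j X
  have T_cong: "T j X c = T j X c'" if "c mod int n = c' mod int n" for j X c c'
    unfolding T_def
    by (intro arg_cong2[of _ _ _ _ "(*)"] Phi_cong[OF n eta]) (use that in \<open>auto intro!: mod_diff_cong mod_mult_cong\<close>)
  \<comment> \<open>The phases of the two factors carry the indices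
    \<open>k * (i + j - c - a)\<close> and \<open>k * (j - c)\<close> with opposite signs; the
    difference \<open>k * (i - a)\<close> does not depend on \<open>c\<close>.\<close>
  define \<omega> where "\<omega> l = ee (of_int (l * (k * (i - a))) / of_nat n)" for l
  have H1: "H j (X + of_int l) = \<omega> l * H j X" for j X l
  proof -
    have "T j (X + of_int l) c = \<omega> l * T j X c" for c
    proof -
      have m: "- (X + of_int l) = - X + of_int (- l)" by simp
      have e: "ee (of_int (l * (k * (i + j - c - a))) / of_nat n) * ee (of_int (- l * (k * (j - c))) / of_nat n) = \<omega> l"
        unfolding \<omega>_def ee_add[symmetric]
        by (intro arg_cong[of _ _ ee]) (simp add: add_divide_distrib diff_divide_distrib algebra_simps)
      show ?thesis unfolding T_def m Phi_add_int[OF n eta] e[symmetric] by (simp only: mult_ac)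
    qed
    thus ?thesis unfolding H_def sum_distrib_left by simp
  qed
  \<comment> \<open>The shift moves the first indices by \<open>l\<close> and \<open>- l\<close>,
    and replacing \<open>c\<close> by \<open>c - l\<close> pushes the change into \<open>j\<close>.
    Every pole can thus be moved to 0 at the price of another \<open>j\<close>, which is why
    \<open>T\<close> and \<open>H\<close> keep \<open>j\<close> as an argument.\<close>
  have H2: "H j (X + of_int l * \<eta>) = H (j - l) X" for j X l
  proof -
    have "T j (X + of_int l * \<eta>) c = T (j - l) X (c - l)" for c
    proof -
      have m: "- (X + of_int l * \<eta>) = - X + of_int (- l) * \<eta>" by simp
      have e: "ee (- (of_int l * Y) / of_nat n) * ee (- (of_int (- l) * Y) / of_nat n) = 1"
        unfolding ee_add[symmetric] by simp
      have i: "a - c + l = a - (c - l)" "c - i + - l = c - l - i"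
        "i + j - c - a = i + (j - l) - (c - l) - a" "j - c = (j - l) - (c - l)" by simp_all
      have "T j (X + of_int l * \<eta>) c = (ee (- (of_int l * Y) / of_nat n) * ee (- (of_int (- l) * Y) / of_nat n)) * T (j - l) X (c - l)"
        unfolding T_def m Phi_add_eta[OF n eta] i by (simp only: mult_ac)
      thus ?thesis unfolding e by simp
    qed
    hence "H j (X + of_int l * \<eta>) = (\<Sum>c\<in>{0..<int n}. T (j - l) X (c - l))" unfolding H_def by simp
    also have "\<dots> = H (j - l) X" unfolding H_def
    proof (rule sum_residues[OF n T_cong])
      fix c c' assume "(c - l) mod int n = (c' - l) mod int n"
      from mod_add_cong[OF this refl[of "l mod int n"]] show "c mod int n = c' mod int n" by simp
    qed
    finally show ?thesis .
  qed
  obtain G where G: "G holomorphic_on UNIV" "G 0 \<noteq> 0" "\<And>x. sg n \<eta> x = x * G x" by (rule sg_local[OF n eta], rule that)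
  have nzY: "sg n \<eta> (Y + of_int b * \<eta>) \<noteq> 0" for b by (rule sg_nonzero[OF Y])
  \<comment> \<open>For first index 0 the pole at \<open>X = 0\<close> is at most simple, and its
    residue is the same for every \<open>b\<close> because the \<open>sg\<close> values involving
    \<open>Y\<close> cancel.\<close>
  have Phi0: "((\<lambda>X. X * Phi n \<eta> 0 b X Y) \<longlongrightarrow> inverse (G 0)) (at 0)" for b
  proof -
    let ?f = "\<lambda>X. ee ((of_int b * X + of_int 0 * Y + of_int (0 * b) * \<eta>) / of_nat n) * sg n \<eta> (X + Y + of_int (0 + b) * \<eta>) / (G X * sg n \<eta> (Y + of_int b * \<eta>))"
    have "(?f \<longlongrightarrow> ee ((of_int b * 0 + of_int 0 * Y + of_int (0 * b) * \<eta>) / of_nat n) * sg n \<eta> (0 + Y + of_int (0 + b) * \<eta>) / (G 0 * sg n \<eta> (Y + of_int b * \<eta>))) (at 0)"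
      using isCont_entire[OF G(1), of 0] nzY G(2) n
      by (intro tendsto_divide tendsto_mult tendsto_ee tendsto_sg[OF n eta] tendsto_add tendsto_const tendsto_ident_at)
         (auto simp: isCont_def)
    moreover have "eventually (\<lambda>X. ?f X = X * Phi n \<eta> 0 b X Y) (at 0)"
      unfolding eventually_at_filter
    proof (rule always_eventually, intro allI impI)
      fix X :: complex assume X0: "X \<noteq> 0"
      have "sg n \<eta> (X + of_int 0 * \<eta>) = X * G X" using G(3)[of X] by simp
      thus "?f X = X * Phi n \<eta> 0 b X Y" unfolding Phi_def using X0 by simp
    qed
    ultimately have "((\<lambda>X. X * Phi n \<eta> 0 b X Y) \<longlongrightarrow> ee ((of_int b * 0 + of_int 0 * Y + of_int (0 * b) * \<eta>) / of_nat n) * sg n \<eta> (0 + Y + of_int (0 + b) * \<eta>) / (G 0 * sg n \<eta> (Y + of_int b * \<eta>))) (at 0)"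
      by (rule Lim_transform_eventually)
    thus ?thesis using nzY[of b] by (simp add: field_simps)
  qed
  have Phi0m: "((\<lambda>X. X * Phi n \<eta> 0 b (- X) Y) \<longlongrightarrow> - inverse (G 0)) (at 0)" for b
  proof -
    have "filterlim uminus (at (0::complex)) (at 0)"
      by (auto simp: filterlim_at eventually_at_filter intro!: tendsto_eq_intros)
    from filterlim_compose[OF Phi0 this, of b] have "((\<lambda>X. - X * Phi n \<eta> 0 b (- X) Y) \<longlongrightarrow> inverse (G 0)) (at 0)" .
    from tendsto_minus[OF this] show ?thesis by simp
  qed
  have lim0: "((\<lambda>X. X * H j X) \<longlongrightarrow> 0) (at 0)" for j
  proof -
    define P0 where "P0 = Phi n \<eta> (a - i) (k * (j - a)) 0 Y"
    have reg: "((\<lambda>X. Phi n \<eta> A B X Y) \<longlongrightarrow> Phi n \<eta> A B 0 Y) (at 0)" "((\<lambda>X. Phi n \<eta> A B (- X) Y) \<longlongrightarrow> Phi n \<eta> A B 0 Y) (at 0)"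
      if "A mod int n \<noteq> 0" for A B
    proof -
      have nz: "sg n \<eta> (0 + of_int A * \<eta>) \<noteq> 0" using that by (simp add: sg_int_eta)
      show "((\<lambda>X. Phi n \<eta> A B X Y) \<longlongrightarrow> Phi n \<eta> A B 0 Y) (at 0)"
        by (rule tendsto_Phi[OF tendsto_ident_at tendsto_const nz nzY])
      have "((\<lambda>X. - X) \<longlongrightarrow> (0::complex)) (at 0)" by (rule tendsto_eq_intros refl | simp)+
      thus "((\<lambda>X. Phi n \<eta> A B (- X) Y) \<longlongrightarrow> Phi n \<eta> A B 0 Y) (at 0)"
        by (rule tendsto_Phi[OF _ tendsto_const nz nzY])
    qed
    have ne: "(x - y) mod int n \<noteq> 0" if "x mod int n \<noteq> y mod int n" for x y
      using that by (simp add: mod_eq_dvd_iff mod_eq_0_iff_dvd)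
    \<comment> \<open>At \<open>X = 0\<close> poles arise only for \<open>c\<close> congruent to
      \<open>a\<close>, in the first factor, or to \<open>i\<close>, in the second, with the same
      cofactor limit \<open>P0\<close>. The argument \<open>- X\<close> of the second factor makes
      the two residues opposite.\<close>
    define L where "L c = (if c = a mod int n then P0 * inverse (G 0) else 0) + (if c = i mod int n then - (P0 * inverse (G 0)) else 0)" for c
    have "((\<lambda>X. X * T j X c) \<longlongrightarrow> L c) (at 0)" if c: "c \<in> {0..<int n}" for c
    proof -
      have cm: "c mod int n = c" using c by simp
      consider "c = a mod int n" | "c = i mod int n" | "c \<noteq> a mod int n" "c \<noteq> i mod int n" by blast
      thus ?thesis
      proof cases
        case 1
        have "T j X c = T j X a" for X by (rule T_cong) (simp add: 1)
        hence eq: "X * T j X c = (X * Phi n \<eta> 0 (k * (i + j - a - a)) X Y) * Phi n \<eta> (a - i) (k * (j - a)) (- X) Y" for X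
          by (simp add: T_def)
        have "L c = inverse (G 0) * P0" using 1 ai by (simp add: L_def)
        moreover have "((\<lambda>X. (X * Phi n \<eta> 0 (k * (i + j - a - a)) X Y) * Phi n \<eta> (a - i) (k * (j - a)) (- X) Y) \<longlongrightarrow> inverse (G 0) * P0) (at 0)"
          unfolding P0_def by (intro tendsto_mult Phi0 reg ne ai)
        ultimately show ?thesis unfolding eq by simp
      next
        case 2
        have "T j X c = T j X i" for X by (rule T_cong) (simp add: 2)
        hence eq: "X * T j X c = (X * Phi n \<eta> 0 (k * (j - i)) (- X) Y) * Phi n \<eta> (a - i) (k * (j - a)) X Y" for X
          by (simp add: T_def)
        have "L c = - inverse (G 0) * P0" using 2 ai by (auto simp: L_def)
        moreover have "((\<lambda>X. (X * Phi n \<eta> 0 (k * (j - i)) (- X) Y) * Phi n \<eta> (a - i) (k * (j - a)) X Y) \<longlongrightarrow> - inverse (G 0) * P0) (at 0)"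
          unfolding P0_def by (intro tendsto_mult Phi0m reg ne ai)
        ultimately show ?thesis unfolding eq by simp
      next
        case 3
        have "((\<lambda>X. X * T j X c) \<longlongrightarrow> 0 * (Phi n \<eta> (a - c) (k * (i + j - c - a)) 0 Y * Phi n \<eta> (c - i) (k * (j - c)) 0 Y)) (at 0)"
          unfolding T_def by (intro tendsto_mult tendsto_ident_at reg ne) (use 3 cm in auto)
        thus ?thesis using 3 by (simp add: L_def)
      qed
    qed
    hence "((\<lambda>X. \<Sum>c\<in>{0..<int n}. X * T j X c) \<longlongrightarrow> (\<Sum>c\<in>{0..<int n}. L c)) (at 0)" by (intro tendsto_sum)
    moreover have "(\<Sum>c\<in>{0..<int n}. L c) = 0" unfolding L_def sum.distrib using n by (simp add: sum.delta)
    ultimately show ?thesis unfolding H_def sum_distrib_left by simp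
  qed
  have lim: "((\<lambda>z. (z - p) * H j z) \<longlongrightarrow> 0) (at p)" if p: "p \<in> period_lattice \<eta>" for p j
  proof -
    obtain l m where plm: "p = of_int l + of_int m * \<eta>" using p unfolding period_lattice_def by blast
    have "H j (p + h) = \<omega> l * H (j - m) h" for h
    proof -
      have "p + h = (h + of_int l) + of_int m * \<eta>" unfolding plm by simp
      thus ?thesis by (simp only: H1 H2)
    qed
    hence e: "(p + h - p) * H j (p + h) = \<omega> l * (h * H (j - m) h)" for h by simp
    have "((\<lambda>h. \<omega> l * (h * H (j - m) h)) \<longlongrightarrow> \<omega> l * 0) (at 0)" by (intro tendsto_mult tendsto_const lim0)
    hence "((\<lambda>h. (p + h - p) * H j (p + h)) \<longlongrightarrow> 0) (at 0)" unfolding e by simp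
    thus ?thesis by (rule LIM_offset_zero_cancel[where f = "\<lambda>z. (z - p) * H j z"])
  qed
  have hol: "H j holomorphic_on - period_lattice \<eta>" for j
    unfolding H_def T_def
    by (intro holomorphic_on_sum holomorphic_on_mult Phi_holomorphic Y) (auto intro!: holomorphic_intros)
  obtain g where g: "g holomorphic_on UNIV" "\<And>z. z \<notin> period_lattice \<eta> \<Longrightarrow> g z = H j z"
    using entire_extension[OF hol closed_lattice[OF eta] lattice_disc[OF eta] lim] by blast
  have g1: "g (z + 1) = \<omega> 1 * g z" for z
  proof (rule lattice_cancel[OF eta, of "\<lambda>z. g (z + 1)" "\<lambda>z. \<omega> 1 * g z" 0])
    fix z assume "z - 0 \<notin> period_lattice \<eta>"
    thus "g (z + 1) = \<omega> 1 * g z" using g(2)[of z] g(2)[of "z + 1"] H1[of j z 1] by (simp add: lattice_add_iff)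
  qed (intro holomorphic_intros entire_shift g(1))+
  \<comment> \<open>After \<open>n\<close> steps \<open>j\<close> is back in its residue class, so
    \<open>n * \<eta>\<close> is a true period.\<close>
  have Hn: "H (j - int n) z = H j z" for z
  proof -
    have "T (j - int n) z c = T j z c" for c
    proof -
      have "(k * (i + (j - int n) - c - a)) mod int n = (k * (i + j - c - a)) mod int n"
        "(k * (j - int n - c)) mod int n = (k * (j - c)) mod int n"
        by (simp_all add: mod_eq_dvd_iff algebra_simps)
      thus ?thesis unfolding T_def by (intro arg_cong2[of _ _ _ _ "(*)"] Phi_cong[OF n eta]) auto
    qed
    thus ?thesis unfolding H_def by simp
  qed
  have g2: "g (z + of_nat n * \<eta>) = g z" for z
  proof (rule lattice_cancel[OF eta, of "\<lambda>z. g (z + of_nat n * \<eta>)" g 0])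
    fix z assume z: "z - 0 \<notin> period_lattice \<eta>"
    hence "z + of_nat n * \<eta> \<notin> period_lattice \<eta>" using lattice_add_int_eta_iff[of z "int n" \<eta>] by simp
    thus "g (z + of_nat n * \<eta>) = g z" using g(2)[of z] g(2)[of "z + of_nat n * \<eta>"] H2[of j z "int n"] z by (simp add: Hn)
  qed (intro holomorphic_intros entire_shift g(1))+
  have "norm (\<omega> 1) = 1" unfolding \<omega>_def norm_ee using n by simp
  hence g1': "norm (g (z + 1)) = norm (g z)" for z unfolding g1 norm_mult by simp
  have g2': "norm (g (z + of_nat n * \<eta>)) = norm (g z)" for z unfolding g2 ..
  obtain C where C: "\<And>z. g z = C"
    using doubly_periodic_norm_constant[OF neta[OF n eta] g(1) g1' g2'] by blast
  have "\<omega> 1 \<noteq> 1"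
  proof
    assume "\<omega> 1 = 1"
    then obtain m where "of_int (k * (i - a)) / of_nat n = (of_int m :: complex)"
      unfolding \<omega>_def ee_eq_1_iff by (auto elim: Ints_cases)
    hence "(of_int (k * (i - a)) :: complex) = of_int (m * int n)" using n by (simp add: field_simps)
    hence "k * (i - a) = m * int n" by (simp only: of_int_eq_iff)
    hence "int n dvd k * (i - a)" by simp
    hence "int n dvd i - a" using cop by (simp add: coprime_dvd_mult_right_iff coprime_commute)
    thus False using ai by (metis mod_eq_dvd_iff)
  qed
  hence "C = 0" using g1[of 0] C by simp
  hence "H j X = 0" using g(2)[OF X] C by simp
  thus ?thesis unfolding H_def T_def .
qed

section \<open>Diagonal entries of the unitarity relation\<close>

lemma Wfun_cong:
  assumes "c mod int n = c' mod int n"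
  shows "Wfun n \<eta> (x + of_int c * \<eta>) w = Wfun n \<eta> (x + of_int c' * \<eta>) w"
proof -
  have "int n dvd c - c'" using assms by (simp add: mod_eq_dvd_iff)
  then obtain m where "c - c' = int n * m" by (rule dvdE)
  hence "c = c' + int n * m" by simp
  hence e: "x + of_int c * \<eta> = (x + of_int c' * \<eta>) + of_int m * (of_nat n * \<eta>)" by (simp add: algebra_simps)
  show ?thesis unfolding e
    by (rule shift_int_induct[of "\<lambda>u. Wfun n \<eta> u w" "of_nat n * \<eta>", OF Wfun_add_period[OF n eta]])
qed

text \<open>Summing an even function with periods 1 and \<open>n * \<eta>\<close> over n successive
  translates by \<open>\<eta>\<close> yields an even function with periods 1 and
  \<open>\<eta>\<close>. Such a function agrees at \<open>X\<close> and \<open>Y\<close> when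
  \<open>X + Y\<close> or \<open>X - Y\<close> is a lattice point.\<close>

lemma Wfun_sum_shift:
  assumes "X + Y \<in> period_lattice \<eta> \<or> X - Y \<in> period_lattice \<eta>"
  shows "(\<Sum>c\<in>{0..<int n}. Wfun n \<eta> (X + of_int c * \<eta>) w) = (\<Sum>c\<in>{0..<int n}. Wfun n \<eta> (Y + of_int c * \<eta>) w)"
proof -
  note cg = Wfun_cong
  have sh: "(\<Sum>c\<in>{0..<int n}. Wfun n \<eta> (x + (of_int l + of_int m * \<eta>) + of_int c * \<eta>) w) = (\<Sum>c\<in>{0..<int n}. Wfun n \<eta> (x + of_int c * \<eta>) w)" for x l m
  proof -
    have "Wfun n \<eta> (x + (of_int l + of_int m * \<eta>) + of_int c * \<eta>) w = Wfun n \<eta> (x + of_int (c + m) * \<eta>) w" for c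
    proof -
      have e: "x + (of_int l + of_int m * \<eta>) + of_int c * \<eta> = (x + of_int (c + m) * \<eta>) + of_int l * 1" by (simp add: algebra_simps)
      show ?thesis unfolding e
        by (rule shift_int_induct[of "\<lambda>u. Wfun n \<eta> u w" 1, OF Wfun_add_1[OF n eta]])
    qed
    hence "(\<Sum>c\<in>{0..<int n}. Wfun n \<eta> (x + (of_int l + of_int m * \<eta>) + of_int c * \<eta>) w) = (\<Sum>c\<in>{0..<int n}. Wfun n \<eta> (x + of_int (c + m) * \<eta>) w)" by simp
    also have "\<dots> = (\<Sum>c\<in>{0..<int n}. Wfun n \<eta> (x + of_int c * \<eta>) w)"
    proof (rule sum_residues[OF n, of "\<lambda>c. Wfun n \<eta> (x + of_int c * \<eta>) w"])
      fix c c' assume "(c + m) mod int n = (c' + m) mod int n"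
      thus "c mod int n = c' mod int n" by (simp add: mod_eq_dvd_iff)
    qed (rule cg)
    finally show ?thesis .
  qed
  have neg: "(\<Sum>c\<in>{0..<int n}. Wfun n \<eta> (- x + of_int c * \<eta>) w) = (\<Sum>c\<in>{0..<int n}. Wfun n \<eta> (x + of_int c * \<eta>) w)" for x
  proof -
    have "Wfun n \<eta> (- x + of_int c * \<eta>) w = Wfun n \<eta> (x + of_int (- c) * \<eta>) w" for c
      using Wfun_uminus[OF n eta, of "x + of_int (- c) * \<eta>" w] by simp
    hence "(\<Sum>c\<in>{0..<int n}. Wfun n \<eta> (- x + of_int c * \<eta>) w) = (\<Sum>c\<in>{0..<int n}. Wfun n \<eta> (x + of_int (- c) * \<eta>) w)" by simp
    also have "\<dots> = (\<Sum>c\<in>{0..<int n}. Wfun n \<eta> (x + of_int c * \<eta>) w)"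
    proof (rule sum_residues[OF n, of "\<lambda>c. Wfun n \<eta> (x + of_int c * \<eta>) w"])
      fix c c' assume "(- c) mod int n = (- c') mod int n"
      thus "c mod int n = c' mod int n" by (metis mod_minus_cong minus_minus)
    qed (rule cg)
    finally show ?thesis .
  qed
  from assms show ?thesis
  proof
    assume "X - Y \<in> period_lattice \<eta>"
    then obtain l m where "X - Y = of_int l + of_int m * \<eta>" unfolding period_lattice_def by blast
    hence "X = Y + (of_int l + of_int m * \<eta>)" by (simp add: algebra_simps)
    thus ?thesis using sh[of Y l m] by simp
  next
    assume "X + Y \<in> period_lattice \<eta>"
    then obtain l m where "X + Y = of_int l + of_int m * \<eta>" unfolding period_lattice_def by blast
    hence "X = - Y + (of_int l + of_int m * \<eta>)" by (simp add: algebra_simps)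
    thus ?thesis using sh[of "- Y" l m] neg[of Y] by simp
  qed
qed

text \<open>When \<open>a\<close> and \<open>i\<close> are congruent, each summand is a value of
  \<open>Wfun\<close>, which splits into a part in \<open>X\<close> and a part in \<open>Y\<close>;
  the sums of the two parts agree by \<open>Wfun_sum_shift\<close>. The other entries are
  \<open>unitarity_off_diagonal\<close>.\<close>

lemma unitarity_zero:
  fixes k a i j :: int
  assumes cop: "coprime k (int n)" and X: "X \<notin> period_lattice \<eta>" and Y: "Y \<notin> period_lattice \<eta>"
    and XY: "X + Y \<in> period_lattice \<eta> \<or> X - Y \<in> period_lattice \<eta>"
  shows "(\<Sum>c\<in>{0..<int n}. Phi n \<eta> (a - c) (k * (i + j - c - a)) X Y * Phi n \<eta> (c - i) (k * (j - c)) (- X) Y) = 0"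
proof (cases "a mod int n = i mod int n")
  case False
  thus ?thesis by (rule unitarity_off_diagonal[OF cop _ X Y])
next
  case True
  \<comment> \<open>An auxiliary third argument for \<open>Wfun_three_term\<close>; it has to avoid
    the lattice of \<open>n * \<eta>\<close> and serves both halves of the difference.\<close>
  let ?w = "1 / 2 :: complex"
  have w: "?w \<notin> period_lattice (of_nat n * \<eta>)"
  proof
    assume "?w \<in> period_lattice (of_nat n * \<eta>)"
    then obtain l m where e: "?w = of_int l + of_int m * (of_nat n * \<eta>)" unfolding period_lattice_def by blast
    from arg_cong[OF e, of Im] have "m = 0" using n eta by simp
    with e have "?w = of_int l" by simp
    from arg_cong[OF this, of Re] have "real_of_int 1 = of_int (2 * l)" by simp
    hence "1 = 2 * l" by (simp only: of_int_eq_iff)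
    thus False by presburger
  qed
  have nl: "x + of_int c * \<eta> \<notin> period_lattice (of_nat n * \<eta>)" if "x \<notin> period_lattice \<eta>" for x c
    using sg_nonzero[OF that, of c] by (simp add: sg_eq_0_iff[OF n eta])
  have t: "Phi n \<eta> (a - c) (k * (i + j - c - a)) X Y * Phi n \<eta> (c - i) (k * (j - c)) (- X) Y
     = Wfun n \<eta> (X + of_int (i - c) * \<eta>) ?w - Wfun n \<eta> (Y + of_int (k * (j - c)) * \<eta>) ?w" for c
  proof -
    have "(a - c) mod int n = (i - c) mod int n" using True by (rule mod_diff_cong) simp
    moreover have "(k * (i + j - c - a)) mod int n = (k * (j - c)) mod int n"
    proof (rule mod_mult_cong[OF refl])
      have "(i + j - c - a) mod int n = (i + j - c - i) mod int n" by (rule mod_diff_cong[OF refl True])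
      thus "(i + j - c - a) mod int n = (j - c) mod int n" by (simp add: algebra_simps)
    qed
    ultimately have "Phi n \<eta> (a - c) (k * (i + j - c - a)) X Y = Phi n \<eta> (i - c) (k * (j - c)) X Y" by (rule Phi_cong[OF n eta])
    hence "Phi n \<eta> (a - c) (k * (i + j - c - a)) X Y * Phi n \<eta> (c - i) (k * (j - c)) (- X) Y
      = Wfun n \<eta> (X + of_int (i - c) * \<eta>) (Y + of_int (k * (j - c)) * \<eta>)"
      using Phi_diagonal_product[OF n eta, of "i - c" "k * (j - c)" X Y] by simp
    also have "\<dots> = Wfun n \<eta> (X + of_int (i - c) * \<eta>) ?w - Wfun n \<eta> (Y + of_int (k * (j - c)) * \<eta>) ?w"
      by (rule Wfun_three_term[OF n eta nl[OF X] nl[OF Y] w])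
    finally show ?thesis .
  qed
  note cg = Wfun_cong
  have 1: "(\<Sum>c\<in>{0..<int n}. Wfun n \<eta> (X + of_int (i - c) * \<eta>) ?w) = (\<Sum>c\<in>{0..<int n}. Wfun n \<eta> (X + of_int c * \<eta>) ?w)"
  proof (rule sum_residues[OF n, of "\<lambda>c. Wfun n \<eta> (X + of_int c * \<eta>) ?w"])
    fix c c' assume "(i - c) mod int n = (i - c') mod int n"
    hence "int n dvd c' - c" by (simp add: mod_eq_dvd_iff)
    thus "c mod int n = c' mod int n" by (metis mod_eq_dvd_iff)
  qed (rule cg)
  have 2: "(\<Sum>c\<in>{0..<int n}. Wfun n \<eta> (Y + of_int (k * (j - c)) * \<eta>) ?w) = (\<Sum>c\<in>{0..<int n}. Wfun n \<eta> (Y + of_int c * \<eta>) ?w)"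
  proof (rule sum_residues[OF n, of "\<lambda>c. Wfun n \<eta> (Y + of_int c * \<eta>) ?w"])
    fix c c' assume "(k * (j - c)) mod int n = (k * (j - c')) mod int n"
    hence "int n dvd k * (c' - c)" by (simp add: mod_eq_dvd_iff algebra_simps)
    hence "int n dvd c' - c" using cop by (simp add: coprime_dvd_mult_right_iff coprime_commute)
    thus "c mod int n = c' mod int n" by (metis mod_eq_dvd_iff)
  qed (rule cg)
  show ?thesis unfolding t sum_subtractf 1 2 Wfun_sum_shift[OF XY] by simp
qed

end

subsection \<open>The matrix of \<open>R\<close>\<close>

text \<open>Row \<open>p\<close> encodes the pair (a, b) and column \<open>q\<close> the pair (i,
  j). With r = j - a the denominator indices of R become \<open>a - i\<close> and
  \<open>k * (j - a)\<close>, and modulo n their sum is the index of the numerator.\<close>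

definition Phi_mat :: "nat \<Rightarrow> nat \<Rightarrow> complex \<Rightarrow> complex \<Rightarrow> complex \<Rightarrow> complex mat" where
  "Phi_mat n k \<eta> X Y = mat (n * n) (n * n) (\<lambda>(p, q).
     if (int (p div n) + int (p mod n)) mod int n = (int (q div n) + int (q mod n)) mod int n
     then Phi n \<eta> (int (p div n) - int (q div n)) (int k * (int (q mod n) - int (p div n))) X Y else 0)"

lemma Phi_mat_carrier [simp]: "Phi_mat n k \<eta> X Y \<in> carrier_mat (n * n) (n * n)"
  unfolding Phi_mat_def by simp

lemma R_mat_carrier [simp]: "R_mat n k \<eta> \<tau> z \<in> carrier_mat (n * n) (n * n)"
  unfolding R_mat_def by simp

lemma Phi_mat_index:
  "p < n * n \<Longrightarrow> q < n * n \<Longrightarrow> Phi_mat n k \<eta> X Y $$ (p, q) =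
    (if (int (p div n) + int (p mod n)) mod int n = (int (q div n) + int (q mod n)) mod int n
     then Phi n \<eta> (int (p div n) - int (q div n)) (int k * (int (q mod n) - int (p div n))) X Y else 0)"
  unfolding Phi_mat_def by simp

lemma lattice_n_iff:
  assumes "n > 0" shows "z \<in> lattice_n n \<eta> \<longleftrightarrow> of_nat n * z \<in> period_lattice \<eta>"
  unfolding lattice_n_def period_lattice_def using assms by (auto simp: field_simps)

lemma div_mod_code: "b < n \<Longrightarrow> (a * n + b) div n = a \<and> (a * n + b) mod n = (b::nat)"
  by simp

lemma code_less: "a < n \<Longrightarrow> b < n \<Longrightarrow> a * n + b < n * (n::nat)"
proof -
  assume ab: "a < n" "b < n"
  hence "a * n + b < Suc a * n" by simp
  also have "\<dots> \<le> n * n" using ab by (intro mult_le_mono1) simp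
  finally show ?thesis .
qed

text \<open>The scalar prefactor. It vanishes when n Z is a point of the lattice of
  \<open>\<eta>\<close>, which is where the entries of \<open>Phi_mat\<close> may have
  poles.\<close>

definition theta_all :: "nat \<Rightarrow> complex \<Rightarrow> complex \<Rightarrow> complex" where
  "theta_all n \<eta> Z = (\<Prod>\<alpha>\<in>{0..<int n}. theta_int n \<eta> \<alpha> Z)"

text \<open>Lowers the second digit by one modulo n. Adding \<open>n - 1\<close> avoids truncated
  subtraction, and fixing all other numbers makes it a permutation in the sense of
  \<open>permutes\<close>; \<open>rotate_fst\<close> does the same to the first digit.\<close>

definition rotate_snd :: "nat \<Rightarrow> nat \<Rightarrow> nat" where
  "rotate_snd n p = (if p < n * n then (p div n) * n + (p mod n + (n - 1)) mod n else p)"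

definition rotate_fst :: "nat \<Rightarrow> nat \<Rightarrow> nat" where
  "rotate_fst n p = (if p < n * n then ((p div n + (n - 1)) mod n) * n + p mod n else p)"

context
  fixes n :: nat
  assumes n: "n > 0"
begin

lemma div_less_n: "p < n * n \<Longrightarrow> p div n < n" using n by (simp add: less_mult_imp_div_less)

lemma rotate_inj: "u < n \<Longrightarrow> v < n \<Longrightarrow> (u + (n - 1)) mod n = (v + (n - 1)) mod n \<Longrightarrow> u = v"
proof -
  assume uv: "u < n" "v < n" "(u + (n - 1)) mod n = (v + (n - 1)) mod n"
  have "(u + (n - 1) + 1) mod n = (v + (n - 1) + 1) mod n" using uv(3) by (rule mod_add_cong) simp
  thus "u = v" using uv(1,2) n by simp
qed

lemma rotate_snd_code: "p < n * n \<Longrightarrow> rotate_snd n p < n * n \<and> rotate_snd n p div n = p div n \<and> rotate_snd n p mod n = (p mod n + (n - 1)) mod n"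
  using n div_less_n[of p] code_less[of "p div n" n "(p mod n + (n - 1)) mod n"] unfolding rotate_snd_def by simp

lemma rotate_fst_code: "p < n * n \<Longrightarrow> rotate_fst n p < n * n \<and> rotate_fst n p div n = (p div n + (n - 1)) mod n \<and> rotate_fst n p mod n = p mod n"
  using n code_less[of "(p div n + (n - 1)) mod n" n "p mod n"] unfolding rotate_fst_def by simp

lemma bij_betw_rotate_snd: "bij_betw (rotate_snd n) {..<n * n} {..<n * n}"
proof -
  have inj: "inj_on (rotate_snd n) {..<n * n}"
  proof (rule inj_onI)
    fix p q assume pq: "p \<in> {..<n * n}" "q \<in> {..<n * n}" "rotate_snd n p = rotate_snd n q"
    have 1: "p div n = q div n" using rotate_snd_code[of p] rotate_snd_code[of q] pq by simp
    have "(p mod n + (n - 1)) mod n = (q mod n + (n - 1)) mod n" using rotate_snd_code[of p] rotate_snd_code[of q] pq by simp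
    hence "p mod n = q mod n" by (rule rotate_inj[rotated 2]) (use n in auto)
    thus "p = q" using 1 by (metis div_mult_mod_eq)
  qed
  have "rotate_snd n ` {..<n * n} \<subseteq> {..<n * n}" using rotate_snd_code by auto
  from endo_inj_surj[OF _ this inj] inj show ?thesis unfolding bij_betw_def by simp
qed

lemma bij_betw_rotate_fst: "bij_betw (rotate_fst n) {..<n * n} {..<n * n}"
proof -
  have inj: "inj_on (rotate_fst n) {..<n * n}"
  proof (rule inj_onI)
    fix p q assume pq: "p \<in> {..<n * n}" "q \<in> {..<n * n}" "rotate_fst n p = rotate_fst n q"
    have 1: "p mod n = q mod n" using rotate_fst_code[of p] rotate_fst_code[of q] pq by simp
    have "(p div n + (n - 1)) mod n = (q div n + (n - 1)) mod n" using rotate_fst_code[of p] rotate_fst_code[of q] pq by simp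
    hence "p div n = q div n" by (rule rotate_inj[rotated 2]) (use div_less_n pq in auto)
    thus "p = q" using 1 by (metis div_mult_mod_eq)
  qed
  have "rotate_fst n ` {..<n * n} \<subseteq> {..<n * n}" using rotate_fst_code by auto
  from endo_inj_surj[OF _ this inj] inj show ?thesis unfolding bij_betw_def by simp
qed

lemma rotate_permutes: "rotate_snd n permutes {0..<n * n}" "rotate_fst n permutes {0..<n * n}"
  unfolding atLeast0LessThan
  by (rule bij_imp_permutes[OF bij_betw_rotate_snd], simp add: rotate_snd_def)
    (rule bij_imp_permutes[OF bij_betw_rotate_fst], simp add: rotate_fst_def)

lemma int_rotate: "int ((u + (n - 1)) mod n) mod int n = (int u - 1) mod int n"
proof -
  have "int ((u + (n - 1)) mod n) mod int n = (int u - 1 + int n) mod int n"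
    using n by (simp add: of_nat_mod of_nat_diff algebra_simps)
  thus ?thesis by simp
qed

end

context
  fixes n k :: nat and \<eta> :: complex
  assumes n: "n > 0" and eta: "Im \<eta> > 0" and cop: "coprime n k"
begin

text \<open>The root of unity belonging to \<open>k * (j - a)\<close> splits into a row factor in
  \<open>a\<close> and a column factor in \<open>j\<close>.\<close>

lemma Phi_mat_add_1:
  assumes "p < n * n" "q < n * n"
  shows "Phi_mat n k \<eta> (X + 1) Y $$ (p, q) = ee (- of_int (int k * int (p div n)) / of_nat n) * Phi_mat n k \<eta> X Y $$ (id p, id q)
    * ee (of_int (int k * int (q mod n)) / of_nat n)"
proof -
  have "ee (of_int (int k * (int (q mod n) - int (p div n))) / of_nat n) =
     ee (- of_int (int k * int (p div n)) / of_nat n) * ee (of_int (int k * int (q mod n)) / of_nat n)"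
    unfolding ee_add[symmetric] by (intro arg_cong[of _ _ ee]) (simp add: algebra_simps diff_divide_distrib)
  thus ?thesis using assms by (simp add: Phi_mat_index Phi_add_1[OF n eta])
qed

text \<open>The translation raises \<open>a - i\<close> by one, which is the effect of lowering
  \<open>i\<close> in the column. Lowering \<open>b\<close> in the row at the same time preserves
  the condition a + b = i + j, and neither digit occurs in \<open>k * (j - a)\<close>.\<close>

lemma Phi_mat_add_eta:
  assumes "p < n * n" "q < n * n"
  shows "Phi_mat n k \<eta> (X + \<eta>) Y $$ (p, q) = ee (- Y / of_nat n) * Phi_mat n k \<eta> X Y $$ (rotate_snd n p, rotate_fst n q) * 1"
proof -
  let ?a = "int (p div n)" and ?b = "int (p mod n)" and ?i = "int (q div n)" and ?j = "int (q mod n)"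
  note r = rotate_snd_code[OF n assms(1)] rotate_fst_code[OF n assms(2)]
  let ?b' = "int ((p mod n + (n - 1)) mod n)" and ?i' = "int ((q div n + (n - 1)) mod n)"
  have b: "?b' mod int n = (?b - 1) mod int n" and i: "?i' mod int n = (?i - 1) mod int n"
    by (rule int_rotate[OF n])+
  have ab: "(?a + ?b') mod int n = (?a + (?b - 1)) mod int n" by (rule mod_add_cong[OF refl b])
  have ij: "(?i' + ?j) mod int n = ((?i - 1) + ?j) mod int n" by (rule mod_add_cong[OF i refl])
  have c: "(?a + ?b') mod int n = (?i' + ?j) mod int n \<longleftrightarrow> (?a + ?b) mod int n = (?i + ?j) mod int n"
    unfolding ab ij by (simp add: mod_eq_dvd_iff algebra_simps)
  have "(?a - ?i') mod int n = (?a - (?i - 1)) mod int n" by (rule mod_diff_cong[OF refl i])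
  hence ph: "Phi n \<eta> (?a - ?i') (int k * (?j - ?a)) X Y = Phi n \<eta> (?a - ?i + 1) (int k * (?j - ?a)) X Y"
    by (intro Phi_cong[OF n eta]) (simp_all add: algebra_simps)
  have "Phi_mat n k \<eta> X Y $$ (rotate_snd n p, rotate_fst n q) =
      (if (?a + ?b') mod int n = (?i' + ?j) mod int n then Phi n \<eta> (?a - ?i') (int k * (?j - ?a)) X Y else 0)"
    using r by (simp add: Phi_mat_index)
  thus ?thesis using assms Phi_add_eta[OF n eta, of "?a - ?i" "int k * (?j - ?a)" X 1 Y]
    unfolding c ph by (simp add: Phi_mat_index)
qed

lemma kernel_dim_Phi_mat_shift:
  assumes "w \<in> period_lattice \<eta>"
  shows "kernel_dim (Phi_mat n k \<eta> (X + w) Y) = kernel_dim (Phi_mat n k \<eta> X Y)"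
proof -
  obtain l m where w: "w = of_int l + of_int m * \<eta>" using assms unfolding period_lattice_def by blast
  have 1: "kernel_dim (Phi_mat n k \<eta> (X + 1) Y) = kernel_dim (Phi_mat n k \<eta> X Y)" for X
    by (rule kernel_dim_monomial[OF _ _ bij_betw_id bij_betw_id _ _ Phi_mat_add_1]) auto
  have 2: "kernel_dim (Phi_mat n k \<eta> (X + \<eta>) Y) = kernel_dim (Phi_mat n k \<eta> X Y)" for X
    by (rule kernel_dim_monomial[OF _ _ bij_betw_rotate_snd[OF n] bij_betw_rotate_fst[OF n] _ _ Phi_mat_add_eta]) auto
  have e: "X + w = (X + of_int l * 1) + of_int m * \<eta>" by (simp add: w)
  have "kernel_dim (Phi_mat n k \<eta> (X + w) Y) = kernel_dim (Phi_mat n k \<eta> (X + of_int l * 1) Y)"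
    unfolding e by (rule shift_int_induct[of "\<lambda>X. kernel_dim (Phi_mat n k \<eta> X Y)", OF 2])
  also have "\<dots> = kernel_dim (Phi_mat n k \<eta> X Y)"
    by (rule shift_int_induct[of "\<lambda>X. kernel_dim (Phi_mat n k \<eta> X Y)", OF 1])
  finally show ?thesis .
qed

lemma det_Phi_mat_add_1:
  obtains C where "C \<noteq> 0" "\<And>X. det (Phi_mat n k \<eta> (X + 1) Y) = C * det (Phi_mat n k \<eta> X Y)"
proof -
  let ?u = "\<lambda>p. ee (- of_int (int k * int (p div n)) / of_nat n)" and ?w = "\<lambda>q. ee (of_int (int k * int (q mod n)) / of_nat n)"
  have "det (Phi_mat n k \<eta> (X + 1) Y) = (\<Prod>p<n*n. ?u p) * (\<Prod>q<n*n. ?w q) * (signof id * signof id) * det (Phi_mat n k \<eta> X Y)" for X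
    by (rule det_monomial[OF _ _ permutes_id permutes_id Phi_mat_add_1]) auto
  thus thesis by (intro that[of "(\<Prod>p<n*n. ?u p) * (\<Prod>q<n*n. ?w q) * (signof id * signof id)"]) (auto simp: sign_def)
qed

lemma det_Phi_mat_add_eta:
  obtains C where "C \<noteq> 0" "\<And>X. det (Phi_mat n k \<eta> (X + \<eta>) Y) = C * det (Phi_mat n k \<eta> X Y)"
proof -
  have "det (Phi_mat n k \<eta> (X + \<eta>) Y) = (\<Prod>p<n*n. ee (- Y / of_nat n)) * (\<Prod>q<n*n. 1)
     * (signof (rotate_snd n) * signof (rotate_fst n)) * det (Phi_mat n k \<eta> X Y)" for X
    by (rule det_monomial[OF _ _ rotate_permutes[OF n] Phi_mat_add_eta]) auto
  thus thesis
    by (intro that[of "(\<Prod>p<n*n. ee (- Y / of_nat n)) * (\<Prod>q<n*n. 1) * (signof (rotate_snd n) * signof (rotate_fst n))"])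
       (auto simp: sign_def)
qed

text \<open>For a given first digit \<open>c\<close> of the middle index the congruence determines
  the second digit, so the matrix product collapses to the single sum of
  \<open>unitarity_zero\<close>.\<close>

lemma Phi_mat_unitarity:
  assumes X: "X \<notin> period_lattice \<eta>" and Y: "Y \<notin> period_lattice \<eta>"
    and XY: "X + Y \<in> period_lattice \<eta> \<or> X - Y \<in> period_lattice \<eta>"
  shows "Phi_mat n k \<eta> X Y * Phi_mat n k \<eta> (- X) Y = 0\<^sub>m (n * n) (n * n)"
proof (rule eq_matI)
  fix p q assume "p < dim_row (0\<^sub>m (n * n) (n * n))" "q < dim_col (0\<^sub>m (n * n) (n * n))"
  hence pq: "p < n * n" "q < n * n" by auto
  define a b i j where "a = int (p div n)" and "b = int (p mod n)" and "i = int (q div n)" and "j = int (q mod n)"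
  let ?A = "Phi_mat n k \<eta> X Y" and ?B = "Phi_mat n k \<eta> (- X) Y"
  let ?g = "\<lambda>c. if (a + b) mod int n = (i + j) mod int n then
      Phi n \<eta> (a - c) (int k * (i + j - c - a)) X Y * Phi n \<eta> (c - i) (int k * (j - c)) (- X) Y else 0"
  have "(?A * ?B) $$ (p, q) = (\<Sum>r<n * n. ?A $$ (p, r) * ?B $$ (r, q))"
    using pq by (auto simp: scalar_prod_def atLeast0LessThan Phi_mat_def)
  also have "\<dots> = (\<Sum>c<n. \<Sum>r\<in>{c * n..<c * n + n}. ?A $$ (p, r) * ?B $$ (r, q))"
    by (rule sum.nat_group[symmetric])
  also have "\<dots> = (\<Sum>c<n. ?g (int c))"
  proof (rule sum.cong[OF refl])
    fix c assume "c \<in> {..<n}"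
    hence c: "c < n" by simp
    define d where "d = nat ((a + b - int c) mod int n)"
    have d: "d < n" "int d mod int n = (a + b - int c) mod int n" "int d = (a + b - int c) mod int n"
      using n unfolding d_def by (simp_all add: nat_less_iff)
    have r0: "c * n + d < n * n" "(c * n + d) div n = c" "(c * n + d) mod n = d"
      using code_less[OF c d(1)] div_mod_code[OF d(1)] by auto
    have "(\<Sum>r\<in>{c * n..<c * n + n}. ?A $$ (p, r) * ?B $$ (r, q)) = (\<Sum>r\<in>{c * n..<c * n + n}. if r = c * n + d then ?A $$ (p, r) * ?B $$ (r, q) else 0)"
    proof (rule sum.cong[OF refl])
      fix r assume r: "r \<in> {c * n..<c * n + n}"
      define e where "e = r - c * n"
      have re: "r = c * n + e" "e < n" using r unfolding e_def by auto
      show "?A $$ (p, r) * ?B $$ (r, q) = (if r = c * n + d then ?A $$ (p, r) * ?B $$ (r, q) else 0)"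
      proof (cases "e = d")
        case False
        have "(a + b) mod int n \<noteq> (int c + int e) mod int n"
        proof
          assume "(a + b) mod int n = (int c + int e) mod int n"
          hence "(a + b - int c) mod int n = (int c + int e - int c) mod int n" by (rule mod_diff_cong) simp
          hence "int d = int e" using re(2) d(3) by simp
          thus False using False by simp
        qed
        hence "?A $$ (p, r) = 0" using pq(1) code_less[OF c re(2)] div_mod_code[OF re(2), of c]
          unfolding re(1) a_def b_def by (simp add: Phi_mat_index)
        thus ?thesis using False re by simp
      qed (use re in simp)
    qed
    also have "\<dots> = ?A $$ (p, c * n + d) * ?B $$ (c * n + d, q)" using d(1) by (simp add: sum.delta)
    also have "\<dots> = ?g (int c)"
    proof -
      have "(int c + int d) mod int n = (int c + (a + b - int c)) mod int n" by (rule mod_add_cong[OF refl d(2)])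
      hence cd: "(int c + int d) mod int n = (a + b) mod int n" by simp
      have A: "?A $$ (p, c * n + d) = Phi n \<eta> (a - int c) (int k * (int d - a)) X Y"
        using pq r0 cd by (simp add: Phi_mat_index a_def b_def)
      have B: "?B $$ (c * n + d, q) = (if (a + b) mod int n = (i + j) mod int n then Phi n \<eta> (int c - i) (int k * (j - int c)) (- X) Y else 0)"
        using pq r0 cd by (simp add: Phi_mat_index i_def j_def)
      show ?thesis
      proof (cases "(a + b) mod int n = (i + j) mod int n")
        case True
        have "(a + b - int c) mod int n = (i + j - int c) mod int n" by (rule mod_diff_cong[OF True refl])
        hence "(int d - a) mod int n = (i + j - int c - a) mod int n" using d(2) by (intro mod_diff_cong) auto
        hence "(int k * (int d - a)) mod int n = (int k * (i + j - int c - a)) mod int n" by (rule mod_mult_cong[OF refl])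
        hence "Phi n \<eta> (a - int c) (int k * (int d - a)) X Y = Phi n \<eta> (a - int c) (int k * (i + j - int c - a)) X Y"
          by (intro Phi_cong[OF n eta]) simp
        thus ?thesis unfolding A B using True by simp
      qed (unfold A B, simp)
    qed
    finally show "(\<Sum>r\<in>{c * n..<c * n + n}. ?A $$ (p, r) * ?B $$ (r, q)) = ?g (int c)" .
  qed
  also have "\<dots> = (\<Sum>c\<in>int ` {0..<n}. ?g c)" by (subst sum.reindex) (auto simp: atLeast0LessThan)
  also have "int ` {0..<n} = {0..<int n}" by (simp add: image_int_atLeastLessThan)
  also have "(\<Sum>c\<in>{0..<int n}. ?g c) = 0"
    using unitarity_zero[OF n eta _ X Y XY, of "int k" a i j] cop
    by (cases "(a + b) mod int n = (i + j) mod int n") (simp_all add: coprime_commute)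
  finally show "(?A * ?B) $$ (p, q) = 0\<^sub>m (n * n) (n * n) $$ (p, q)" using pq by simp
qed (auto simp: Phi_mat_def)

section \<open>The scalar factor between \<open>R_mat\<close> and \<open>Phi_mat\<close>\<close>

lemma theta_int_entire: "theta_int n \<eta> a holomorphic_on UNIV"
proof -
  obtain K where K0: "K \<noteq> 0" and K: "\<And>a z. theta_int n \<eta> a z =
    K * ee (of_nat n * z / 2 + of_int a * z + of_int a ^ 2 * \<eta> / (2 * of_nat n) + of_int a / (2 * of_nat n))
      * sg n \<eta> (of_nat n * z + of_int a * \<eta>)" by (rule theta_int_sg[OF n eta], rule that)
  show ?thesis unfolding K[abs_def] using n by (intro holomorphic_intros holomorphic_on_sg[OF n eta]) auto
qed

lemma theta_int_nonzero: "theta_int n \<eta> a z = 0 \<longleftrightarrow> of_nat n * z + of_int a * \<eta> \<in> period_lattice (of_nat n * \<eta>)"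
  using theta_int_sg[OF n eta] sg_eq_0_iff[OF n eta] by (metis ee_nonzero mult_eq_0_iff)

lemma theta_int_nz: "of_nat n * z \<notin> period_lattice \<eta> \<Longrightarrow> theta_int n \<eta> a z \<noteq> 0"
  using period_lattice_subset[of "of_nat n * z + of_int a * \<eta>" n \<eta>]
  by (auto simp: theta_int_nonzero lattice_add_int_eta_iff)

lemma theta_int_zero_nz: "a mod int n \<noteq> 0 \<Longrightarrow> theta_int n \<eta> a 0 \<noteq> 0"
  by (simp add: theta_int_nonzero int_eta_lattice_iff[OF n eta])

lemma theta_all_nz: "of_nat n * Z \<notin> period_lattice \<eta> \<Longrightarrow> theta_all n \<eta> Z \<noteq> 0"
  unfolding theta_all_def using theta_int_nz by auto

text \<open>Under \<open>X + \<eta>\<close> each of the n factors contributes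
  \<open>ee (- X / n)\<close>, while the indices move up by one and close up modulo n. So the
  product has degree one in \<open>X\<close>, and the determinant will see its power n^2.\<close>

lemma theta_all_shift:
  obtains c1 c2 where "c1 \<noteq> 0" "c2 \<noteq> 0" "\<And>X. theta_all n \<eta> ((X + 1) / of_nat n) = c1 * theta_all n \<eta> (X / of_nat n)"
    "\<And>X. theta_all n \<eta> ((X + \<eta>) / of_nat n) = c2 * ee (- X) * theta_all n \<eta> (X / of_nat n)"
proof -
  obtain K where K0: "K \<noteq> 0" and K: "\<And>a z. theta_int n \<eta> a z =
    K * ee (of_nat n * z / 2 + of_int a * z + of_int a ^ 2 * \<eta> / (2 * of_nat n) + of_int a / (2 * of_nat n))
      * sg n \<eta> (of_nat n * z + of_int a * \<eta>)" by (rule theta_int_sg[OF n eta], rule that)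
  have 1: "theta_int n \<eta> a ((X + 1) / of_nat n) = ee (of_int a / of_nat n) * theta_int n \<eta> a (X / of_nat n)" for a X
  proof -
    have s: "of_nat n * ((X + 1) / of_nat n) + of_int a * \<eta> = (of_nat n * (X / of_nat n) + of_int a * \<eta>) + 1" using n by simp
    have e: "ee (of_nat n * ((X + 1) / of_nat n) / 2 + of_int a * ((X + 1) / of_nat n) + of_int a ^ 2 * \<eta> / (2 * of_nat n) + of_int a / (2 * of_nat n))
      = ee (of_int a / of_nat n) * ee (of_nat n * (X / of_nat n) / 2 + of_int a * (X / of_nat n) + of_int a ^ 2 * \<eta> / (2 * of_nat n) + of_int a / (2 * of_nat n)) * ee (1/2)"
      unfolding ee_add[symmetric] using n by (intro arg_cong[of _ _ ee]) (simp add: field_simps)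
    show ?thesis unfolding K e s sg_add_1[OF n eta] by simp
  qed
  define w where "w = ee (\<eta> / 2 - \<eta> / (2 * of_nat n) - 1 / (2 * of_nat n))"
  have 2: "theta_int n \<eta> a ((X + \<eta>) / of_nat n) = (w * ee (- X / of_nat n)) * theta_int n \<eta> (a + 1) (X / of_nat n)" for a X
  proof -
    have s: "of_nat n * ((X + \<eta>) / of_nat n) + of_int a * \<eta> = of_nat n * (X / of_nat n) + of_int (a + 1) * \<eta>"
    proof -
      have "of_nat n * ((X + \<eta>) / of_nat n) = X + \<eta>" "of_nat n * (X / of_nat n) = X" using n by simp_all
      thus ?thesis by (simp only:) (simp add: algebra_simps)
    qed
    have e: "ee (of_nat n * ((X + \<eta>) / of_nat n) / 2 + of_int a * ((X + \<eta>) / of_nat n) + of_int a ^ 2 * \<eta> / (2 * of_nat n) + of_int a / (2 * of_nat n))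
      = w * ee (- X / of_nat n) * ee (of_nat n * (X / of_nat n) / 2 + of_int (a + 1) * (X / of_nat n) + of_int (a + 1) ^ 2 * \<eta> / (2 * of_nat n) + of_int (a + 1) / (2 * of_nat n))"
      unfolding w_def ee_add[symmetric] using n by (intro arg_cong[of _ _ ee]) (simp add: field_simps power2_eq_square)
    show ?thesis unfolding K e s by simp
  qed
  have A: "theta_all n \<eta> ((X + 1) / of_nat n) = (\<Prod>\<alpha>\<in>{0..<int n}. ee (of_int \<alpha> / of_nat n)) * theta_all n \<eta> (X / of_nat n)" for X
    unfolding theta_all_def 1 prod.distrib ..
  have B: "theta_all n \<eta> ((X + \<eta>) / of_nat n) = w ^ n * ee (- X) * theta_all n \<eta> (X / of_nat n)" for X
  proof -
    have "(\<Prod>\<alpha>\<in>{0..<int n}. theta_int n \<eta> (\<alpha> + 1) (X / of_nat n)) = (\<Prod>\<alpha>\<in>(\<lambda>\<alpha>. \<alpha> + 1) ` {0..<int n}. theta_int n \<eta> \<alpha> (X / of_nat n))"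
      by (subst prod.reindex) (auto simp: inj_on_def)
    also have "(\<lambda>\<alpha>. \<alpha> + 1) ` {0..<int n} = insert (int n) ({0..<int n} - {0})"
    proof -
      have "(\<lambda>\<alpha>. \<alpha> + 1) ` {0..<int n} = {1..<int n + 1}" using image_add_int_atLeastLessThan[of 1 "int n + 1"]
        by (simp add: add.commute image_add_atLeastLessThan[symmetric] image_iff)
      thus ?thesis using n by auto
    qed
    also have "(\<Prod>\<alpha>\<in>insert (int n) ({0..<int n} - {0}). theta_int n \<eta> \<alpha> (X / of_nat n)) = theta_int n \<eta> (int n) (X / of_nat n) * (\<Prod>\<alpha>\<in>{0..<int n} - {0}. theta_int n \<eta> \<alpha> (X / of_nat n))"
      by (subst prod.insert) auto
    also have "theta_int n \<eta> (int n) (X / of_nat n) = theta_int n \<eta> 0 (X / of_nat n)"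
      by (rule theta_int_cong[OF n eta]) simp
    also have "theta_int n \<eta> 0 (X / of_nat n) * (\<Prod>\<alpha>\<in>{0..<int n} - {0}. theta_int n \<eta> \<alpha> (X / of_nat n)) = theta_all n \<eta> (X / of_nat n)"
      unfolding theta_all_def using n by (subst prod.remove[of "{0..<int n}" 0]) auto
    finally have p: "(\<Prod>\<alpha>\<in>{0..<int n}. theta_int n \<eta> (\<alpha> + 1) (X / of_nat n)) = theta_all n \<eta> (X / of_nat n)" .
    have "ee (- X / of_nat n) ^ n = ee (- X)" unfolding ee_of_nat_mult[symmetric] using n by simp
    thus ?thesis unfolding theta_all_def[of n \<eta> "(X + \<eta>) / of_nat n"] 2 prod.distrib p by (simp add: power_mult_distrib)
  qed
  show thesis by (rule that[OF _ _ A B]) (auto simp: w_def)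
qed

lemma R_coef_theta:
  "R_coef n k \<eta> \<tau> z i j ((j - a) mod int n) =
     (\<Prod>\<alpha>\<in>{0..<int n} - {(a - i) mod int n}. theta_int n \<eta> \<alpha> (- z)) / (\<Prod>\<alpha>\<in>{1..<int n}. theta_int n \<eta> \<alpha> 0)
     * theta_int n \<eta> ((a - i) + int k * (j - a)) (- z + \<tau>) / theta_int n \<eta> (int k * (j - a)) \<tau>"
proof -
  let ?r = "(j - a) mod int n"
  have r: "?r mod int n = (j - a) mod int n" by simp
  have "(j - i - ?r) mod int n = (j - i - (j - a)) mod int n" by (rule mod_diff_cong[OF refl r])
  hence 1: "(j - i - ?r) mod int n = (a - i) mod int n" by simp
  have "(j - i + ?r * (int k - 1)) mod int n = (j - i + (j - a) * (int k - 1)) mod int n"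
    by (rule mod_add_cong[OF refl mod_mult_cong[OF r refl]])
  hence 2: "(j - i + ?r * (int k - 1)) mod int n = ((a - i) + int k * (j - a)) mod int n" by (simp add: algebra_simps)
  have 3: "(int k * ?r) mod int n = (int k * (j - a)) mod int n" by (rule mod_mult_cong[OF refl r])
  show ?thesis unfolding R_coef_def theta_idx_eq[OF n eta] 1
      theta_int_cong[OF n eta 2] theta_int_cong[OF n eta 3] ..
qed

lemma R_mat_index:
  assumes "p < n * n" "q < n * n"
  shows "R_mat n k \<eta> \<tau> z $$ (p, q) = (if (int (p div n) + int (p mod n)) mod int n = (int (q div n) + int (q mod n)) mod int n
    then R_coef n k \<eta> \<tau> z (int (q div n)) (int (q mod n)) ((int (q mod n) - int (p div n)) mod int n) else 0)"
  using assms unfolding R_mat_def by (simp add: Let_def)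

text \<open>Off the lattice the omitted factor of the product can be restored and divided by, which
  turns each coefficient into a value of \<open>Phi\<close> with one scalar common to all
  entries.\<close>

lemma R_mat_Phi_mat:
  obtains K where "K \<noteq> 0" "\<And>\<tau> z. of_nat n * \<tau> \<notin> period_lattice \<eta> \<Longrightarrow> of_nat n * z \<notin> period_lattice \<eta> \<Longrightarrow>
    R_mat n k \<eta> \<tau> z = (K * theta_all n \<eta> (- z)) \<cdot>\<^sub>m Phi_mat n k \<eta> (- (of_nat n * z)) (of_nat n * \<tau>)"
proof -
  obtain K where K: "K \<noteq> 0" "\<And>a b Z W. theta_int n \<eta> (a + b) (Z + W) / (theta_int n \<eta> a Z * theta_int n \<eta> b W)
    = K * Phi n \<eta> a b (of_nat n * Z) (of_nat n * W)" by (rule Phi_theta[OF n eta], rule that)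
  define D where "D = (\<Prod>\<alpha>\<in>{1..<int n}. theta_int n \<eta> \<alpha> 0)"
  have D: "D \<noteq> 0" unfolding D_def using theta_int_zero_nz by auto
  have "R_mat n k \<eta> \<tau> z = (K / D * theta_all n \<eta> (- z)) \<cdot>\<^sub>m Phi_mat n k \<eta> (- (of_nat n * z)) (of_nat n * \<tau>)"
    if \<tau>: "of_nat n * \<tau> \<notin> period_lattice \<eta>" and z: "of_nat n * z \<notin> period_lattice \<eta>" for \<tau> z
  proof (rule eq_matI)
    fix p q assume "p < dim_row ((K / D * theta_all n \<eta> (- z)) \<cdot>\<^sub>m Phi_mat n k \<eta> (- (of_nat n * z)) (of_nat n * \<tau>))"
      "q < dim_col ((K / D * theta_all n \<eta> (- z)) \<cdot>\<^sub>m Phi_mat n k \<eta> (- (of_nat n * z)) (of_nat n * \<tau>))"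
    hence pq: "p < n * n" "q < n * n" by (auto simp: Phi_mat_def)
    have c: "R_coef n k \<eta> \<tau> z i j ((j - a) mod int n) = K / D * theta_all n \<eta> (- z) * Phi n \<eta> (a - i) (int k * (j - a)) (- (of_nat n * z)) (of_nat n * \<tau>)" for a i j
    proof -
      have nz: "theta_int n \<eta> (a - i) (- z) \<noteq> 0" using z by (intro theta_int_nz) simp
      have "theta_all n \<eta> (- z) = theta_int n \<eta> ((a - i) mod int n) (- z) * (\<Prod>\<alpha>\<in>{0..<int n} - {(a - i) mod int n}. theta_int n \<eta> \<alpha> (- z))"
        unfolding theta_all_def using n by (intro prod.remove) auto
      also have "theta_int n \<eta> ((a - i) mod int n) (- z) = theta_int n \<eta> (a - i) (- z)" by (rule theta_int_cong[OF n eta]) simp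
      finally have "(\<Prod>\<alpha>\<in>{0..<int n} - {(a - i) mod int n}. theta_int n \<eta> \<alpha> (- z)) = theta_all n \<eta> (- z) / theta_int n \<eta> (a - i) (- z)"
        using nz by simp
      hence "R_coef n k \<eta> \<tau> z i j ((j - a) mod int n) = theta_all n \<eta> (- z) / D *
          (theta_int n \<eta> ((a - i) + int k * (j - a)) (- z + \<tau>) / (theta_int n \<eta> (a - i) (- z) * theta_int n \<eta> (int k * (j - a)) \<tau>))"
        unfolding R_coef_theta D_def[symmetric] by (simp add: divide_inverse mult_ac)
      thus ?thesis unfolding K(2) by simp
    qed
    show "R_mat n k \<eta> \<tau> z $$ (p, q) = ((K / D * theta_all n \<eta> (- z)) \<cdot>\<^sub>m Phi_mat n k \<eta> (- (of_nat n * z)) (of_nat n * \<tau>)) $$ (p, q)"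
      using pq by (simp add: R_mat_index c Phi_mat_index) (simp add: Phi_mat_def)
  qed (auto simp: Phi_mat_def R_mat_def)
  thus thesis using that[of "K / D"] K(1) D by auto
qed

text \<open>Unless a = i, the product contains the theta function of index 0 at 0, which vanishes;
  if a = i, the two theta values at \<open>\<tau>\<close> cancel. This point shows that the
  determinant is not identically zero.\<close>

lemma R_mat_zero:
  assumes \<tau>: "of_nat n * \<tau> \<notin> period_lattice \<eta>"
  shows "R_mat n k \<eta> \<tau> 0 = 1\<^sub>m (n * n)"
proof (rule eq_matI)
  fix p q assume "p < dim_row (1\<^sub>m (n * n) :: complex mat)" "q < dim_col (1\<^sub>m (n * n) :: complex mat)"
  hence pq: "p < n * n" "q < n * n" by auto
  define a b i j where "a = int (p div n)" and "b = int (p mod n)" and "i = int (q div n)" and "j = int (q mod n)"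
  have bounds: "a < int n" "i < int n" "0 \<le> a" "0 \<le> i" "b < int n" "j < int n" "0 \<le> b" "0 \<le> j"
    unfolding a_def b_def i_def j_def using n div_less_n[OF n] pq by auto
  have pq_iff: "p = q \<longleftrightarrow> a = i \<and> b = j"
    unfolding a_def b_def i_def j_def by (metis div_mult_mod_eq of_nat_eq_iff)
  show "R_mat n k \<eta> \<tau> 0 $$ (p, q) = 1\<^sub>m (n * n) $$ (p, q)"
  proof (cases "a = i")
    case True
    have jb: "(a + b) mod int n = (i + j) mod int n \<longleftrightarrow> b = j"
    proof
      assume "(a + b) mod int n = (i + j) mod int n"
      hence "(a + b - a) mod int n = (i + j - a) mod int n" by (rule mod_diff_cong) simp
      thus "b = j" using True bounds by simp
    qed (use True in simp)
    have D: "(\<Prod>\<alpha>\<in>{1..<int n}. theta_int n \<eta> \<alpha> 0) \<noteq> 0" using theta_int_zero_nz by auto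
    have s: "{0..<int n} - {0} = {1..<int n}" by auto
    have "R_coef n k \<eta> \<tau> 0 i j ((j - a) mod int n) = 1"
      unfolding R_coef_theta using True D theta_int_nz[OF \<tau>] by (simp add: s)
    thus ?thesis using pq jb True by (simp add: R_mat_index pq_iff flip: a_def b_def i_def j_def)
  next
    case False
    hence ne: "(a - i) mod int n \<noteq> 0" using bounds
      by (metis diff_self mod_eq_dvd_iff mod_pos_pos_trivial dvd_eq_mod_eq_0)
    have "(\<Prod>\<alpha>\<in>{0..<int n} - {(a - i) mod int n}. theta_int n \<eta> \<alpha> (- 0)) = 0"
      by (rule prod_zero) (use ne n in \<open>auto intro!: bexI[of _ 0] simp: theta_int_nonzero\<close>)
    hence "R_coef n k \<eta> \<tau> 0 i j ((j - a) mod int n) = 0" unfolding R_coef_theta by simp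
    thus ?thesis using pq False by (simp add: R_mat_index pq_iff flip: a_def b_def i_def j_def)
  qed
qed (auto simp: R_mat_def)

lemma R_mat_entire:
  assumes "p < n * n" "q < n * n"
  shows "(\<lambda>z. R_mat n k \<eta> \<tau> z $$ (p, q)) holomorphic_on UNIV"
proof -
  have t: "(\<lambda>z. theta_int n \<eta> a (f z)) holomorphic_on UNIV" if "f holomorphic_on UNIV" for a f
    using holomorphic_on_compose_gen[OF that theta_int_entire] by (simp add: o_def)
  have "(\<lambda>z. R_coef n k \<eta> \<tau> z i j ((j - a) mod int n)) holomorphic_on UNIV" for i j a
    unfolding R_coef_theta divide_inverse by (intro holomorphic_intros t)
  moreover have "(\<lambda>z. if C then f z else 0) holomorphic_on UNIV" if "f holomorphic_on UNIV" for C and f :: "complex \<Rightarrow> complex"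
    using that by (cases C) simp_all
  ultimately show ?thesis unfolding R_mat_index[OF assms] by blast
qed

lemma R_mat_smult_kernel_dim:
  assumes "of_nat n * \<tau> \<notin> period_lattice \<eta>" "of_nat n * z \<notin> period_lattice \<eta>"
  shows "kernel_dim (R_mat n k \<eta> \<tau> z) = kernel_dim (Phi_mat n k \<eta> (- (of_nat n * z)) (of_nat n * \<tau>))"
proof -
  obtain K where K: "K \<noteq> 0" "\<And>\<tau> z. of_nat n * \<tau> \<notin> period_lattice \<eta> \<Longrightarrow> of_nat n * z \<notin> period_lattice \<eta> \<Longrightarrow>
    R_mat n k \<eta> \<tau> z = (K * theta_all n \<eta> (- z)) \<cdot>\<^sub>m Phi_mat n k \<eta> (- (of_nat n * z)) (of_nat n * \<tau>)"
    by (rule R_mat_Phi_mat, rule that)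
  have nz: "K * theta_all n \<eta> (- z) \<noteq> 0" using K(1) theta_all_nz[of "- z"] assms(2) by simp
  show ?thesis unfolding K(2)[OF assms]
    by (rule kernel_dim_monomial[OF _ _ bij_betw_id bij_betw_id, of _ "n * n" _ "\<lambda>_. K * theta_all n \<eta> (- z)" "\<lambda>_. 1"])
       (use nz in \<open>auto simp: Phi_mat_def\<close>)
qed

lemma R_mat_unitarity:
  assumes \<tau>: "of_nat n * \<tau> \<notin> period_lattice \<eta>" and z: "of_nat n * z \<notin> period_lattice \<eta>"
    and z\<tau>: "of_nat n * (z - \<tau>) \<in> period_lattice \<eta> \<or> of_nat n * (z + \<tau>) \<in> period_lattice \<eta>"
  shows "R_mat n k \<eta> \<tau> z * R_mat n k \<eta> \<tau> (- z) = 0\<^sub>m (n * n) (n * n)"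
proof -
  obtain K where K: "K \<noteq> 0" "\<And>\<tau> z. of_nat n * \<tau> \<notin> period_lattice \<eta> \<Longrightarrow> of_nat n * z \<notin> period_lattice \<eta> \<Longrightarrow>
    R_mat n k \<eta> \<tau> z = (K * theta_all n \<eta> (- z)) \<cdot>\<^sub>m Phi_mat n k \<eta> (- (of_nat n * z)) (of_nat n * \<tau>)"
    by (rule R_mat_Phi_mat, rule that)
  have z': "of_nat n * (- z) \<notin> period_lattice \<eta>" using z by simp
  let ?X = "- (of_nat n * z)" and ?Y = "of_nat n * \<tau>"
  have "?X + ?Y = - (of_nat n * (z - \<tau>))" "?X - ?Y = - (of_nat n * (z + \<tau>))" by (simp_all add: algebra_simps)
  hence "?X + ?Y \<in> period_lattice \<eta> \<or> ?X - ?Y \<in> period_lattice \<eta>" using z\<tau> by simp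
  hence u: "Phi_mat n k \<eta> ?X ?Y * Phi_mat n k \<eta> (- ?X) ?Y = 0\<^sub>m (n * n) (n * n)"
    using z \<tau> by (intro Phi_mat_unitarity) auto
  have X: "- (of_nat n * (- z)) = - ?X" by simp
  let ?A = "Phi_mat n k \<eta> ?X ?Y" and ?B = "Phi_mat n k \<eta> (- ?X) ?Y"
  have "(c \<cdot>\<^sub>m ?A) * (d \<cdot>\<^sub>m ?B) = 0\<^sub>m (n * n) (n * n)" for c d
  proof -
    have "(c \<cdot>\<^sub>m ?A) * (d \<cdot>\<^sub>m ?B) = c \<cdot>\<^sub>m (?A * (d \<cdot>\<^sub>m ?B))"
      by (rule mult_smult_assoc_mat[OF Phi_mat_carrier smult_carrier_mat[OF Phi_mat_carrier]])
    also have "?A * (d \<cdot>\<^sub>m ?B) = d \<cdot>\<^sub>m (?A * ?B)"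
      by (rule mult_smult_distrib[OF Phi_mat_carrier Phi_mat_carrier])
    finally show ?thesis unfolding u by (auto intro!: eq_matI)
  qed
  thus ?thesis unfolding K(2)[OF \<tau> z] K(2)[OF \<tau> z'] X by blast
qed

end

subsection \<open>The zeros of the determinant\<close>

lemma kernel_dim_smult:
  fixes A :: "'a::field mat"
  assumes A: "A \<in> carrier_mat m m" and c: "c \<noteq> 0"
  shows "kernel_dim (c \<cdot>\<^sub>m A) = kernel_dim A"
  by (rule kernel_dim_monomial[OF A _ bij_betw_id bij_betw_id, of _ "\<lambda>_. c" "\<lambda>_. 1"]) (use A c in auto)

lemma kernel_dim_0:
  fixes A :: "'a::field mat"
  assumes A: "A \<in> carrier_mat m m" and d: "det A \<noteq> 0"
  shows "kernel_dim A = 0"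
proof -
  have "kernel_dim A \<le> card ({} :: nat set)"
  proof (rule kernel_dim_le[OF A])
    fix v assume "kernel_fun m A v"
    thus "\<forall>j<m. v j = 0" using d det_zero_iff_kernel_fun[OF A] by blast
  qed auto
  thus ?thesis by simp
qed

lemma notin_lattice_of_double: "2 * Y \<notin> period_lattice \<eta> \<Longrightarrow> Y \<notin> period_lattice \<eta>"
  using lattice_add[of Y \<eta> Y] by (metis mult_2)

lemma sum_lessThan_choose: "(\<Sum>b<n. b) = n choose 2"
  by (induction n) (simp_all add: numeral_2_eq_2)

lemma choose_sum_square: "(n choose 2) + (n + 1 choose 2) = n * n"
  by (induction n) (simp_all add: numeral_2_eq_2)

lemma card_upper_pairs:
  "card {p. p < n * n \<and> p div n < p mod n} \<le> n choose 2"
  "card {p. p < n * n \<and> p div n \<le> p mod n} \<le> (n + 1) choose 2"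
proof -
  have "{p. p < n * n \<and> p div n < p mod n} \<subseteq> (\<lambda>(b, a). a * n + b) ` (SIGMA b:{..<n}. {..<b})"
  proof
    fix p assume p: "p \<in> {p. p < n * n \<and> p div n < p mod n}"
    hence "n > 0" by (cases n) auto
    thus "p \<in> (\<lambda>(b, a). a * n + b) ` (SIGMA b:{..<n}. {..<b})"
      using p by (intro image_eqI[of _ _ "(p mod n, p div n)"]) auto
  qed
  from card_mono[OF _ this] have "card {p. p < n * n \<and> p div n < p mod n} \<le> card ((\<lambda>(b, a). a * n + b) ` (SIGMA b:{..<n}. {..<b}))" by simp
  also have "\<dots> \<le> card (SIGMA b:{..<n}. {..<b})" by (rule card_image_le) simp
  also have "\<dots> = n choose 2" by (simp add: sum_lessThan_choose)
  finally show "card {p. p < n * n \<and> p div n < p mod n} \<le> n choose 2" .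
  have "{p. p < n * n \<and> p div n \<le> p mod n} \<subseteq> (\<lambda>(b, a). a * n + b) ` (SIGMA b:{..<n}. {..b})"
  proof
    fix p assume p: "p \<in> {p. p < n * n \<and> p div n \<le> p mod n}"
    hence "n > 0" by (cases n) auto
    thus "p \<in> (\<lambda>(b, a). a * n + b) ` (SIGMA b:{..<n}. {..b})"
      using p by (intro image_eqI[of _ _ "(p mod n, p div n)"]) auto
  qed
  from card_mono[OF _ this] have "card {p. p < n * n \<and> p div n \<le> p mod n} \<le> card ((\<lambda>(b, a). a * n + b) ` (SIGMA b:{..<n}. {..b}))" by simp
  also have "\<dots> \<le> card (SIGMA b:{..<n}. {..b})" by (rule card_image_le) simp
  also have "\<dots> = (\<Sum>b<n. b + 1)" by simp
  also have "\<dots> = (\<Sum>b<n. b) + n" by (subst sum.distrib) simp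
  also have "\<dots> = (n + 1) choose 2" using sum_lessThan_choose[of "n + 1"] by simp
  finally show "card {p. p < n * n \<and> p div n \<le> p mod n} \<le> (n + 1) choose 2" .
qed

text \<open>The limit of \<open>sg n \<eta> Y\<close> times \<open>Phi_mat n k \<eta> (\<sigma> * Y) Y\<close> as \<open>Y\<close> tends to 0:
  \<open>\<sigma>\<close> plus the flip of the two tensor factors.\<close>
definition flip_mat :: "nat \<Rightarrow> complex \<Rightarrow> complex mat" where
  "flip_mat n \<sigma> = mat (n * n) (n * n) (\<lambda>(p, q). (if q = p then \<sigma> else 0) + (if q = (p mod n) * n + p div n then 1 else 0))"

lemma flip_mat_carrier: "flip_mat n \<sigma> \<in> carrier_mat (n * n) (n * n)"
  unfolding flip_mat_def by simp

section \<open>Nullities of the flip plus or minus the identity\<close>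

lemma kernel_fun_flip_mat:
  assumes "n > 0" "kernel_fun (n * n) (flip_mat n \<sigma>) v" "p < n * n"
  shows "\<sigma> * v p + v ((p mod n) * n + p div n) = 0"
proof -
  let ?q = "(p mod n) * n + p div n"
  have q: "?q < n * n" using assms by (intro code_less) (auto simp: less_mult_imp_div_less)
  have "(\<Sum>q<n * n. flip_mat n \<sigma> $$ (p, q) * v q) = (\<Sum>q<n * n. (if q = p then \<sigma> * v q else 0) + (if q = ?q then v q else 0))"
    using assms by (intro sum.cong) (auto simp: flip_mat_def algebra_simps)
  also have "\<dots> = \<sigma> * v p + v ?q" unfolding sum.distrib using assms(3) q by (simp add: sum.delta)
  finally show ?thesis using kernel_fun_index[OF assms(2,3)] by simp
qed

text \<open>Kernel elements are antisymmetric tensors for sign 1 and symmetric ones for sign -1,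
  determined by the coordinates strictly or weakly above the diagonal. Upper bounds suffice because
  they add up to n^2, like the nullities they are compared with.\<close>

lemma kernel_dim_flip_mat:
  assumes n: "n > 0"
  shows "kernel_dim (flip_mat n 1) \<le> n choose 2" "kernel_dim (flip_mat n (- 1)) \<le> (n + 1) choose 2"
proof -
  note c = flip_mat_carrier
  have sw: "(p mod n) * n + p div n < n * n \<and> ((p mod n) * n + p div n) div n = p mod n \<and> ((p mod n) * n + p div n) mod n = p div n"
    if "p < n * n" for p
    using that n code_less[of "p mod n" n "p div n"] by (auto simp: less_mult_imp_div_less)
  have "kernel_dim (flip_mat n 1) \<le> card {p. p < n * n \<and> p div n < p mod n}"
  proof (rule kernel_dim_le[OF c])
    fix v assume v: "kernel_fun (n * n) (flip_mat n 1) v" "\<And>s. s \<in> {p. p < n * n \<and> p div n < p mod n} \<Longrightarrow> v s = 0"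
    show "\<forall>p<n * n. v p = 0"
    proof (intro allI impI)
      fix p assume p: "p < n * n"
      note e = kernel_fun_flip_mat[OF n v(1) p]
      consider "p div n < p mod n" | "p div n = p mod n" | "p mod n < p div n" by linarith
      thus "v p = 0"
      proof cases
        case 1
        thus ?thesis using v(2) p by simp
      next
        case 2
        have "(p mod n) * n + p div n = p" using 2 by (metis div_mult_mod_eq)
        thus ?thesis using e by simp
      next
        case 3
        hence "v ((p mod n) * n + p div n) = 0" using v(2) sw[OF p] by simp
        thus ?thesis using e by simp
      qed
    qed
  qed auto
  thus "kernel_dim (flip_mat n 1) \<le> n choose 2" using card_upper_pairs(1)[of n] by linarith
  have "kernel_dim (flip_mat n (- 1)) \<le> card {p. p < n * n \<and> p div n \<le> p mod n}"
  proof (rule kernel_dim_le[OF c])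
    fix v assume v: "kernel_fun (n * n) (flip_mat n (- 1)) v" "\<And>s. s \<in> {p. p < n * n \<and> p div n \<le> p mod n} \<Longrightarrow> v s = 0"
    show "\<forall>p<n * n. v p = 0"
    proof (intro allI impI)
      fix p assume p: "p < n * n"
      note e = kernel_fun_flip_mat[OF n v(1) p]
      show "v p = 0"
      proof (cases "p div n \<le> p mod n")
        case True
        thus ?thesis using v(2) p by simp
      next
        case False
        hence "v ((p mod n) * n + p div n) = 0" using v(2) sw[OF p] by simp
        thus ?thesis using e by simp
      qed
    qed
  qed auto
  thus "kernel_dim (flip_mat n (- 1)) \<le> (n + 1) choose 2" using card_upper_pairs(2)[of n] by linarith
qed

context
  fixes n k :: nat and \<eta> :: complex
  assumes n: "n > 0" and eta: "Im \<eta> > 0" and cop: "coprime n k"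
begin

text \<open>The exponents remain unevaluated nullities, since their sum is needed before the
  individual values can be found. The assumption on \<open>2 * (n * \<tau>)\<close> keeps
  \<open>Y\<close> and \<open>- Y\<close> apart modulo the lattice.\<close>

lemma det_R_mat_factorization:
  assumes Y2: "2 * (of_nat n * \<tau>) \<notin> period_lattice \<eta>"
  defines "Y \<equiv> of_nat n * \<tau>"
  defines "a \<equiv> kernel_dim (Phi_mat n k \<eta> Y Y)" and "b \<equiv> kernel_dim (Phi_mat n k \<eta> (- Y) Y)"
  shows "a + b = n * n \<and> (\<exists>K l. K \<noteq> 0 \<and> (\<forall>X. det (R_mat n k \<eta> \<tau> (- (X / of_nat n))) =
      K * exp (l * X) * tht \<eta> (X - Y) ^ a * tht \<eta> (X - (- Y)) ^ b))"
proof -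
  have Y: "Y \<notin> period_lattice \<eta>" using Y2 unfolding Y_def by (rule notin_lattice_of_double)
  hence \<tau>: "of_nat n * \<tau> \<notin> period_lattice \<eta>" by (simp add: Y_def)
  define Rt where "Rt X = R_mat n k \<eta> \<tau> (- (X / of_nat n))" for X
  define F where "F X = det (Rt X)" for X
  have Rtc: "Rt X \<in> carrier_mat (n * n) (n * n)" for X unfolding Rt_def by simp
  have ent: "(\<lambda>X. Rt X $$ (p, q)) holomorphic_on UNIV" if "p < n * n" "q < n * n" for p q
  proof -
    have "(\<lambda>X. - (X / of_nat n) :: complex) holomorphic_on UNIV" using n by (intro holomorphic_intros) auto
    from holomorphic_on_compose_gen[OF this R_mat_entire[OF n eta cop that]] show ?thesis
      unfolding Rt_def by (simp add: o_def)
  qed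
  have hol: "F holomorphic_on UNIV" unfolding F_def[abs_def] by (rule det_holomorphic[OF Rtc ent])
  obtain Kc where Kc: "Kc \<noteq> 0" "\<And>\<tau> z. of_nat n * \<tau> \<notin> period_lattice \<eta> \<Longrightarrow> of_nat n * z \<notin> period_lattice \<eta> \<Longrightarrow>
    R_mat n k \<eta> \<tau> z = (Kc * theta_all n \<eta> (- z)) \<cdot>\<^sub>m Phi_mat n k \<eta> (- (of_nat n * z)) (of_nat n * \<tau>)"
    by (rule R_mat_Phi_mat[OF n eta cop], rule that)
  obtain c1 c2 where c: "c1 \<noteq> 0" "c2 \<noteq> 0" "\<And>X. theta_all n \<eta> ((X + 1) / of_nat n) = c1 * theta_all n \<eta> (X / of_nat n)"
    "\<And>X. theta_all n \<eta> ((X + \<eta>) / of_nat n) = c2 * ee (- X) * theta_all n \<eta> (X / of_nat n)"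
    by (rule theta_all_shift[OF n eta cop], rule that)
  obtain C1 where C1: "C1 \<noteq> 0" "\<And>X. det (Phi_mat n k \<eta> (X + 1) Y) = C1 * det (Phi_mat n k \<eta> X Y)"
    by (rule det_Phi_mat_add_1[OF n eta cop], rule that)
  obtain C2 where C2: "C2 \<noteq> 0" "\<And>X. det (Phi_mat n k \<eta> (X + \<eta>) Y) = C2 * det (Phi_mat n k \<eta> X Y)"
    by (rule det_Phi_mat_add_eta[OF n eta cop], rule that)
  \<comment> \<open>A scalar enters the determinant with power \<open>n * n\<close>, which becomes
    the degree of \<open>F\<close>. The formula holds off the lattice; the multipliers derived from
    it extend by \<open>lattice_cancel\<close>.\<close>
  have F_eq: "F X = (Kc * theta_all n \<eta> (X / of_nat n)) ^ (n * n) * det (Phi_mat n k \<eta> X Y)"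
    if X: "X \<notin> period_lattice \<eta>" for X
  proof -
    have "of_nat n * (- (X / of_nat n)) = - X" using n by simp
    thus ?thesis unfolding F_def Rt_def using Kc(2)[OF \<tau>, of "- (X / of_nat n)"] X
      by (simp add: det_smult Phi_mat_def Y_def)
  qed
  have p1: "F (X + 1) = (c1 ^ (n * n) * C1) * F X" for X
  proof (rule lattice_cancel[OF eta, of "\<lambda>X. F (X + 1)" "\<lambda>X. (c1 ^ (n * n) * C1) * F X" 0])
    fix z assume "z - 0 \<notin> period_lattice \<eta>"
    hence z: "z \<notin> period_lattice \<eta>" "z + 1 \<notin> period_lattice \<eta>" by (simp_all add: lattice_add_iff)
    show "F (z + 1) = (c1 ^ (n * n) * C1) * F z" unfolding F_eq[OF z(1)] F_eq[OF z(2)] c(3) C1(2)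
      by (simp add: power_mult_distrib)
  qed (intro holomorphic_intros entire_shift hol)+
  have p2: "F (X + \<eta>) = (c2 ^ (n * n) * C2) * ee (- of_nat (n * n) * X) * F X" for X
  proof (rule lattice_cancel[OF eta, of "\<lambda>X. F (X + \<eta>)" "\<lambda>X. (c2 ^ (n * n) * C2) * ee (- of_nat (n * n) * X) * F X" 0])
    fix z assume "z - 0 \<notin> period_lattice \<eta>"
    hence z: "z \<notin> period_lattice \<eta>" "z + \<eta> \<notin> period_lattice \<eta>" by (simp_all add: lattice_add_iff)
    have "- of_nat (n * n) * z = of_nat (n * n) * (- z)" by simp
    hence e: "ee (- of_nat (n * n) * z) = ee (- z) ^ (n * n)" by (simp only: ee_of_nat_mult)
    show "F (z + \<eta>) = (c2 ^ (n * n) * C2) * ee (- of_nat (n * n) * z) * F z" unfolding F_eq[OF z(1)] F_eq[OF z(2)] c(4) C2(2) e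
      by (simp add: power_mult_distrib)
  qed (intro holomorphic_intros entire_shift hol)+
  have F0: "F 0 \<noteq> 0" unfolding F_def Rt_def using R_mat_zero[OF n eta cop \<tau>] by simp
  have kd: "kernel_dim (Rt X) = kernel_dim (Phi_mat n k \<eta> X Y)" if "X \<notin> period_lattice \<eta>" for X
    using R_mat_smult_kernel_dim[OF n eta cop \<tau>, of "- (X / of_nat n)"] n that by (simp add: Rt_def Y_def)
  have van: "vanishes_to_order F X (kernel_dim (Phi_mat n k \<eta> X Y))" if X: "X \<notin> period_lattice \<eta>" for X
  proof -
    obtain g where g: "g holomorphic_on UNIV" "\<And>z. det (Rt z) = (z - X) ^ kernel_dim (Rt X) * g z"
      using det_divisible_kernel_dim[OF Rtc ent] by blast
    show ?thesis unfolding kd[OF X, symmetric] by (rule vanishes_to_orderI[OF g(1)]) (simp add: F_def g(2))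
  qed
  have "Phi_mat n k \<eta> Y Y * Phi_mat n k \<eta> (- Y) Y = 0\<^sub>m (n * n) (n * n)"
    by (rule Phi_mat_unitarity[OF n eta cop Y Y]) simp
  hence "n * n \<le> a + b" unfolding a_def b_def by (rule kernel_dim_zero_product[OF Phi_mat_carrier Phi_mat_carrier])
  moreover have "- Y - Y \<notin> period_lattice \<eta>"
  proof -
    have "- Y - Y = - (2 * Y)" by simp
    thus ?thesis using Y2 unfolding Y_def by (simp only: lattice_uminus_iff not_False_eq_True)
  qed
  moreover have "vanishes_to_order F (- Y) b" unfolding b_def using van[of "- Y"] Y by simp
  moreover have "vanishes_to_order F Y a" unfolding a_def by (rule van[OF Y])
  moreover have "c1 ^ (n * n) * C1 \<noteq> 0" "c2 ^ (n * n) * C2 \<noteq> 0" using c C1 C2 by auto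
  ultimately have "a + b = n * n \<and> (\<exists>K l. K \<noteq> 0 \<and> (\<forall>z. F z = K * exp (l * z) * tht \<eta> (z - Y) ^ a * tht \<eta> (z - (- Y)) ^ b))"
    using two_point_factorization[OF eta hol _ p1 _ p2 F0, of Y a "- Y" b] by blast
  thus ?thesis unfolding F_def Rt_def .
qed

lemma kernel_dim_sum:
  assumes "2 * Y \<notin> period_lattice \<eta>"
  shows "kernel_dim (Phi_mat n k \<eta> Y Y) + kernel_dim (Phi_mat n k \<eta> (- Y) Y) = n * n"
  using det_R_mat_factorization[of "Y / of_nat n"] assms n by simp

lemma kernel_dim_semicontinuous:
  assumes Y0: "Y0 \<notin> period_lattice \<eta>" and \<sigma>: "\<sigma> = 1 \<or> \<sigma> = (- 1 :: complex)"
  shows "eventually (\<lambda>Y. kernel_dim (Phi_mat n k \<eta> (\<sigma> * Y) Y) \<le> kernel_dim (Phi_mat n k \<eta> (\<sigma> * Y0) Y0)) (at Y0)"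
proof (rule eventually_kernel_dim_le[OF Phi_mat_carrier Phi_mat_carrier])
  fix p q assume pq: "p < n * n" "q < n * n"
  have \<sigma>Y: "\<sigma> * Y0 \<notin> period_lattice \<eta>" using \<sigma> Y0 by auto
  have "((\<lambda>Y. Phi n \<eta> c d (\<sigma> * Y) Y) \<longlongrightarrow> Phi n \<eta> c d (\<sigma> * Y0) Y0) (at Y0)" for c d
    by (rule tendsto_Phi[OF n eta]) (auto intro!: tendsto_intros sg_nonzero[OF n eta] \<sigma>Y Y0)
  thus "((\<lambda>Y. Phi_mat n k \<eta> (\<sigma> * Y) Y $$ (p, q)) \<longlongrightarrow> Phi_mat n k \<eta> (\<sigma> * Y0) Y0 $$ (p, q)) (at Y0)"
    using pq by (simp add: Phi_mat_index)
qed

text \<open>At \<open>Y = 0\<close> the two denominators vanish exactly for a = i and for a = j, and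
  \<open>sg n \<eta> Y\<close> compensates one zero. If both vanish, so does the numerator, which
  becomes \<open>sg n \<eta> ((\<sigma> + 1) * Y)\<close> and leaves (\<sigma> + 1)/\<sigma>. The
  stated form of the limits uses 1/\<sigma> = \<sigma>.\<close>

lemma sg_scaled_Phi_limit:
  fixes a i j :: int
  assumes \<sigma>: "\<sigma> = 1 \<or> \<sigma> = (- 1 :: complex)"
    and r: "0 \<le> a" "a < int n" "0 \<le> i" "i < int n" "0 \<le> j" "j < int n"
  shows "((\<lambda>Y. sg n \<eta> Y * Phi n \<eta> (a - i) (int k * (j - a)) (\<sigma> * Y) Y) \<longlongrightarrow> (if a = i then \<sigma> else 0) + (if a = j then 1 else 0)) (at 0)"
proof -
  have sg\<sigma>: "sg n \<eta> (\<sigma> * Y) = \<sigma> * sg n \<eta> Y" for Y using \<sigma> sg_uminus[OF n eta, of Y] by auto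
  have ai: "(a - i) mod int n = 0 \<longleftrightarrow> a = i"
  proof
    assume "(a - i) mod int n = 0"
    hence "a mod int n = i mod int n" by (simp add: mod_eq_dvd_iff dvd_eq_mod_eq_0)
    thus "a = i" using r by simp
  qed simp
  have aj: "(int k * (j - a)) mod int n = 0 \<longleftrightarrow> a = j"
  proof
    assume "(int k * (j - a)) mod int n = 0"
    hence "int n dvd int k * (j - a)" by (simp add: dvd_eq_mod_eq_0)
    hence "int n dvd j - a" using cop by (simp add: coprime_dvd_mult_right_iff)
    hence "j mod int n = a mod int n" by (simp add: mod_eq_dvd_iff)
    thus "a = j" using r by simp
  qed simp
  have nzY: "eventually (\<lambda>Y. sg n \<eta> Y \<noteq> 0) (at 0)"
    unfolding sg_eq_0_iff[OF n eta] by (rule lattice_isolated[OF neta[OF n eta]])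
  have \<sigma>0: "((\<lambda>Y. \<sigma> * Y) \<longlongrightarrow> 0) (at 0)" by (auto intro!: tendsto_eq_intros)
  consider "a \<noteq> i" "a \<noteq> j" | "a = i" "a \<noteq> j" | "a \<noteq> i" "a = j" | "a = i" "a = j" by blast
  thus ?thesis
  proof cases
    case 1
    have nz: "sg n \<eta> (0 + of_int (a - i) * \<eta>) \<noteq> 0" "sg n \<eta> (0 + of_int (int k * (j - a)) * \<eta>) \<noteq> 0"
      unfolding add_0_left sg_int_eta[OF n eta] ai aj using 1 by simp_all
    have "((\<lambda>Y. sg n \<eta> Y * Phi n \<eta> (a - i) (int k * (j - a)) (\<sigma> * Y) Y) \<longlongrightarrow> sg n \<eta> 0 * Phi n \<eta> (a - i) (int k * (j - a)) 0 0) (at 0)"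
      by (intro tendsto_mult tendsto_sg[OF n eta] tendsto_ident_at tendsto_Phi[OF n eta] \<sigma>0 nz)
    thus ?thesis using 1 sg_0[OF n eta] by simp
  next
    case 2
    let ?B = "int k * (j - a)"
    let ?f = "\<lambda>Y. ee (of_int ?B * (\<sigma> * Y) / of_nat n) * sg n \<eta> (\<sigma> * Y + Y + of_int ?B * \<eta>) / (\<sigma> * sg n \<eta> (Y + of_int ?B * \<eta>))"
    have nB: "sg n \<eta> (of_int ?B * \<eta>) \<noteq> 0" unfolding sg_int_eta[OF n eta] aj using 2 by simp
    have "(?f \<longlongrightarrow> ee (of_int ?B * 0 / of_nat n) * sg n \<eta> (0 + 0 + of_int ?B * \<eta>) / (\<sigma> * sg n \<eta> (0 + of_int ?B * \<eta>))) (at 0)"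
      by (intro tendsto_divide tendsto_mult tendsto_ee tendsto_sg[OF n eta] tendsto_add tendsto_const tendsto_ident_at \<sigma>0)
         (use nB \<sigma> n in auto)
    hence "(?f \<longlongrightarrow> \<sigma>) (at 0)" using nB \<sigma> by auto
    moreover have "eventually (\<lambda>Y. ?f Y = sg n \<eta> Y * Phi n \<eta> (a - i) ?B (\<sigma> * Y) Y) (at 0)"
      using nzY
    proof eventually_elim
      case (elim Y)
      have "Phi n \<eta> (a - i) ?B (\<sigma> * Y) Y = ee (of_int ?B * (\<sigma> * Y) / of_nat n) * sg n \<eta> (\<sigma> * Y + Y + of_int ?B * \<eta>) / (\<sigma> * sg n \<eta> Y * sg n \<eta> (Y + of_int ?B * \<eta>))"
        using 2(1) unfolding Phi_def by (simp add: sg\<sigma>)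
      thus ?case using elim by simp
    qed
    ultimately show ?thesis using 2 by (simp add: Lim_transform_eventually)
  next
    case 3
    let ?A = "a - i"
    let ?f = "\<lambda>Y. ee (of_int ?A * Y / of_nat n) * sg n \<eta> (\<sigma> * Y + Y + of_int ?A * \<eta>) / sg n \<eta> (\<sigma> * Y + of_int ?A * \<eta>)"
    have nA: "sg n \<eta> (of_int ?A * \<eta>) \<noteq> 0" unfolding sg_int_eta[OF n eta] ai using 3 by simp
    have "(?f \<longlongrightarrow> ee (of_int ?A * 0 / of_nat n) * sg n \<eta> (0 + 0 + of_int ?A * \<eta>) / sg n \<eta> (0 + of_int ?A * \<eta>)) (at 0)"
      by (intro tendsto_divide tendsto_mult tendsto_ee tendsto_sg[OF n eta] tendsto_add tendsto_const tendsto_ident_at \<sigma>0)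
         (use nA n in auto)
    hence "(?f \<longlongrightarrow> 1) (at 0)" using nA by simp
    moreover have "eventually (\<lambda>Y. ?f Y = sg n \<eta> Y * Phi n \<eta> (a - i) (int k * (j - a)) (\<sigma> * Y) Y) (at 0)"
      using nzY
    proof eventually_elim
      case (elim Y)
      have "Phi n \<eta> ?A (int k * (j - a)) (\<sigma> * Y) Y = ee (of_int ?A * Y / of_nat n) * sg n \<eta> (\<sigma> * Y + Y + of_int ?A * \<eta>) / (sg n \<eta> (\<sigma> * Y + of_int ?A * \<eta>) * sg n \<eta> Y)"
        using 3(2) unfolding Phi_def by simp
      thus ?case using elim by simp
    qed
    ultimately show ?thesis using 3 by (simp add: Lim_transform_eventually)
  next
    case 4
    obtain G where G: "G holomorphic_on UNIV" "G 0 \<noteq> 0" "\<And>x. sg n \<eta> x = x * G x" by (rule sg_local[OF n eta], rule that)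
    let ?f = "\<lambda>Y. (\<sigma> + 1) * G ((\<sigma> + 1) * Y) / (\<sigma> * G Y)"
    have "((\<lambda>Y. (\<sigma> + 1) * Y) \<longlongrightarrow> 0) (at 0)" by (auto intro!: tendsto_eq_intros)
    hence "((\<lambda>Y. G ((\<sigma> + 1) * Y)) \<longlongrightarrow> G 0) (at 0)"
      by (rule isCont_tendsto_compose[OF isCont_entire[OF G(1)]])
    moreover have "(G \<longlongrightarrow> G 0) (at 0)" using isCont_entire[OF G(1), of 0] by (simp add: isCont_def)
    ultimately have "(?f \<longlongrightarrow> (\<sigma> + 1) * G 0 / (\<sigma> * G 0)) (at 0)"
      using G(2) \<sigma> by (intro tendsto_divide tendsto_mult tendsto_const) auto
    hence "(?f \<longlongrightarrow> \<sigma> + 1) (at 0)" using G(2) \<sigma> by auto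
    moreover have "eventually (\<lambda>Y. ?f Y = sg n \<eta> Y * Phi n \<eta> (a - i) (int k * (j - a)) (\<sigma> * Y) Y) (at 0)"
      using nzY
    proof eventually_elim
      case (elim Y)
      hence Y: "Y \<noteq> 0" using G(3)[of Y] by auto
      have z: "a - i = 0" "int k * (j - a) = 0" using 4 by simp_all
      have s: "(\<sigma> + 1) * Y = \<sigma> * Y + Y" by (simp add: distrib_right)
      have "Phi n \<eta> (a - i) (int k * (j - a)) (\<sigma> * Y) Y = sg n \<eta> ((\<sigma> + 1) * Y) / (\<sigma> * sg n \<eta> Y * sg n \<eta> Y)"
        unfolding z s Phi_def by (simp add: sg\<sigma>)
      hence "sg n \<eta> Y * Phi n \<eta> (a - i) (int k * (j - a)) (\<sigma> * Y) Y = sg n \<eta> ((\<sigma> + 1) * Y) / (\<sigma> * sg n \<eta> Y)" using elim by simp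
      also have "\<dots> = ?f Y" unfolding G(3) using Y by simp
      finally show ?case by simp
    qed
    ultimately show ?thesis using 4 by (simp add: Lim_transform_eventually)
  qed
qed

text \<open>Multiplying by \<open>sg n \<eta> Y\<close> makes the entries converge without changing
  the nullity, as the factor is nonzero near 0. Under a + b = i + j, the conditions a = i and a = j
  of the limit say that the two pairs are equal or swapped.\<close>

lemma kernel_dim_near_0:
  assumes \<sigma>: "\<sigma> = 1 \<or> \<sigma> = (- 1 :: complex)"
  shows "eventually (\<lambda>Y. kernel_dim (Phi_mat n k \<eta> (\<sigma> * Y) Y) \<le> kernel_dim (flip_mat n \<sigma>)) (at 0)"
proof -
  have "eventually (\<lambda>Y. kernel_dim (sg n \<eta> Y \<cdot>\<^sub>m Phi_mat n k \<eta> (\<sigma> * Y) Y) \<le> kernel_dim (flip_mat n \<sigma>)) (at 0)"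
  proof (rule eventually_kernel_dim_le[OF flip_mat_carrier smult_carrier_mat[OF Phi_mat_carrier]])
    fix p q assume pq: "p < n * n" "q < n * n"
    define a b i j where "a = int (p div n)" and "b = int (p mod n)" and "i = int (q div n)" and "j = int (q mod n)"
    have bounds: "0 \<le> a" "a < int n" "0 \<le> i" "i < int n" "0 \<le> j" "j < int n" "0 \<le> b" "b < int n"
      unfolding a_def b_def i_def j_def using n div_less_n[OF n] pq by auto
    have e: "(sg n \<eta> Y \<cdot>\<^sub>m Phi_mat n k \<eta> (\<sigma> * Y) Y) $$ (p, q) =
       (if (a + b) mod int n = (i + j) mod int n then sg n \<eta> Y * Phi n \<eta> (a - i) (int k * (j - a)) (\<sigma> * Y) Y else 0)" for Y
      using pq by (simp add: Phi_mat_def a_def b_def i_def j_def)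
    have q1: "q = p \<longleftrightarrow> a = i \<and> b = j"
      unfolding a_def b_def i_def j_def by (metis div_mult_mod_eq of_nat_eq_iff)
    have q2: "q = (p mod n) * n + p div n \<longleftrightarrow> a = j \<and> b = i"
    proof -
      have "p div n < n" using div_less_n[OF n] pq by simp
      hence "((p mod n) * n + p div n) div n = p mod n" "((p mod n) * n + p div n) mod n = p div n" by auto
      thus ?thesis unfolding a_def b_def i_def j_def by (metis div_mult_mod_eq of_nat_eq_iff)
    qed
    have c1: "b = j" if "(a + b) mod int n = (i + j) mod int n" "a = i"
    proof -
      have "(a + b - a) mod int n = (i + j - a) mod int n" by (rule mod_diff_cong[OF that(1) refl])
      thus ?thesis using that(2) bounds by simp
    qed
    have c2: "b = i" if "(a + b) mod int n = (i + j) mod int n" "a = j"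
    proof -
      have "(a + b - a) mod int n = (i + j - a) mod int n" by (rule mod_diff_cong[OF that(1) refl])
      thus ?thesis using that(2) bounds by simp
    qed
    have f: "flip_mat n \<sigma> $$ (p, q) = (if a = i \<and> b = j then \<sigma> else 0) + (if a = j \<and> b = i then 1 else 0)"
      unfolding q1[symmetric] q2[symmetric] using pq by (simp add: flip_mat_def)
    show "((\<lambda>Y. (sg n \<eta> Y \<cdot>\<^sub>m Phi_mat n k \<eta> (\<sigma> * Y) Y) $$ (p, q)) \<longlongrightarrow> flip_mat n \<sigma> $$ (p, q)) (at 0)"
    proof (cases "(a + b) mod int n = (i + j) mod int n")
      case True
      have f': "flip_mat n \<sigma> $$ (p, q) = (if a = i then \<sigma> else 0) + (if a = j then 1 else 0)"
        unfolding f using c1[OF True] c2[OF True] by auto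
      show ?thesis unfolding e f' if_P[OF True] by (rule sg_scaled_Phi_limit[OF \<sigma> bounds(1-6)])
    next
      case False
      have "\<not> (a = i \<and> b = j)" "\<not> (a = j \<and> b = i)" using False by (metis, metis add.commute)
      hence f': "flip_mat n \<sigma> $$ (p, q) = 0" unfolding f by (simp only: if_False add_0_left)
      show ?thesis unfolding e f' if_not_P[OF False] by (rule tendsto_const)
    qed
  qed
  moreover have "eventually (\<lambda>Y. sg n \<eta> Y \<noteq> 0) (at 0)"
    unfolding sg_eq_0_iff[OF n eta] by (rule lattice_isolated[OF neta[OF n eta]])
  ultimately show ?thesis by eventually_elim (simp add: kernel_dim_smult[OF Phi_mat_carrier])
qed

lemma double_isolated: "eventually (\<lambda>Y. 2 * Y \<notin> period_lattice \<eta>) (at p)"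
proof -
  have "filterlim (\<lambda>Y. 2 * Y) (at (2 * p)) (at p)"
    by (auto simp: filterlim_at eventually_at_filter intro!: tendsto_intros)
  from filterlim_iff[THEN iffD1, OF this] lattice_isolated[OF eta, of "2 * p"] show ?thesis by auto
qed

text \<open>The two nullities are upper semicontinuous in \<open>Y\<close> and have constant sum, so they are locally constant
  on the connected complement of the half-lattice; the limit \<open>Y \<rightarrow> 0\<close> identifies the values.\<close>
lemma kernel_dim_generic:
  assumes Y: "2 * Y \<notin> period_lattice \<eta>"
  shows "kernel_dim (Phi_mat n k \<eta> Y Y) = n choose 2" "kernel_dim (Phi_mat n k \<eta> (- Y) Y) = (n + 1) choose 2"
proof -
  define U where "U = - {Y. 2 * Y \<in> period_lattice \<eta>}"
  define b where "b Y = kernel_dim (Phi_mat n k \<eta> (- Y) Y)" for Y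
  define a where "a Y = kernel_dim (Phi_mat n k \<eta> Y Y)" for Y
  have ab: "a Y + b Y = n * n" if "Y \<in> U" for Y using kernel_dim_sum that by (simp add: U_def a_def b_def)
  have "{Y. 2 * Y \<in> period_lattice \<eta>} \<subseteq> range (\<lambda>(c, d). (of_int c + of_int d * \<eta>) / 2)"
  proof
    fix Y assume "Y \<in> {Y. 2 * Y \<in> period_lattice \<eta>}"
    then obtain c d where "2 * Y = of_int c + of_int d * \<eta>" unfolding period_lattice_def by blast
    thus "Y \<in> range (\<lambda>(c, d). (of_int c + of_int d * \<eta>) / 2)"
      by (intro range_eqI[of _ _ "(c, d)"]) (simp add: field_simps)
  qed
  hence "countable {Y. 2 * Y \<in> period_lattice \<eta>}" by (rule countable_subset) simp
  hence conn: "connected U" unfolding U_def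
    by (intro path_connected_imp_connected path_connected_complement_countable) simp_all
  have const: "b Y1 = b Y2" if Y1: "Y1 \<in> U" and Y2: "Y2 \<in> U" for Y1 Y2
  proof (rule connected_induction_simple[OF conn, of Y1 Y2 "\<lambda>y. b Y1 = b y"])
    fix Y0 assume Y0: "Y0 \<in> U"
    hence "2 * Y0 \<notin> period_lattice \<eta>" unfolding U_def by blast
    hence Y0': "Y0 \<notin> period_lattice \<eta>" by (rule notin_lattice_of_double)
    have "eventually (\<lambda>Y. b Y \<le> b Y0 \<and> a Y \<le> a Y0) (at Y0)"
      using eventually_conj[OF kernel_dim_semicontinuous[OF Y0' disjI2[OF refl]] kernel_dim_semicontinuous[OF Y0' disjI1[OF refl]]]
      unfolding a_def b_def by (simp only: mult_minus1 mult_1)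
    then obtain r where r: "r > 0" "\<And>Y. Y \<noteq> Y0 \<Longrightarrow> dist Y Y0 < r \<Longrightarrow> b Y \<le> b Y0 \<and> a Y \<le> a Y0"
      unfolding eventually_at by auto
    have eq: "b Y = b Y0" if "Y \<in> U \<inter> ball Y0 r" for Y
    proof (cases "Y = Y0")
      case False
      hence "b Y \<le> b Y0" "a Y \<le> a Y0" using r(2)[of Y] that by (auto simp: dist_commute)
      thus ?thesis using ab[of Y] ab[OF Y0] that by simp
    qed simp
    show "\<exists>T. openin (top_of_set U) T \<and> Y0 \<in> T \<and> (\<forall>x\<in>T. \<forall>y\<in>T. b Y1 = b x \<longrightarrow> b Y1 = b y)"
    proof (intro exI conjI ballI impI)
      show "openin (top_of_set U) (U \<inter> ball Y0 r)" by (rule openin_open_Int) simp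
      show "Y0 \<in> U \<inter> ball Y0 r" using Y0 r(1) by simp
      fix x y assume "x \<in> U \<inter> ball Y0 r" "y \<in> U \<inter> ball Y0 r" "b Y1 = b x"
      thus "b Y1 = b y" using eq[of x] eq[of y] by simp
    qed
  qed (use Y1 Y2 in auto)
  \<comment> \<open>A single point close to 0 and off the half-lattice satisfies both upper bounds;
    as these add up to \<open>n * n\<close>, both are attained there.\<close>
  have "eventually (\<lambda>Y. b Y \<le> kernel_dim (flip_mat n (- 1)) \<and> a Y \<le> kernel_dim (flip_mat n 1) \<and> Y \<in> U) (at 0)"
    using eventually_conj[OF kernel_dim_near_0[OF disjI2[OF refl]] eventually_conj[OF kernel_dim_near_0[OF disjI1[OF refl]] double_isolated[of 0]]]
    unfolding a_def b_def U_def by (simp only: mult_minus1 mult_1 Compl_iff mem_Collect_eq)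
  then obtain Y0 where Y0: "b Y0 \<le> kernel_dim (flip_mat n (- 1))" "a Y0 \<le> kernel_dim (flip_mat n 1)" "Y0 \<in> U"
    using eventually_happens'[OF at_neq_bot] by blast
  have "b Y0 \<le> (n + 1) choose 2" "a Y0 \<le> n choose 2" using Y0 kernel_dim_flip_mat[OF n] by linarith+
  hence "b Y0 = (n + 1) choose 2" using ab[OF Y0(3)] choose_sum_square[of n] by linarith
  moreover have YU: "Y \<in> U" using Y by (simp add: U_def)
  ultimately have bY: "b Y = (n + 1) choose 2" using const[OF YU Y0(3)] by simp
  thus "kernel_dim (Phi_mat n k \<eta> (- Y) Y) = (n + 1) choose 2" by (simp add: b_def)
  have "a Y = n choose 2" using bY ab[OF YU] choose_sum_square[of n] by linarith
  thus "kernel_dim (Phi_mat n k \<eta> Y Y) = n choose 2" by (simp add: a_def)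
qed

text \<open>Points close to \<open>Y\<close> and off the half-lattice have the generic nullity, and
  the nullity can only go up in the limit. This is what remains at half-lattice points.\<close>

lemma kernel_dim_ge_limit:
  assumes "Y \<notin> period_lattice \<eta>"
  shows "kernel_dim (Phi_mat n k \<eta> (- Y) Y) \<ge> (n + 1) choose 2"
proof -
  have "eventually (\<lambda>Y'. kernel_dim (Phi_mat n k \<eta> (- 1 * Y') Y') \<le> kernel_dim (Phi_mat n k \<eta> (- 1 * Y) Y) \<and> 2 * Y' \<notin> period_lattice \<eta>) (at Y)"
    by (rule eventually_conj[OF kernel_dim_semicontinuous[OF assms disjI2[OF refl]] double_isolated])
  then obtain Y' where "kernel_dim (Phi_mat n k \<eta> (- 1 * Y') Y') \<le> kernel_dim (Phi_mat n k \<eta> (- 1 * Y) Y)" "2 * Y' \<notin> period_lattice \<eta>"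
    using eventually_happens'[OF at_neq_bot] by blast
  thus ?thesis using kernel_dim_generic(2)[of Y'] by simp
qed

text \<open>The conditional exponent treats zeros and other points by one formula, with
  \<open>H\<close> nonzero at \<open>p\<close> either way, so the order of the determinant can be
  read off without a case distinction.\<close>

lemma tht_linear_order:
  obtains H where "H holomorphic_on UNIV" "H p \<noteq> 0"
    "\<And>z. tht \<eta> (- (of_nat n * z) + c) = (z - p) ^ (if - (of_nat n * p) + c \<in> period_lattice \<eta> then 1 else 0) * H z"
proof (cases "- (of_nat n * p) + c \<in> period_lattice \<eta>")
  case True
  obtain G where G: "G holomorphic_on UNIV" "G (- (of_nat n * p) + c) \<noteq> 0" "\<And>z. tht \<eta> z = (z - (- (of_nat n * p) + c)) * G z"
    by (rule tht_local[OF eta True], rule that)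
  have "(\<lambda>z. - (of_nat n * z) + c) holomorphic_on UNIV" by (intro holomorphic_intros)
  from holomorphic_on_compose_gen[OF this G(1)] have "(\<lambda>z. G (- (of_nat n * z) + c)) holomorphic_on UNIV" by (simp add: o_def)
  hence "(\<lambda>z. - of_nat n * G (- (of_nat n * z) + c)) holomorphic_on UNIV" by (intro holomorphic_intros)
  thus thesis using True G(2) n
    by (intro that[of "\<lambda>z. - of_nat n * G (- (of_nat n * z) + c)"]) (auto simp: G(3) algebra_simps)
next
  case False
  have "(\<lambda>z. tht \<eta> (- (of_nat n * z) + c)) holomorphic_on UNIV" by (intro holomorphic_intros holomorphic_on_tht[OF eta])
  thus thesis using False by (intro that[of "\<lambda>z. tht \<eta> (- (of_nat n * z) + c)"]) (auto simp: tht_eq_0_iff[OF eta])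
qed

text \<open>Since X = - n z, the zero at \<open>Y\<close> belongs to \<open>- \<tau>\<close> and
  that at \<open>- Y\<close> to \<open>\<tau>\<close>, so the larger binomial goes with
  \<open>p - \<tau>\<close>. The two classes are disjoint because \<open>2 * Y\<close> is not a
  lattice point.\<close>

lemma det_R_mat_zeros:
  assumes \<tau>: "\<tau> \<notin> lattice_n (2 * n) \<eta>" and n2: "n \<ge> 2"
  defines "e \<equiv> \<lambda>p. if p - \<tau> \<in> lattice_n n \<eta> then (n + 1) choose 2 else if p + \<tau> \<in> lattice_n n \<eta> then n choose 2 else 0"
  shows "zorder (\<lambda>z. det (R_mat n k \<eta> \<tau> z)) p = int (e p)"
    "det (R_mat n k \<eta> \<tau> p) = 0 \<longleftrightarrow> p - \<tau> \<in> lattice_n n \<eta> \<or> p + \<tau> \<in> lattice_n n \<eta>"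
    "kernel_dim (R_mat n k \<eta> \<tau> p) = e p"
proof -
  define Y where "Y = of_nat n * \<tau>"
  have Y2: "2 * Y \<notin> period_lattice \<eta>" using \<tau> n by (simp add: lattice_n_iff Y_def mult.assoc)
  have Y: "Y \<notin> period_lattice \<eta>" using Y2 by (rule notin_lattice_of_double)
  obtain K l where K: "K \<noteq> 0" "\<And>X. det (R_mat n k \<eta> \<tau> (- (X / of_nat n))) =
      K * exp (l * X) * tht \<eta> (X - Y) ^ (n choose 2) * tht \<eta> (X - (- Y)) ^ (n + 1 choose 2)"
    using det_R_mat_factorization[of \<tau>] Y2 kernel_dim_generic[OF Y2] unfolding Y_def by auto
  have minus: "p - \<tau> \<in> lattice_n n \<eta> \<longleftrightarrow> - (of_nat n * p) + Y \<in> period_lattice \<eta>" for p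
  proof -
    have "- (of_nat n * p) + Y = - (of_nat n * (p - \<tau>))" by (simp add: Y_def algebra_simps)
    thus ?thesis using n by (simp add: lattice_n_iff del: minus_add_distrib)
  qed
  have plus: "p + \<tau> \<in> lattice_n n \<eta> \<longleftrightarrow> - (of_nat n * p) + (- Y) \<in> period_lattice \<eta>" for p
  proof -
    have "- (of_nat n * p) + (- Y) = - (of_nat n * (p + \<tau>))" by (simp add: Y_def algebra_simps)
    thus ?thesis using n by (simp add: lattice_n_iff del: minus_add_distrib)
  qed
  have excl: "\<not> (p - \<tau> \<in> lattice_n n \<eta> \<and> p + \<tau> \<in> lattice_n n \<eta>)" for p
  proof
    assume "p - \<tau> \<in> lattice_n n \<eta> \<and> p + \<tau> \<in> lattice_n n \<eta>"
    hence "(- (of_nat n * p) + Y) - (- (of_nat n * p) + (- Y)) \<in> period_lattice \<eta>"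
      unfolding minus plus by (intro lattice_diff) auto
    moreover have "(- (of_nat n * p) + Y) - (- (of_nat n * p) + (- Y)) = 2 * Y" by simp
    ultimately show False using Y2 by simp
  qed
  have det_eq: "det (R_mat n k \<eta> \<tau> z) = K * exp (l * (- (of_nat n * z))) * tht \<eta> (- (of_nat n * z) + (- Y)) ^ (n choose 2)
      * tht \<eta> (- (of_nat n * z) + Y) ^ (n + 1 choose 2)" for z
    using K(2)[of "- (of_nat n * z)"] n by simp
  obtain H1 where H1: "H1 holomorphic_on UNIV" "H1 p \<noteq> 0"
    "\<And>z. tht \<eta> (- (of_nat n * z) + Y) = (z - p) ^ (if - (of_nat n * p) + Y \<in> period_lattice \<eta> then 1 else 0) * H1 z"
    by (rule tht_linear_order, rule that)
  obtain H2 where H2: "H2 holomorphic_on UNIV" "H2 p \<noteq> 0"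
    "\<And>z. tht \<eta> (- (of_nat n * z) + (- Y)) = (z - p) ^ (if - (of_nat n * p) + (- Y) \<in> period_lattice \<eta> then 1 else 0) * H2 z"
    by (rule tht_linear_order, rule that)
  define g where "g z = K * exp (l * (- (of_nat n * z))) * H2 z ^ (n choose 2) * H1 z ^ (n + 1 choose 2)" for z
  have gh: "g holomorphic_on UNIV" unfolding g_def[abs_def] by (intro holomorphic_intros H1 H2)
  have gp: "g p \<noteq> 0" unfolding g_def using K(1) H1(2) H2(2) by simp
  have det_g: "det (R_mat n k \<eta> \<tau> z) = g z * (z - p) ^ e p" for z
  proof -
    have e: "e p = (if - (of_nat n * p) + (- Y) \<in> period_lattice \<eta> then 1 else 0) * (n choose 2) + (if - (of_nat n * p) + Y \<in> period_lattice \<eta> then 1 else 0) * (n + 1 choose 2)"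
      unfolding e_def using excl[of p] unfolding minus plus by auto
    have gen: "K * E * (w ^ i * h2) ^ M * (w ^ j * h1) ^ N = (K * E * h2 ^ M * h1 ^ N) * w ^ (i * M + j * N)"
      for E w h1 h2 and i j M N :: nat
      by (simp add: power_mult_distrib power_add power_mult)
    show ?thesis unfolding det_eq H1(3) H2(3) g_def e by (rule gen)
  qed
  show "zorder (\<lambda>z. det (R_mat n k \<eta> \<tau> z)) p = int (e p)"
    by (rule zorder_eqI[OF open_UNIV UNIV_I gh gp]) (simp add: det_g)
  show d0: "det (R_mat n k \<eta> \<tau> p) = 0 \<longleftrightarrow> p - \<tau> \<in> lattice_n n \<eta> \<or> p + \<tau> \<in> lattice_n n \<eta>"
  proof -
    have pos: "n + 1 choose 2 \<noteq> 0" using n by (simp add: numeral_2_eq_2)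
    \<comment> \<open>For n = 1 this exponent would be zero, and the class of
      \<open>- \<tau>\<close> would not consist of zeros of the determinant.\<close>
    have "n choose 2 \<noteq> 0" using n2 by simp
    thus ?thesis unfolding det_eq minus plus using K(1) pos by (auto simp: tht_eq_0_iff[OF eta])
  qed
  have \<tau>': "of_nat n * \<tau> \<notin> period_lattice \<eta>" using Y by (simp add: Y_def)
  show "kernel_dim (R_mat n k \<eta> \<tau> p) = e p"
  proof -
    consider "p - \<tau> \<in> lattice_n n \<eta>" | "p + \<tau> \<in> lattice_n n \<eta>" "p - \<tau> \<notin> lattice_n n \<eta>" | "p - \<tau> \<notin> lattice_n n \<eta>" "p + \<tau> \<notin> lattice_n n \<eta>" by blast
    thus ?thesis
    proof cases
      case 1
      hence w: "of_nat n * (p - \<tau>) \<in> period_lattice \<eta>" using n by (simp add: lattice_n_iff)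
      have np: "of_nat n * p \<notin> period_lattice \<eta>" using Y lattice_diff[OF _ w, of "of_nat n * p"] by (auto simp: Y_def algebra_simps)
      have "- (of_nat n * p) = - Y + (- (of_nat n * (p - \<tau>)))" by (simp add: Y_def algebra_simps)
      hence "kernel_dim (Phi_mat n k \<eta> (- (of_nat n * p)) Y) = kernel_dim (Phi_mat n k \<eta> (- Y) Y)"
        using kernel_dim_Phi_mat_shift[OF n eta cop, of "- (of_nat n * (p - \<tau>))" "- Y" Y] w by simp
      thus ?thesis using R_mat_smult_kernel_dim[OF n eta cop \<tau>' np] kernel_dim_generic(2)[OF Y2] 1 by (simp add: e_def Y_def)
    next
      case 2
      hence w: "of_nat n * (p + \<tau>) \<in> period_lattice \<eta>" using n by (simp add: lattice_n_iff)
      have np: "of_nat n * p \<notin> period_lattice \<eta>" using Y lattice_diff[OF w, of "of_nat n * p"] by (auto simp: Y_def algebra_simps)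
      have "- (of_nat n * p) = Y + (- (of_nat n * (p + \<tau>)))" by (simp add: Y_def algebra_simps)
      hence "kernel_dim (Phi_mat n k \<eta> (- (of_nat n * p)) Y) = kernel_dim (Phi_mat n k \<eta> Y Y)"
        using kernel_dim_Phi_mat_shift[OF n eta cop, of "- (of_nat n * (p + \<tau>))" Y Y] w by simp
      thus ?thesis using R_mat_smult_kernel_dim[OF n eta cop \<tau>' np] kernel_dim_generic(1)[OF Y2] 2 by (simp add: e_def Y_def)
    next
      case 3
      thus ?thesis using kernel_dim_0[OF R_mat_carrier, of n k \<eta> \<tau> p] d0 by (simp add: e_def)
    qed
  qed
qed

end

theorem theorem5p7:
  fixes n k :: nat and \<eta> :: complex
  assumes "1 \<le> k" and "k < n" and "coprime n k" and "Im \<eta> > 0"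
  shows
   "(\<forall>\<tau>. \<tau> \<notin> lattice_n (2 * n) \<eta> \<longrightarrow>
       (\<forall>z. invertible_mat (R_mat n k \<eta> \<tau> z) \<longleftrightarrow>
              (z - \<tau> \<notin> lattice_n n \<eta> \<and> z + \<tau> \<notin> lattice_n n \<eta>))
     \<and> (\<forall>\<zeta>\<in>lattice_n n \<eta>.
          mat_image (R_mat n k \<eta> \<tau> (\<tau> + \<zeta>)) = mat_kernel (R_mat n k \<eta> \<tau> (- \<tau> - \<zeta>)) \<and>
          mat_image (R_mat n k \<eta> \<tau> (- \<tau> - \<zeta>)) = mat_kernel (R_mat n k \<eta> \<tau> (\<tau> + \<zeta>)))
     \<and> (\<forall>p. zorder (\<lambda>z. det (R_mat n k \<eta> \<tau> z)) p = int (kernel_dim (R_mat n k \<eta> \<tau> p))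
          \<and> kernel_dim (R_mat n k \<eta> \<tau> p) =
              (if p - \<tau> \<in> lattice_n n \<eta> then (n + 1) choose 2
               else if p + \<tau> \<in> lattice_n n \<eta> then n choose 2 else 0)))
  \<and> (\<forall>\<tau>. \<tau> \<in> lattice_n (2 * n) \<eta> \<and> \<tau> \<notin> lattice_n n \<eta> \<longrightarrow>
       kernel_dim (R_mat n k \<eta> \<tau> \<tau>) = kernel_dim (R_mat n k \<eta> \<tau> (- \<tau>)) \<and>
       kernel_dim (R_mat n k \<eta> \<tau> \<tau>) \<ge> (n + 1) choose 2)"
proof (intro conjI allI impI)
  have n: "n > 0" and n2: "n \<ge> 2" using assms by auto
  note ctx = n assms(4) assms(3)
  {
    fix \<tau> assume \<tau>: "\<tau> \<notin> lattice_n (2 * n) \<eta>"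
    note zeros = det_R_mat_zeros[OF ctx \<tau> n2]
    show "invertible_mat (R_mat n k \<eta> \<tau> z) \<longleftrightarrow> (z - \<tau> \<notin> lattice_n n \<eta> \<and> z + \<tau> \<notin> lattice_n n \<eta>)" for z
      using invertible_mat_iff_det[OF R_mat_carrier, of n k \<eta> \<tau> z] zeros(2)[of z] by simp
    show "zorder (\<lambda>z. det (R_mat n k \<eta> \<tau> z)) p = int (kernel_dim (R_mat n k \<eta> \<tau> p))" for p
      unfolding zeros(1) zeros(3) ..
    show "kernel_dim (R_mat n k \<eta> \<tau> p) = (if p - \<tau> \<in> lattice_n n \<eta> then (n + 1) choose 2
        else if p + \<tau> \<in> lattice_n n \<eta> then n choose 2 else 0)" for p
      by (rule zeros(3))
    show "\<forall>\<zeta>\<in>lattice_n n \<eta>.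
          mat_image (R_mat n k \<eta> \<tau> (\<tau> + \<zeta>)) = mat_kernel (R_mat n k \<eta> \<tau> (- \<tau> - \<zeta>)) \<and>
          mat_image (R_mat n k \<eta> \<tau> (- \<tau> - \<zeta>)) = mat_kernel (R_mat n k \<eta> \<tau> (\<tau> + \<zeta>))"
    proof
      fix \<zeta> assume \<zeta>: "\<zeta> \<in> lattice_n n \<eta>"
      hence w: "of_nat n * \<zeta> \<in> period_lattice \<eta>" using n by (simp add: lattice_n_iff)
      have Y2: "2 * (of_nat n * \<tau>) \<notin> period_lattice \<eta>" using \<tau> n by (simp add: lattice_n_iff mult.assoc)
      have Y: "of_nat n * \<tau> \<notin> period_lattice \<eta>"
        using Y2 by (rule notin_lattice_of_double)
      have z: "of_nat n * (\<tau> + \<zeta>) \<notin> period_lattice \<eta>"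
        using Y lattice_add_iff[OF w, of "of_nat n * \<tau>"] by (simp add: distrib_left)
      have z': "- \<tau> - \<zeta> = - (\<tau> + \<zeta>)" by simp
      let ?A = "R_mat n k \<eta> \<tau> (\<tau> + \<zeta>)" and ?B = "R_mat n k \<eta> \<tau> (- (\<tau> + \<zeta>))"
      \<comment> \<open>Unitarity at \<open>\<tau> + \<zeta>\<close> applies because its difference
        from \<open>\<tau>\<close> lies in the lattice, and at \<open>- (\<tau> + \<zeta>)\<close>
        because its sum with \<open>\<tau>\<close> does; each gives one of the two vanishing
        products.\<close>
      have AB: "?A * ?B = 0\<^sub>m (n * n) (n * n)"
        by (rule R_mat_unitarity[OF ctx Y z]) (use w in simp)
      have "?B * R_mat n k \<eta> \<tau> (- (- (\<tau> + \<zeta>))) = 0\<^sub>m (n * n) (n * n)"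
      proof (rule R_mat_unitarity[OF ctx Y])
        have "of_nat n * (- (\<tau> + \<zeta>)) = - (of_nat n * (\<tau> + \<zeta>))" by (rule mult_minus_right)
        thus "of_nat n * (- (\<tau> + \<zeta>)) \<notin> period_lattice \<eta>" using z by (simp only: lattice_uminus_iff not_False_eq_True)
        have "of_nat n * (- (\<tau> + \<zeta>) + \<tau>) = - (of_nat n * \<zeta>)" by (simp add: algebra_simps)
        thus "of_nat n * (- (\<tau> + \<zeta>) - \<tau>) \<in> period_lattice \<eta> \<or> of_nat n * (- (\<tau> + \<zeta>) + \<tau>) \<in> period_lattice \<eta>"
          using w by (simp only: lattice_uminus_iff simp_thms)
      qed
      hence BA: "?B * ?A = 0\<^sub>m (n * n) (n * n)" by (simp only: minus_minus)
      have kA: "kernel_dim ?A = (n + 1) choose 2" unfolding zeros(3) using \<zeta> by simp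
      have "\<not> - (\<tau> + \<zeta>) - \<tau> \<in> lattice_n n \<eta>"
      proof
        assume "- (\<tau> + \<zeta>) - \<tau> \<in> lattice_n n \<eta>"
        hence "of_nat n * (- (\<tau> + \<zeta>) - \<tau>) \<in> period_lattice \<eta>" using n by (simp add: lattice_n_iff)
        from lattice_add[OF this w] have "- (2 * (of_nat n * \<tau>)) \<in> period_lattice \<eta>" by (simp add: algebra_simps)
        thus False using Y2 by (simp only: lattice_uminus_iff)
      qed
      moreover have "- (\<tau> + \<zeta>) + \<tau> \<in> lattice_n n \<eta>" using w n by (simp add: lattice_n_iff)
      ultimately have kB: "kernel_dim ?B = n choose 2" unfolding zeros(3) by simp
      have "kernel_dim ?A + kernel_dim ?B = n * n" "kernel_dim ?B + kernel_dim ?A = n * n"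
        unfolding kA kB using choose_sum_square[of n] by simp_all
      thus "mat_image (R_mat n k \<eta> \<tau> (\<tau> + \<zeta>)) = mat_kernel (R_mat n k \<eta> \<tau> (- \<tau> - \<zeta>)) \<and>
          mat_image (R_mat n k \<eta> \<tau> (- \<tau> - \<zeta>)) = mat_kernel (R_mat n k \<eta> \<tau> (\<tau> + \<zeta>))"
        unfolding z' using image_eq_kernel_of_zero_product[OF R_mat_carrier R_mat_carrier] AB BA by blast
    qed
  }
  {
    fix \<tau> assume \<tau>: "\<tau> \<in> lattice_n (2 * n) \<eta> \<and> \<tau> \<notin> lattice_n n \<eta>"
    let ?Y = "of_nat n * \<tau>"
    have Y2: "2 * ?Y \<in> period_lattice \<eta>" and Y: "?Y \<notin> period_lattice \<eta>" using \<tau> n by (simp_all add: lattice_n_iff mult.assoc)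
    have k1: "kernel_dim (R_mat n k \<eta> \<tau> \<tau>) = kernel_dim (Phi_mat n k \<eta> (- ?Y) ?Y)"
      by (rule R_mat_smult_kernel_dim[OF ctx Y Y])
    have "kernel_dim (R_mat n k \<eta> \<tau> (- \<tau>)) = kernel_dim (Phi_mat n k \<eta> ?Y ?Y)"
      using R_mat_smult_kernel_dim[OF ctx Y, of "- \<tau>"] Y by simp
    also have "\<dots> = kernel_dim (Phi_mat n k \<eta> (- ?Y) ?Y)"
    proof -
      \<comment> \<open>On the half-lattice \<open>2 * ?Y\<close> is a period, so the two matrices
        differ by a lattice translation.\<close>
      have "- ?Y + 2 * ?Y = ?Y" by simp
      thus ?thesis using kernel_dim_Phi_mat_shift[OF ctx Y2, of "- ?Y" ?Y] by (simp only:)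
    qed
    finally show "kernel_dim (R_mat n k \<eta> \<tau> \<tau>) = kernel_dim (R_mat n k \<eta> \<tau> (- \<tau>))" using k1 by simp
    show "kernel_dim (R_mat n k \<eta> \<tau> \<tau>) \<ge> (n + 1) choose 2"
      unfolding k1 by (rule kernel_dim_ge_limit[OF ctx Y])
  }
qed

end
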